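(* Let $X$, $Y$ be Gaussian random vectors in $\mathbb{R}^d$ with $\mathsf{E}X=\mu_X$, $\mathsf{E}Y=\mu_Y$ and nondegenerate covariance matrices $\Sigma_X$ and $\Sigma_Y$, respectively. Then, for any fixed $k,l\in\mathbb{N}$, $$\lim_{n,m\to\infty}\mathsf{E}\,\widehat{D}_{n,m}(k,l)=D(\mathsf{P}_X\|\mathsf{P}_Y)\quad\text{and}\quad\lim_{n,m\to\infty}\mathsf{E}\left(\widehat{D}_{n,m}(k,l)-D(\mathsf{P}_X\|\mathsf{P}_Y)\right)^2=0,$$ where $$D(\mathsf{P}_X\|\mathsf{P}_Y)=\frac12\left(\mathrm{tr}\left(\Sigma_Y^{-1}\Sigma_X\right)+(\mu_Y-\mu_X)^T\Sigma_Y^{-1}(\mu_Y-\mu_X)-d+\log\left(\frac{\det\Sigma_Y}{\det\Sigma_X}\right)\right).$$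
   Context: $\mathsf{P}_X,\mathsf{P}_Y$ are the laws of $X,Y$, with Lebesgue densities $p,q$, and $D(\mathsf{P}_X\|\mathsf{P}_Y)=\int_{\mathbb{R}^d}p(x)\log\frac{p(x)}{q(x)}\,dx$ is the Kullback-Leibler divergence (natural logarithm). Estimator: $X_1,X_2,\ldots$ are i.i.d. with the law of $X$, $Y_1,Y_2,\ldots$ are i.i.d. with the law of $Y$, and all the vectors $X_i,Y_i$, $i\in\mathbb{N}$, are independent. $\|\cdot\|$ is the Euclidean norm. $\mathbb{X}_n=\{X_1,\ldots,X_n\}$, $\mathbb{Y}_m=\{Y_1,\ldots,Y_m\}$ (almost surely all points are distinct). For a finite set $E$ and a point $v$, $z_{(k)}(v,E)$ denotes the $k$-th nearest neighbor of $v$ in $E$ (ties broken by increasing index). For $n\ge k+1$, $m\ge l$, $i=1,\ldots,n$ let $R_{n,k}(i)=\|X_i-X_{(k)}(X_i,\mathbb{X}_n\setminus\{X_i\})\|$ (distance from $X_i$ to its $k$-th nearest neighbor among the other $X_j$) and $V_{m,l}(i)=\|X_i-Y_{(l)}(X_i,\mathbb{Y}_m)\|$ (distance from $X_i$ to its $l$-th nearest neighbor in $\mathbb{Y}_m$). Put $$\widehat{D}_{n,m}(k,l)=\psi(k)-\psi(l)+\frac1n\sum_{i=1}^n\log\left(\frac{m\,V_{m,l}^d(i)}{(n-1)\,R_{n,k}^d(i)}\right),$$ where $\psi(t)=\Gamma'(t)/\Gamma(t)$ is the digamma function. *)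

theory Defs
  imports "HOL-Probability.Probability"
begin

definition std_gaussian :: "(real ^ 'd) measure" where
  "std_gaussian = density lborel (\<lambda>z. ennreal (\<Prod>i\<in>UNIV. std_normal_density (z $ i)))"

(* Gaussian vectors are the affine images, in law, of a standard Gaussian vector.  A may be
   singular, so degenerate Gaussian vectors are included; a square A is no restriction, since
   every covariance matrix S has a square root with S = A ** transpose A. *)
definition gaussian_vector :: "'a measure \<Rightarrow> ('a \<Rightarrow> real ^ 'd) \<Rightarrow> bool" where
  "gaussian_vector M X \<longleftrightarrow> X \<in> borel_measurable M \<and>
     (\<exists>(A :: real ^ 'd ^ 'd) b. distr M borel X = distr std_gaussian borel (\<lambda>z. A *v z + b))"

definition covariance_matrix :: "'a measure \<Rightarrow> ('a \<Rightarrow> real ^ 'd) \<Rightarrow> real ^ 'd ^ 'd" where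
  "covariance_matrix M X =
     (\<chi> i j. \<integral>\<omega>. (X \<omega> $ i - (\<integral>\<omega>'. X \<omega>' \<partial>M) $ i) * (X \<omega> $ j - (\<integral>\<omega>'. X \<omega>' \<partial>M) $ j) \<partial>M)"

(* D(P || Q) with natural logarithm.  The library constant takes the reference measure first:
   KL_divergence b Q P integrates log b (dP/dQ) with respect to P.  For densities p, q this is
   the integral of p * ln (p / q), cf. KL_density_density. *)
definition kl_div :: "'b measure \<Rightarrow> 'b measure \<Rightarrow> real" where
  "kl_div P Q = KL_divergence (exp 1) Q P"

(* The k-th (k \<ge> 1) nearest neighbor of v among the points z i, i \<in> I.  The list of indices is
   increasing and sort_key is stable, so ties in distance are broken by increasing index. *)
definition nearest_neighbor ::
    "nat \<Rightarrow> 'b::metric_space \<Rightarrow> (nat \<Rightarrow> 'b) \<Rightarrow> nat set \<Rightarrow> 'b" where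
  "nearest_neighbor k v z I =
     z (sort_key (\<lambda>i. dist v (z i)) (sorted_list_of_set I) ! (k - 1))"

(* In the following definitions the sample points are x 0, ..., x (n - 1) and
   y 0, ..., y (m - 1). *)

definition R_dist :: "(nat \<Rightarrow> real ^ 'd) \<Rightarrow> nat \<Rightarrow> nat \<Rightarrow> nat \<Rightarrow> real" where
  "R_dist x n k i = norm (x i - nearest_neighbor k (x i) x ({..<n} - {i}))"

definition V_dist ::
    "(nat \<Rightarrow> real ^ 'd) \<Rightarrow> (nat \<Rightarrow> real ^ 'd) \<Rightarrow> nat \<Rightarrow> nat \<Rightarrow> nat \<Rightarrow> real" where
  "V_dist x y m l i = norm (x i - nearest_neighbor l (x i) y {..<m})"

definition D_hat ::
    "(nat \<Rightarrow> real ^ 'd) \<Rightarrow> (nat \<Rightarrow> real ^ 'd) \<Rightarrow> nat \<Rightarrow> nat \<Rightarrow> nat \<Rightarrow> nat \<Rightarrow> real" where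
  "D_hat x y k l n m =
     Digamma (real k) - Digamma (real l) +
     (1 / real n) * (\<Sum>i<n. ln (real m * V_dist x y m l i ^ CARD('d) /
                               ((real n - 1) * R_dist x n k i ^ CARD('d))))"

end

theory Submission
  imports Defs "HOL-Real_Asymp.Real_Asymp"
begin

text \<open>
Let Q be the law of Y and V the distance from the query point x to its l-th nearest neighbour
among m points of law Q. By the probability integral transform, U = Q (cball x V) is the l-th
order statistic of m independent uniform variables, and
ln (m * c * V ^ d) = ln (m * U) + ln (c * V ^ d / Q (cball x V)), where c is the volume of the unit
ball. Doing the same for the X-neighbours splits the error of the estimator into averages of three
kinds.

\<^item> ln (m * U), centred at its limiting mean Digamma l. The terms belonging to two query points
decorrelate: the joint law of the two order statistics is given by multinomial counts, which
converge to independent Poisson counts, and Hoeffding's formula carries this over to the mixed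
moment.

\<^item> The volume ratios, which tend to minus the log density as V tends to 0. Gaussian densities are
bounded below by exp (- C * (1 + norm x ^ 2)), which dominates these terms by a square-integrable
variable.

\<^item> The log-likelihood ratio at the query points, centred at the divergence: an ordinary average of
independent variables.

By exchangeability the second moment of each average is controlled by the terms of at most two
query points, so the estimator converges in mean square and hence in mean.
\<close>

section \<open>Order statistics and counts\<close>

text \<open>Since n and m grow independently, every bound must split into quantities governed by n
  alone or by m alone. The logarithmic ranks do not become small one by one: their second moments
  stay bounded and are divided by n, so the cross moment of two query points decides. There one
  sample serves both query points. Around fixed distinct points, balls of mass of order 1/m are
  eventually disjoint, and their counts are exactly multinomial. For X-neighbours each query point
  is moreover a candidate neighbour of the other; dropping it costs an event of probability of order
  1/m. Logarithms are unbounded, so convergence of tails needs a majorant uniform in m. Tails are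
  bounded by the square of an integrable b: whatever the dependence, the joint tail at (s, t) is
  then below b(s) * b(t). The limiting mean is an integral of a Poisson tail. For l = 1 it is the
  limit of ln m minus a harmonic number, that is, minus Euler's constant; each further l adds 1 / l,
  as in the recurrence of the digamma function.\<close>

definition order_stat :: "nat \<Rightarrow> ('i \<Rightarrow> real) \<Rightarrow> 'i set \<Rightarrow> real" where
  "order_stat k f I = sorted_list_of_multiset (image_mset f (mset_set I)) ! (k - 1)"

text \<open>A downward-closed \<open>P\<close> holds on an initial segment of a sorted list, and
  \<open>filter\<close> returns exactly that segment.\<close>

lemma sorted_nth_iff_less_length_filter:
  assumes "sorted xs" "j < length xs" "\<And>x y. x \<le> y \<Longrightarrow> P y \<Longrightarrow> P x"
  shows "P (xs ! j) \<longleftrightarrow> j < length (filter P xs)"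
  using assms(1,2)
proof (induction xs arbitrary: j)
  case (Cons a xs)
  show ?case
  proof (cases j)
    case 0
    have "filter P xs = []" if "\<not> P a"
      using Cons.prems that assms(3) by (auto simp: filter_empty_conv)
    then show ?thesis
      using 0 by auto
  next
    case (Suc i)
    have "P a" if "P (xs ! i)"
      using assms(3)[OF _ that] Cons.prems Suc by auto
    moreover have "filter P xs = []" if "\<not> P a"
      using Cons.prems that assms(3) by (auto simp: filter_empty_conv)
    ultimately show ?thesis
      using Cons.IH[of i] Cons.prems Suc by auto
  qed
qed simp

text \<open>Counting replaces sorting. A general downward-closed \<open>P\<close> covers half-lines
  as well as their preimages under a monotone map, which \<open>mono_order_stat\<close>
  uses.\<close>

lemma order_stat_iff_card:
  assumes "finite I" "1 \<le> k" "k \<le> card I" "\<And>x y. x \<le> y \<Longrightarrow> P y \<Longrightarrow> P x"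
  shows "P (order_stat k f I) \<longleftrightarrow> k \<le> card {i\<in>I. P (f i)}"
proof -
  let ?xs = "sorted_list_of_multiset (image_mset f (mset_set I))"
  have "length ?xs = card I"
    by (metis mset_sorted_list_of_multiset size_image_mset size_mset size_mset_set)
  moreover have "length (filter P ?xs) = card {i\<in>I. P (f i)}"
  proof -
    have "length (filter P ?xs) = size (filter_mset P (image_mset f (mset_set I)))"
      by (metis mset_filter mset_sorted_list_of_multiset size_mset)
    also have "\<dots> = card {i\<in>I. P (f i)}"
      using \<open>finite I\<close> by (simp add: filter_mset_image_mset filter_mset_mset_set)
    finally show ?thesis .
  qed
  ultimately show ?thesis
    using sorted_nth_iff_less_length_filter[of ?xs "k - 1" P] assms
    unfolding order_stat_def by auto
qed

lemma order_stat_le_iff: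
  assumes "finite I" "1 \<le> k" "k \<le> card I"
  shows "order_stat k f I \<le> r \<longleftrightarrow> k \<le> card {i\<in>I. f i \<le> r}"
  by (rule order_stat_iff_card[OF assms]) auto

lemma order_stat_gt_iff:
  assumes "finite I" "1 \<le> k" "k \<le> card I"
  shows "r < order_stat k f I \<longleftrightarrow> card {i\<in>I. f i \<le> r} < k"
  using order_stat_le_iff[OF assms] by (meson not_le)

lemma order_stat_in_image:
  assumes "finite I" "1 \<le> k" "k \<le> card I"
  shows "order_stat k f I \<in> f ` I"
proof -
  let ?xs = "sorted_list_of_multiset (image_mset f (mset_set I))"
  have "length ?xs = card I"
    by (metis mset_sorted_list_of_multiset size_image_mset size_mset size_mset_set)
  then have "?xs ! (k - 1) \<in> set ?xs"
    using assms by (intro nth_mem) auto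
  then show ?thesis
    using assms by (simp add: order_stat_def)
qed

text \<open>Both sides lie below the same reals, because the set of x with F x <= r is downward
  closed. \<open>F\<close> may be constant on intervals; with \<open>F = ball_prob x\<close> a
  neighbour distance turns into the rank U of the overview.\<close>

lemma mono_order_stat:
  assumes "finite I" "1 \<le> k" "k \<le> card I" "mono F"
  shows "F (order_stat k f I) = order_stat k (\<lambda>i. F (f i)) I"
proof -
  have "F (order_stat k f I) \<le> r \<longleftrightarrow> order_stat k (\<lambda>i. F (f i)) I \<le> r" for r
  proof -
    have "F (order_stat k f I) \<le> r \<longleftrightarrow> k \<le> card {i\<in>I. F (f i) \<le> r}"
      by (rule order_stat_iff_card[OF assms(1-3)]) (meson assms(4) monoD order_trans)
    then show ?thesis
      using order_stat_le_iff[OF assms(1-3)] by simp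
  qed
  from this[of "F (order_stat k f I)"] this[of "order_stat k (\<lambda>i. F (f i)) I"]
  show ?thesis
    by simp
qed

lemma order_stat_reindex:
  assumes "inj_on \<pi> I"
  shows "order_stat k f (\<pi> ` I) = order_stat k (\<lambda>i. f (\<pi> i)) I"
  unfolding order_stat_def image_mset_mset_set[OF assms, symmetric]
  by (simp add: multiset.map_comp comp_def)

lemma order_stat_mono_set:
  assumes "finite J" "1 \<le> k" "k \<le> card I" "I \<subseteq> J"
  shows "order_stat k f J \<le> order_stat k f I"
proof -
  have "k \<le> card {i\<in>I. f i \<le> order_stat k f I}"
    using order_stat_le_iff[of I k f "order_stat k f I"] assms finite_subset by blast
  also have "\<dots> \<le> card {i\<in>J. f i \<le> order_stat k f I}"
    using assms by (intro card_mono) auto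
  finally show ?thesis
    using assms card_mono[of J I] by (subst order_stat_le_iff) auto
qed

text \<open>At least \<open>k\<close> values are below \<open>r\<close> iff some
  \<open>k\<close>-element index set has all its values below \<open>r\<close>, which is a finite
  union of measurable events.\<close>

lemma order_stat_measurable[measurable (raw)]:
  assumes "finite I" "1 \<le> k" "k \<le> card I"
    and [measurable]: "\<And>i. i \<in> I \<Longrightarrow> f i \<in> borel_measurable N"
  shows "(\<lambda>\<omega>. order_stat k (\<lambda>i. f i \<omega>) I) \<in> borel_measurable N"
proof (subst borel_measurable_iff_le, intro allI)
  fix r
  have "{\<omega> \<in> space N. order_stat k (\<lambda>i. f i \<omega>) I \<le> r} =
        (\<Union>S\<in>{S. S \<subseteq> I \<and> card S = k}. {\<omega> \<in> space N. \<forall>i\<in>S. f i \<omega> \<le> r})" (is "?A = ?B")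
  proof (rule set_eqI)
    fix \<omega>
    have "k \<le> card {i\<in>I. f i \<omega> \<le> r} \<longleftrightarrow> (\<exists>S\<subseteq>I. card S = k \<and> (\<forall>i\<in>S. f i \<omega> \<le> r))"
    proof
      assume "k \<le> card {i\<in>I. f i \<omega> \<le> r}"
      then obtain S where "S \<subseteq> {i\<in>I. f i \<omega> \<le> r}" "card S = k"
        by (meson obtain_subset_with_card_n)
      then show "\<exists>S\<subseteq>I. card S = k \<and> (\<forall>i\<in>S. f i \<omega> \<le> r)"
        by blast
    next
      assume "\<exists>S\<subseteq>I. card S = k \<and> (\<forall>i\<in>S. f i \<omega> \<le> r)"
      then obtain S where "S \<subseteq> I" "card S = k" "\<forall>i\<in>S. f i \<omega> \<le> r"
        by blast
      then show "k \<le> card {i\<in>I. f i \<omega> \<le> r}"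
        using card_mono[of "{i\<in>I. f i \<omega> \<le> r}" S] \<open>finite I\<close> by auto
    qed
    then show "\<omega> \<in> ?A \<longleftrightarrow> \<omega> \<in> ?B"
      using order_stat_le_iff[OF assms(1-3), of "\<lambda>i. f i \<omega>" r] by auto
  qed
  also have "\<dots> \<in> sets N"
  proof (intro sets.finite_UN)
    show "finite {S. S \<subseteq> I \<and> card S = k}"
      using \<open>finite I\<close> by simp
    fix S assume S: "S \<in> {S. S \<subseteq> I \<and> card S = k}"
    then have "finite S"
      using \<open>finite I\<close> finite_subset by auto
    then show "{\<omega> \<in> space N. \<forall>i\<in>S. f i \<omega> \<le> r} \<in> sets N"
      using S by (intro sets.sets_Collect_finite_All) auto
  qed
  finally show "?A \<in> sets N" .
qed

text \<open>Tie-breaking decides which point is chosen, never its distance. The distance therefore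
  depends only on the multiset of distances, which is what \<open>order_stat\<close> sorts.\<close>

lemma dist_nearest_neighbor:
  assumes "finite I" "1 \<le> k" "k \<le> card I"
  shows "dist v (nearest_neighbor k v z I) = order_stat k (\<lambda>i. dist v (z i)) I"
proof -
  let ?f = "\<lambda>i. dist v (z i)" and ?xs = "sorted_list_of_set I"
  have "sorted_list_of_multiset (image_mset ?f (mset_set I)) = map ?f (sort_key ?f ?xs)"
  proof -
    have "mset (map ?f ?xs) = image_mset ?f (mset_set I)"
      using \<open>finite I\<close> by (metis mset_map sorted_list_of_mset_set mset_sorted_list_of_multiset)
    then have "sorted_list_of_multiset (image_mset ?f (mset_set I)) = sort (map ?f ?xs)"
      by (metis sorted_list_of_multiset_mset)
    also have "\<dots> = map ?f (sort_key ?f ?xs)"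
      by (intro properties_for_sort) auto
    finally show ?thesis .
  qed
  moreover have "k - 1 < length (sort_key ?f ?xs)"
    using assms by simp
  ultimately show ?thesis
    by (simp add: order_stat_def nearest_neighbor_def)
qed

text \<open>Probability that the first two cells of a multinomial law with cell probabilities
  \<open>u\<close>, \<open>v\<close>, \<open>1 - u - v\<close> both receive fewer than
  \<open>l\<close> of \<open>m\<close> points. Terms with \<open>a + b > m\<close> vanish through a
  binomial coefficient, so truncated subtraction does no harm; \<open>v = 0\<close> leaves the
  binomial case.\<close>

definition multinomial_cdf :: "nat \<Rightarrow> nat \<Rightarrow> real \<Rightarrow> real \<Rightarrow> real" where
  "multinomial_cdf l m u v = (\<Sum>a<l. \<Sum>b<l. real (m choose a) * real ((m - a) choose b) *
     (u ^ a * v ^ b * (1 - u - v) ^ (m - a - b)))"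

text \<open>The event splits according to the index sets \<open>S\<close> and \<open>T\<close> that
  fall into \<open>A\<close> and \<open>B\<close>. Choosing \<open>S\<close> first and
  \<open>T\<close> in its complement yields the two binomial coefficients, and independence gives
  every piece the same probability.\<close>

lemma (in prob_space) prob_counts_eq:
  assumes indep: "indep_vars (\<lambda>_. N) Z {..<m}"
    and A: "A \<in> sets N" and B: "B \<in> sets N" and disj: "A \<inter> B = {}"
    and u: "\<And>j. j < m \<Longrightarrow> prob (Z j -` A \<inter> space M) = u"
    and v: "\<And>j. j < m \<Longrightarrow> prob (Z j -` B \<inter> space M) = v"
  shows "prob {\<omega>\<in>space M. card {j\<in>{..<m}. Z j \<omega> \<in> A} = a \<and> card {j\<in>{..<m}. Z j \<omega> \<in> B} = b} =
    real (m choose a) * real ((m - a) choose b) * (u ^ a * v ^ b * (1 - u - v) ^ (m - a - b))"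
proof -
  have rv[measurable]: "Z j \<in> measurable M N" if "j < m" for j
    using indep that by (auto simp: indep_vars_def)
  define P where "P = (SIGMA S:{S. S \<subseteq> {..<m} \<and> card S = a}. {T. T \<subseteq> {..<m} - S \<and> card T = b})"
  define C where "C = (\<lambda>(S, T) (j::nat). if j \<in> S then A else if j \<in> T then B else space N - (A \<union> B))"
  define E where "E = (\<lambda>ST. {\<omega>\<in>space M. \<forall>j<m. Z j \<omega> \<in> C ST j})"
  have Csets: "C ST j \<in> sets N" for ST j
    using A B by (auto simp: C_def split: prod.splits)
  have pC: "prob (Z j -` (space N - (A \<union> B)) \<inter> space M) = 1 - u - v" if "j < m" for j
  proof -
    have "prob (Z j -` (A \<union> B) \<inter> space M) = u + v"
    proof -
      have "Z j -` (A \<union> B) \<inter> space M = (Z j -` A \<inter> space M) \<union> (Z j -` B \<inter> space M)"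
        by auto
      then show ?thesis
        using disj u[OF that] v[OF that] measurable_sets[OF rv[OF that] A]
          measurable_sets[OF rv[OF that] B]
        by (simp, subst finite_measure_Union) auto
    qed
    moreover have "Z j -` (space N - (A \<union> B)) \<inter> space M = space M - (Z j -` (A \<union> B) \<inter> space M)"
      using measurable_space[OF rv[OF that]] by auto
    ultimately show ?thesis
      using prob_compl[of "Z j -` (A \<union> B) \<inter> space M"] measurable_sets[OF rv[OF that], of "A \<union> B"] A B
      by simp
  qed
  have E_eq: "{j\<in>{..<m}. Z j \<omega> \<in> A} = S \<and> {j\<in>{..<m}. Z j \<omega> \<in> B} = T"
    if "(S, T) \<in> P" "\<omega> \<in> E (S, T)" for S T \<omega>
  proof -
    have ST: "S \<subseteq> {..<m}" "T \<subseteq> {..<m}" "S \<inter> T = {}"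
      using that by (auto simp: P_def)
    have "(Z j \<omega> \<in> A \<longleftrightarrow> j \<in> S) \<and> (Z j \<omega> \<in> B \<longleftrightarrow> j \<in> T)" if "j < m" for j
    proof -
      have "Z j \<omega> \<in> C (S, T) j"
        using \<open>\<omega> \<in> E (S, T)\<close> that by (simp add: E_def)
      then show ?thesis
        using disj ST by (auto simp: C_def split: if_splits)
    qed
    then show ?thesis
      using ST by auto
  qed
  have "{\<omega>\<in>space M. card {j\<in>{..<m}. Z j \<omega> \<in> A} = a \<and> card {j\<in>{..<m}. Z j \<omega> \<in> B} = b} = (\<Union>ST\<in>P. E ST)"
    (is "?L = ?R")
  proof (rule set_eqI)
    fix \<omega>
    show "\<omega> \<in> ?L \<longleftrightarrow> \<omega> \<in> ?R"
    proof
      assume w: "\<omega> \<in> ?L"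
      let ?ST = "({j\<in>{..<m}. Z j \<omega> \<in> A}, {j\<in>{..<m}. Z j \<omega> \<in> B})"
      have "?ST \<in> P"
        using w disj by (auto simp: P_def)
      moreover have "\<omega> \<in> E ?ST"
        using w measurable_space[OF rv, of _ \<omega>] by (auto simp: E_def C_def)
      ultimately show "\<omega> \<in> ?R"
        by blast
    next
      assume "\<omega> \<in> ?R"
      then obtain S T where ST: "(S, T) \<in> P" "\<omega> \<in> E (S, T)"
        by auto
      then have *: "{j\<in>{..<m}. Z j \<omega> \<in> A} = S" "{j\<in>{..<m}. Z j \<omega> \<in> B} = T"
        using E_eq by blast+
      show "\<omega> \<in> ?L"
        unfolding mem_Collect_eq * using ST by (auto simp: P_def E_def)
    qed
  qed
  also have "prob \<dots> = (\<Sum>ST\<in>P. prob (E ST))"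
  proof (rule finite_measure_finite_Union)
    show "finite P"
      unfolding P_def by (intro finite_SigmaI) auto
    show "E ` P \<subseteq> events"
    proof (rule image_subsetI)
      fix ST
      have "{\<omega>\<in>space M. \<forall>j\<in>{..<m}. Z j \<omega> \<in> C ST j} \<in> events"
      proof (intro sets.sets_Collect_finite_All)
        fix j assume "j \<in> {..<m}"
        then have "Z j -` C ST j \<inter> space M \<in> events"
          by (intro measurable_sets[OF rv Csets]) simp
        also have "Z j -` C ST j \<inter> space M = {\<omega>\<in>space M. Z j \<omega> \<in> C ST j}"
          by auto
        finally show "{\<omega>\<in>space M. Z j \<omega> \<in> C ST j} \<in> events" .
      qed simp
      moreover have "{\<omega>\<in>space M. \<forall>j\<in>{..<m}. Z j \<omega> \<in> C ST j} = E ST"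
        by (auto simp: E_def)
      ultimately show "E ST \<in> events"
        by simp
    qed
    show "disjoint_family_on E P"
    proof (unfold disjoint_family_on_def, intro ballI impI equals0I)
      fix ST ST' \<omega>
      assume P: "ST \<in> P" "ST' \<in> P" "ST \<noteq> ST'" and w: "\<omega> \<in> E ST \<inter> E ST'"
      have "fst ST = fst ST'" "snd ST = snd ST'"
        using E_eq[of "fst ST" "snd ST" \<omega>] E_eq[of "fst ST'" "snd ST'" \<omega>] P w by auto
      then show False
        using \<open>ST \<noteq> ST'\<close> prod_eqI by blast
    qed
  qed
  also have "\<dots> = (\<Sum>ST\<in>P. u ^ a * v ^ b * (1 - u - v) ^ (m - a - b))"
  proof (rule sum.cong[OF refl])
    fix ST assume "ST \<in> P"
    obtain S T where [simp]: "ST = (S, T)"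
      by (cases ST)
    have ST: "S \<subseteq> {..<m}" "card S = a" "T \<subseteq> {..<m} - S" "card T = b" "finite S" "finite T"
      using \<open>ST \<in> P\<close> by (auto simp: P_def intro: finite_subset)
    have "prob (E ST) = (\<Prod>j<m. prob (Z j -` C ST j \<inter> space M))"
    \<comment> \<open>For \<open>m = 0\<close> the intersection over the indices would be
      \<open>UNIV\<close> instead of the sample space.\<close>
    proof (cases "m = 0")
      case True
      then show ?thesis by (simp add: E_def prob_space)
    next
      case False
      then have "E ST = (\<Inter>j\<in>{..<m}. Z j -` C ST j \<inter> space M)"
        by (auto simp: E_def)
      then show ?thesis
        using indep_varsD_finite[OF indep, of "C ST"] False Csets by (simp add: lessThan_empty_iff)
    qed
    also have "\<dots> = (\<Prod>j<m. if j \<in> S then u else if j \<in> T then v else 1 - u - v)"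
      using u v pC by (intro prod.cong) (auto simp: C_def)
    also have "\<dots> = (\<Prod>j\<in>S \<union> (T \<union> ({..<m} - S - T)). if j \<in> S then u else if j \<in> T then v else 1 - u - v)"
      using ST by (intro prod.cong) auto
    also have "\<dots> = (\<Prod>j\<in>S. if j \<in> S then u else if j \<in> T then v else 1 - u - v) *
        ((\<Prod>j\<in>T. if j \<in> S then u else if j \<in> T then v else 1 - u - v) *
         (\<Prod>j\<in>{..<m} - S - T. if j \<in> S then u else if j \<in> T then v else 1 - u - v))"
    proof -
      have "S \<inter> (T \<union> ({..<m} - S - T)) = {}" "T \<inter> ({..<m} - S - T) = {}"
        using ST by auto
      moreover have "finite (T \<union> ({..<m} - S - T))" "finite ({..<m} - S - T)"
        using ST by auto
      ultimately show ?thesis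
        using ST(5,6) by (simp only: prod.union_disjoint)
    qed
    also have "\<dots> = (\<Prod>j\<in>S. u) * ((\<Prod>j\<in>T. v) * (\<Prod>j\<in>{..<m} - S - T. 1 - u - v))"
      using ST by (intro arg_cong2[of _ _ _ _ "(*)"] prod.cong) auto
    also have "\<dots> = u ^ a * v ^ b * (1 - u - v) ^ (m - a - b)"
    proof -
      have "card ({..<m} - S - T) = m - a - b"
        using ST by (simp add: card_Diff_subset)
      then show ?thesis
        using ST by simp
    qed
    finally show "prob (E ST) = u ^ a * v ^ b * (1 - u - v) ^ (m - a - b)" .
  qed
  also have "\<dots> = real (card P) * (u ^ a * v ^ b * (1 - u - v) ^ (m - a - b))"
    by simp
  also have "card P = (m choose a) * ((m - a) choose b)"
  proof -
    have "card P = (\<Sum>S\<in>{S. S \<subseteq> {..<m} \<and> card S = a}. card {T. T \<subseteq> {..<m} - S \<and> card T = b})"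
      unfolding P_def by (subst card_SigmaI) auto
    also have "\<dots> = (\<Sum>S\<in>{S. S \<subseteq> {..<m} \<and> card S = a}. (m - a) choose b)"
      by (intro sum.cong refl) (auto simp: n_subsets card_Diff_subset finite_subset[OF _ finite_lessThan])
    also have "\<dots> = (m choose a) * ((m - a) choose b)"
      using n_subsets[of "{..<m}" a] by simp
    finally show ?thesis .
  qed
  finally show ?thesis
    by (simp only: of_nat_mult)
qed

lemma (in prob_space) prob_counts_less:
  assumes indep: "indep_vars (\<lambda>_. N) Z {..<m}"
    and A: "A \<in> sets N" and B: "B \<in> sets N" and disj: "A \<inter> B = {}"
    and u: "\<And>j. j < m \<Longrightarrow> prob (Z j -` A \<inter> space M) = u"
    and v: "\<And>j. j < m \<Longrightarrow> prob (Z j -` B \<inter> space M) = v"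
  shows "prob {\<omega>\<in>space M. card {j\<in>{..<m}. Z j \<omega> \<in> A} < l \<and> card {j\<in>{..<m}. Z j \<omega> \<in> B} < l} =
    multinomial_cdf l m u v"
proof -
  define F where "F = (\<lambda>(a, b). {\<omega>\<in>space M. card {j\<in>{..<m}. Z j \<omega> \<in> A} = a \<and>
    card {j\<in>{..<m}. Z j \<omega> \<in> B} = b})"
  have rv: "Z j \<in> measurable M N" if "j < m" for j
    using indep that by (auto simp: indep_vars_def)
  have meas: "{\<omega>\<in>space M. card {j\<in>{..<m}. Z j \<omega> \<in> C} = c} \<in> events" if C: "C \<in> sets N" for C c
  proof -
    have "(\<lambda>\<omega>. \<Sum>j<m. indicator (Z j -` C \<inter> space M) \<omega> :: real) \<in> borel_measurable M"
      using rv C by (intro borel_measurable_sum borel_measurable_indicator measurable_sets) auto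
    then have "{\<omega>\<in>space M. (\<Sum>j<m. indicator (Z j -` C \<inter> space M) \<omega> :: real) = real c} \<in> events"
      by measurable
    also have "{\<omega>\<in>space M. (\<Sum>j<m. indicator (Z j -` C \<inter> space M) \<omega> :: real) = real c} =
        {\<omega>\<in>space M. card {j\<in>{..<m}. Z j \<omega> \<in> C} = c}"
      by (intro Collect_cong conj_cong refl) (simp add: indicator_def sum.If_cases Int_def)
    finally show ?thesis .
  qed
  have Fsets: "F ab \<in> events" for ab
  proof -
    have "F ab = {\<omega>\<in>space M. card {j\<in>{..<m}. Z j \<omega> \<in> A} = fst ab} \<inter>
        {\<omega>\<in>space M. card {j\<in>{..<m}. Z j \<omega> \<in> B} = snd ab}"
      by (auto simp: F_def split_beta)
    then show ?thesis
      by (simp only:) (intro sets.Int meas A B)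
  qed
  have "{\<omega>\<in>space M. card {j\<in>{..<m}. Z j \<omega> \<in> A} < l \<and> card {j\<in>{..<m}. Z j \<omega> \<in> B} < l} =
      (\<Union>ab\<in>{..<l}\<times>{..<l}. F ab)"
    unfolding F_def by auto
  also have "prob \<dots> = (\<Sum>ab\<in>{..<l}\<times>{..<l}. prob (F ab))"
    using Fsets by (intro finite_measure_finite_Union) (unfold F_def disjoint_family_on_def, auto)
  also have "\<dots> = multinomial_cdf l m u v"
    unfolding multinomial_cdf_def sum.cartesian_product F_def
    by (intro sum.cong refl) (simp only: split_beta prob_counts_eq[OF assms])
  finally show ?thesis .
qed

lemma multinomial_cdf_0:
  assumes "1 \<le> l"
  shows "multinomial_cdf l m u 0 = (\<Sum>a<l. real (m choose a) * u ^ a * (1 - u) ^ (m - a))"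
proof -
  have "(\<Sum>b<l. real (m choose a) * real ((m - a) choose b) * (u ^ a * 0 ^ b * (1 - u - 0) ^ (m - a - b)))
    = (\<Sum>b<l. if b = 0 then real (m choose a) * u ^ a * (1 - u) ^ (m - a) else 0)" for a
    by (intro sum.cong) auto
  then show ?thesis
    using assms by (auto simp: multinomial_cdf_def sum.delta)
qed

section \<open>Moments from joint tails\<close>

text \<open>Layer-cake kernel of a signed number: 1 for 0 <= s < x, -1 for x <= s < 0 and 0
  otherwise, so that its integral over \<open>s\<close> is \<open>x\<close>.\<close>

definition step_kernel :: "real \<Rightarrow> real \<Rightarrow> real" where
  "step_kernel s x = indicator {..<x} s - indicator {..<0} s"

lemma step_kernel_measurable[measurable]:
  "(\<lambda>p. step_kernel (f p) (g p)) \<in> borel_measurable N"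
  if [measurable]: "f \<in> borel_measurable N" "g \<in> borel_measurable N"
proof -
  have "(\<lambda>p. step_kernel (f p) (g p)) = (\<lambda>p. (if f p < g p then 1 else 0) - (if f p < 0 then 1 else 0))"
    by (auto simp: step_kernel_def)
  also have "\<dots> \<in> borel_measurable N"
    by measurable
  finally show ?thesis .
qed

lemma has_integral_step_kernel:
  "integrable lborel (\<lambda>s. step_kernel s x)" "(\<integral>s. step_kernel s x \<partial>lborel) = x"
  "(\<integral>\<^sup>+s. ennreal \<bar>step_kernel s x\<bar> \<partial>lborel) = ennreal \<bar>x\<bar>"
proof -
  have eq: "step_kernel s x = indicator {0..<x} s - indicator {x..<0} s" for s
    by (auto simp: step_kernel_def indicator_def)
  have eq': "\<bar>step_kernel s x\<bar> = indicator {0..<x} s + indicator {x..<0} s" for s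
    by (auto simp: step_kernel_def indicator_def)
  show "integrable lborel (\<lambda>s. step_kernel s x)" "(\<integral>s. step_kernel s x \<partial>lborel) = x"
  proof -
    have "integrable lborel (indicator {0..<x} :: real \<Rightarrow> real)" "integrable lborel (indicator {x..<0} :: real \<Rightarrow> real)"
      by (cases "0 \<le> x"; simp)+
    moreover have "measure lborel {0..<x} - measure lborel {x..<0} = x"
      by (cases "0 \<le> x") auto
    ultimately show "integrable lborel (\<lambda>s. step_kernel s x)" "(\<integral>s. step_kernel s x \<partial>lborel) = x"
      unfolding eq by simp_all
  qed
  show "(\<integral>\<^sup>+s. ennreal \<bar>step_kernel s x\<bar> \<partial>lborel) = ennreal \<bar>x\<bar>"
    unfolding eq' by (cases "0 \<le> x") (auto simp: ennreal_plus[symmetric] nn_integral_add ennreal_indicator simp del: ennreal_plus)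
qed

text \<open>Expand \<open>L\<close> by the layer-cake kernel and exchange the integrals;
  \<open>B\<close> majorises the inner one. The weight \<open>W\<close> is kept general: it is 1 for
  means, and a second kernel or a second variable for mixed moments.\<close>

lemma (in prob_space) integral_mult_step_kernel:
  assumes [measurable]: "random_variable borel L" "random_variable borel W"
    and B: "integrable lborel B" "\<And>s. 0 \<le> B s"
    and le: "\<And>s. (\<integral>\<^sup>+\<omega>. ennreal (\<bar>step_kernel s (L \<omega>)\<bar> * \<bar>W \<omega>\<bar>) \<partial>M) \<le> ennreal (B s)"
  shows "(\<integral>\<^sup>+\<omega>. ennreal (\<bar>L \<omega>\<bar> * \<bar>W \<omega>\<bar>) \<partial>M) \<le> ennreal (\<integral>s. B s \<partial>lborel)"
    and "integrable M (\<lambda>\<omega>. L \<omega> * W \<omega>)"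
    and "(\<integral>\<omega>. L \<omega> * W \<omega> \<partial>M) = (\<integral>s. (\<integral>\<omega>. step_kernel s (L \<omega>) * W \<omega> \<partial>M) \<partial>lborel)"
    and "\<bar>\<integral>\<omega>. step_kernel s (L \<omega>) * W \<omega> \<partial>M\<bar> \<le> B s"
    and "(\<lambda>s. \<integral>\<omega>. step_kernel s (L \<omega>) * W \<omega> \<partial>M) \<in> borel_measurable lborel"
proof -
  interpret P: pair_sigma_finite lborel M
    by unfold_locales
  let ?f = "\<lambda>(s, \<omega>). step_kernel s (L \<omega>) * W \<omega>"
  have [measurable]: "?f \<in> borel_measurable (lborel \<Otimes>\<^sub>M M)"
    by measurable
  have *: "(\<integral>\<^sup>+s. (\<integral>\<^sup>+\<omega>. ennreal (\<bar>step_kernel s (L \<omega>)\<bar> * \<bar>W \<omega>\<bar>) \<partial>M) \<partial>lborel) \<le> ennreal (\<integral>s. B s \<partial>lborel)"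
  proof -
    have "(\<integral>\<^sup>+s. (\<integral>\<^sup>+\<omega>. ennreal (\<bar>step_kernel s (L \<omega>)\<bar> * \<bar>W \<omega>\<bar>) \<partial>M) \<partial>lborel) \<le> (\<integral>\<^sup>+s. ennreal (B s) \<partial>lborel)"
      by (intro nn_integral_mono le)
    then show ?thesis
      using B by (simp add: nn_integral_eq_integral)
  qed
  have "(\<integral>\<^sup>+\<omega>. ennreal (\<bar>L \<omega>\<bar> * \<bar>W \<omega>\<bar>) \<partial>M) =
      (\<integral>\<^sup>+\<omega>. (\<integral>\<^sup>+s. ennreal (\<bar>step_kernel s (L \<omega>)\<bar> * \<bar>W \<omega>\<bar>) \<partial>lborel) \<partial>M)"
    by (intro nn_integral_cong) (simp add: ennreal_mult nn_integral_multc has_integral_step_kernel(3))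
  also have "\<dots> = (\<integral>\<^sup>+s. (\<integral>\<^sup>+\<omega>. ennreal (\<bar>step_kernel s (L \<omega>)\<bar> * \<bar>W \<omega>\<bar>) \<partial>M) \<partial>lborel)"
    by (rule P.Fubini') measurable
  finally have eq: "(\<integral>\<^sup>+\<omega>. ennreal (\<bar>L \<omega>\<bar> * \<bar>W \<omega>\<bar>) \<partial>M) =
      (\<integral>\<^sup>+s. (\<integral>\<^sup>+\<omega>. ennreal (\<bar>step_kernel s (L \<omega>)\<bar> * \<bar>W \<omega>\<bar>) \<partial>M) \<partial>lborel)" .
  then show bnd: "(\<integral>\<^sup>+\<omega>. ennreal (\<bar>L \<omega>\<bar> * \<bar>W \<omega>\<bar>) \<partial>M) \<le> ennreal (\<integral>s. B s \<partial>lborel)"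
    using * by simp
  then show "integrable M (\<lambda>\<omega>. L \<omega> * W \<omega>)"
    by (intro integrableI_bounded) (auto simp: abs_mult intro: le_less_trans)
  have int: "integrable (lborel \<Otimes>\<^sub>M M) ?f"
  proof (rule integrableI_bounded)
    have "(\<integral>\<^sup>+p. ennreal (norm (?f p)) \<partial>(lborel \<Otimes>\<^sub>M M)) =
        (\<integral>\<^sup>+s. (\<integral>\<^sup>+\<omega>. ennreal (\<bar>step_kernel s (L \<omega>)\<bar> * \<bar>W \<omega>\<bar>) \<partial>M) \<partial>lborel)"
      by (subst nn_integral_fst[symmetric]) (auto simp: abs_mult)
    then show "(\<integral>\<^sup>+p. ennreal (norm (?f p)) \<partial>(lborel \<Otimes>\<^sub>M M)) < \<infinity>"
      using * by (auto intro: le_less_trans)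
  qed measurable
  have "(\<integral>\<omega>. L \<omega> * W \<omega> \<partial>M) = (\<integral>\<omega>. (\<integral>s. step_kernel s (L \<omega>) * W \<omega> \<partial>lborel) \<partial>M)"
    by (simp add: has_integral_step_kernel)
  also have "\<dots> = (\<integral>s. (\<integral>\<omega>. step_kernel s (L \<omega>) * W \<omega> \<partial>M) \<partial>lborel)"
    using P.Fubini_integral[OF int] by simp
  finally show "(\<integral>\<omega>. L \<omega> * W \<omega> \<partial>M) = (\<integral>s. (\<integral>\<omega>. step_kernel s (L \<omega>) * W \<omega> \<partial>M) \<partial>lborel)" .
  show "\<bar>\<integral>\<omega>. step_kernel s (L \<omega>) * W \<omega> \<partial>M\<bar> \<le> B s"
  proof -
    have *: "integrable M (\<lambda>\<omega>. step_kernel s (L \<omega>) * W \<omega>)"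
      using le[of s] by (intro integrableI_bounded) (auto simp: abs_mult intro: le_less_trans)
    have "ennreal \<bar>\<integral>\<omega>. step_kernel s (L \<omega>) * W \<omega> \<partial>M\<bar> \<le> ennreal (B s)"
      using integral_norm_bound_ennreal[OF *] le[of s] by (simp add: abs_mult)
    then show ?thesis
      using B(2)[of s] by simp
  qed
  show "(\<lambda>s. \<integral>\<omega>. step_kernel s (L \<omega>) * W \<omega> \<partial>M) \<in> borel_measurable lborel"
    by measurable
qed

lemma (in prob_space) integrable_step_kernel_mult:
  assumes [measurable]: "random_variable borel L" "random_variable borel L'"
  shows "integrable M (\<lambda>\<omega>. step_kernel s (L \<omega>) * step_kernel t (L' \<omega>))"
    "(\<integral>\<omega>. step_kernel s (L \<omega>) * step_kernel t (L' \<omega>) \<partial>M) =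
      prob {\<omega>\<in>space M. s < L \<omega> \<and> t < L' \<omega>} - indicator {..<0} s * prob {\<omega>\<in>space M. t < L' \<omega>}
      - indicator {..<0} t * prob {\<omega>\<in>space M. s < L \<omega>} + indicator {..<0} s * indicator {..<0} t"
proof -
  have eq: "step_kernel s (L \<omega>) * step_kernel t (L' \<omega>) =
    indicator {\<omega>\<in>space M. s < L \<omega> \<and> t < L' \<omega>} \<omega> - indicator {..<0} s * indicator {\<omega>\<in>space M. t < L' \<omega>} \<omega>
      - indicator {..<0} t * indicator {\<omega>\<in>space M. s < L \<omega>} \<omega> + indicator {..<0} s * indicator {..<0} t"
    if "\<omega> \<in> space M" for \<omega>
    using that by (auto simp: step_kernel_def indicator_def)
  have [simp]: "{\<omega>\<in>space M. s < L \<omega> \<and> t < L' \<omega>} \<in> events" "{\<omega>\<in>space M. t < L' \<omega>} \<in> events"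
     "{\<omega>\<in>space M. s < L \<omega>} \<in> events"
    by measurable
  show "integrable M (\<lambda>\<omega>. step_kernel s (L \<omega>) * step_kernel t (L' \<omega>))"
    by (subst Bochner_Integration.integrable_cong[OF refl eq]) (auto simp: emeasure_eq_measure)
  show "(\<integral>\<omega>. step_kernel s (L \<omega>) * step_kernel t (L' \<omega>) \<partial>M) =
      prob {\<omega>\<in>space M. s < L \<omega> \<and> t < L' \<omega>} - indicator {..<0} s * prob {\<omega>\<in>space M. t < L' \<omega>}
      - indicator {..<0} t * prob {\<omega>\<in>space M. s < L \<omega>} + indicator {..<0} s * indicator {..<0} t"
    by (subst Bochner_Integration.integral_cong[OF refl eq]) (auto simp: emeasure_eq_measure prob_space)
qed

text \<open>The square of \<open>b\<close> appears because an intersection has probability at most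
  the geometric mean of those of its two parts: joint tails at (s, t) are then below
  \<open>b s * b t\<close>, whatever the dependence of the two variables.\<close>

definition (in prob_space) tail_bound :: "('a \<Rightarrow> real) \<Rightarrow> (real \<Rightarrow> real) \<Rightarrow> bool" where
  "tail_bound L b \<longleftrightarrow> (\<forall>s\<ge>0. prob {\<omega>\<in>space M. s < L \<omega>} \<le> (b s)\<^sup>2) \<and>
     (\<forall>s<0. prob {\<omega>\<in>space M. L \<omega> \<le> s} \<le> (b s)\<^sup>2)"

lemma (in prob_space) nn_integral_step_kernel_mult_le:
  assumes [measurable]: "random_variable borel L" "random_variable borel L'"
    and b: "\<And>s. 0 \<le> b s" and tails: "tail_bound L b" "tail_bound L' b"
  shows "(\<integral>\<^sup>+\<omega>. ennreal (\<bar>step_kernel s (L \<omega>)\<bar> * \<bar>step_kernel t (L' \<omega>)\<bar>) \<partial>M) \<le> ennreal (b s * b t)"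
proof -
  define A where "A s L = {\<omega>\<in>space M. if 0 \<le> s then s < L \<omega> else L \<omega> \<le> s}" for s :: real and L :: "'a \<Rightarrow> real"
  have A_le: "prob (A s L) \<le> (b s)\<^sup>2" if "tail_bound L b" for s L
    using that by (cases "0 \<le> s") (auto simp: A_def tail_bound_def)
  have [measurable]: "A s L \<in> events" if [measurable]: "random_variable borel L" for s L
    unfolding A_def by measurable
  have ind: "\<bar>step_kernel s (L \<omega>)\<bar> = indicator (A s L) \<omega>" if "\<omega> \<in> space M" for s \<omega> and L :: "'a \<Rightarrow> real"
    using that by (auto simp: step_kernel_def A_def indicator_def)
  have "(\<integral>\<^sup>+\<omega>. ennreal (\<bar>step_kernel s (L \<omega>)\<bar> * \<bar>step_kernel t (L' \<omega>)\<bar>) \<partial>M) =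
      (\<integral>\<^sup>+\<omega>. indicator (A s L \<inter> A t L') \<omega> \<partial>M)"
    by (intro nn_integral_cong) (auto simp: ind indicator_def)
  also have "\<dots> = ennreal (prob (A s L \<inter> A t L'))"
    by (subst nn_integral_indicator) (auto simp: emeasure_eq_measure)
  also have "prob (A s L \<inter> A t L') \<le> b s * b t"
  proof (rule power2_le_imp_le)
    have "prob (A s L \<inter> A t L') \<le> prob (A s L)" "prob (A s L \<inter> A t L') \<le> prob (A t L')"
      by (intro finite_measure_mono; simp)+
    then have "(prob (A s L \<inter> A t L'))\<^sup>2 \<le> prob (A s L) * prob (A t L')"
      unfolding power2_eq_square by (intro mult_mono) auto
    also have "\<dots> \<le> (b s)\<^sup>2 * (b t)\<^sup>2"
      using A_le tails by (intro mult_mono) auto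
    finally show "(prob (A s L \<inter> A t L'))\<^sup>2 \<le> (b s * b t)\<^sup>2"
      by (simp add: power_mult_distrib)
  qed (use b in auto)
  finally show ?thesis
    by (auto intro: ennreal_leI)
qed

lemma (in prob_space) tail_bound_integrals:
  assumes rv[measurable]: "random_variable borel L" "random_variable borel L'"
    and b: "integrable lborel b" "\<And>s. 0 \<le> b s" and tails: "tail_bound L b" "tail_bound L' b"
  shows "integrable M (\<lambda>\<omega>. L \<omega> * L' \<omega>)" (is ?A)
    and "\<bar>\<integral>\<omega>. L \<omega> * L' \<omega> \<partial>M\<bar> \<le> (\<integral>s. b s \<partial>lborel)\<^sup>2" (is ?B)
    and "(\<integral>\<omega>. L \<omega> * L' \<omega> \<partial>M) =
      (\<integral>s. (\<integral>t. (\<integral>\<omega>. step_kernel s (L \<omega>) * step_kernel t (L' \<omega>) \<partial>M) \<partial>lborel) \<partial>lborel)" (is ?C)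
    and "\<bar>\<integral>\<omega>. step_kernel s (L \<omega>) * step_kernel t (L' \<omega>) \<partial>M\<bar> \<le> b s * b t" (is ?D)
    and "(\<lambda>t. \<integral>\<omega>. step_kernel s (L \<omega>) * step_kernel t (L' \<omega>) \<partial>M) \<in> borel_measurable lborel" (is ?E)
    and "\<bar>\<integral>t. (\<integral>\<omega>. step_kernel s (L \<omega>) * step_kernel t (L' \<omega>) \<partial>M) \<partial>lborel\<bar> \<le> b s * (\<integral>t. b t \<partial>lborel)" (is ?F)
    and "(\<lambda>s. \<integral>t. (\<integral>\<omega>. step_kernel s (L \<omega>) * step_kernel t (L' \<omega>) \<partial>M) \<partial>lborel) \<in> borel_measurable lborel" (is ?G)
proof -
  have le: "(\<integral>\<^sup>+\<omega>. ennreal (\<bar>step_kernel t (L' \<omega>)\<bar> * \<bar>step_kernel s (L \<omega>)\<bar>) \<partial>M) \<le> ennreal (b s * b t)" for s t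
    using nn_integral_step_kernel_mult_le[OF rv b(2) tails, of s t] by (simp add: mult.commute)
  have B: "integrable lborel (\<lambda>t. b s * b t)" "0 \<le> b s * b t" for s t
    using b by auto
  have [measurable]: "random_variable borel (\<lambda>\<omega>. step_kernel s (L \<omega>))" for s
    by measurable
  \<comment> \<open>The inner expansion is that of \<open>L'\<close> with the kernel of
    \<open>L\<close> as weight. Its bound is the majorant for the outer expansion, that of
    \<open>L\<close> with weight \<open>L'\<close>.\<close>
  have inner: "(\<integral>\<^sup>+\<omega>. ennreal (\<bar>L' \<omega>\<bar> * \<bar>step_kernel s (L \<omega>)\<bar>) \<partial>M) \<le> ennreal (b s * (\<integral>t. b t \<partial>lborel))"
    "(\<integral>\<omega>. L' \<omega> * step_kernel s (L \<omega>) \<partial>M) =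
      (\<integral>t. (\<integral>\<omega>. step_kernel t (L' \<omega>) * step_kernel s (L \<omega>) \<partial>M) \<partial>lborel)"
    "\<bar>\<integral>\<omega>. step_kernel t (L' \<omega>) * step_kernel s (L \<omega>) \<partial>M\<bar> \<le> b s * b t"
    "(\<lambda>t. \<integral>\<omega>. step_kernel t (L' \<omega>) * step_kernel s (L \<omega>) \<partial>M) \<in> borel_measurable lborel" for s t
    using integral_mult_step_kernel[where W="\<lambda>\<omega>. step_kernel s (L \<omega>)" and B="\<lambda>t. b s * b t", OF rv(2) _ B le]
    by simp_all
  have inner_eq: "(\<integral>\<omega>. step_kernel s (L \<omega>) * L' \<omega> \<partial>M) =
      (\<integral>t. (\<integral>\<omega>. step_kernel s (L \<omega>) * step_kernel t (L' \<omega>) \<partial>M) \<partial>lborel)" for s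
    using inner(2)[of s] by (simp add: mult.commute)
  have le': "(\<integral>\<^sup>+\<omega>. ennreal (\<bar>step_kernel s (L \<omega>)\<bar> * \<bar>L' \<omega>\<bar>) \<partial>M) \<le> ennreal (b s * (\<integral>t. b t \<partial>lborel))" for s
    using inner(1)[of s] by (simp add: mult.commute)
  have "integrable lborel (\<lambda>s. b s * (\<integral>t. b t \<partial>lborel))" "0 \<le> b s * (\<integral>t. b t \<partial>lborel)" for s
    using b by auto
  note outer = integral_mult_step_kernel[where L=L and W=L', OF rv this le']
  show ?A ?C
    using outer(2,3) by (simp_all add: inner_eq)
  show ?D ?E
    using inner(3)[of t s] inner(4)[of s] by (simp_all add: mult.commute)
  show ?F ?G
    using outer(4,5) by (simp_all add: inner_eq)
  have "ennreal \<bar>\<integral>\<omega>. L \<omega> * L' \<omega> \<partial>M\<bar> \<le> ennreal (\<integral>s. b s * (\<integral>t. b t \<partial>lborel) \<partial>lborel)"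
    using integral_norm_bound_ennreal[OF \<open>?A\<close>] outer(1) unfolding real_norm_def abs_mult
    by (rule order_trans)
  then have "ennreal \<bar>\<integral>\<omega>. L \<omega> * L' \<omega> \<partial>M\<bar> \<le> ennreal ((\<integral>s. b s \<partial>lborel)\<^sup>2)"
    by (simp add: power2_eq_square)
  then show ?B
    by (subst (asm) ennreal_le_iff) auto
qed

text \<open>Hoeffding's formula turns the joint tail of two variables into their mixed moment, so
  asymptotic independence of the tails passes to the mixed moments by dominated convergence.\<close>

lemma (in prob_space) asymptotically_independent_moments:
  fixes L L' :: "nat \<Rightarrow> 'a \<Rightarrow> real"
  assumes rv[measurable]: "\<And>m. random_variable borel (L m)" "\<And>m. random_variable borel (L' m)"
    and b: "integrable lborel b" "\<And>s. 0 \<le> b s" and tails: "\<And>m. tail_bound (L m) b" "\<And>m. tail_bound (L' m) b"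
    and g[measurable]: "g \<in> borel_measurable borel"
    and lim: "\<And>s. (\<lambda>m. prob {\<omega>\<in>space M. s < L m \<omega>}) \<longlonglongrightarrow> g s"
      "\<And>s. (\<lambda>m. prob {\<omega>\<in>space M. s < L' m \<omega>}) \<longlonglongrightarrow> g s"
    and joint: "\<And>s t. (\<lambda>m. prob {\<omega>\<in>space M. s < L m \<omega> \<and> t < L' m \<omega>}) \<longlonglongrightarrow> g s * g t"
  shows "(\<lambda>m. \<integral>\<omega>. L m \<omega> * L' m \<omega> \<partial>M) \<longlonglongrightarrow> (\<integral>s. (g s - indicator {..<0} s) \<partial>lborel)\<^sup>2"
proof -
  let ?k = "\<lambda>s. g s - indicator {..<0} s"
  let ?h = "\<lambda>m s t. \<integral>\<omega>. step_kernel s (L m \<omega>) * step_kernel t (L' m \<omega>) \<partial>M"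
  note T = tail_bound_integrals[OF rv b tails]
  have *: "(\<lambda>m. ?h m s t) \<longlonglongrightarrow> ?k s * ?k t" for s t
  proof -
    have "(\<lambda>m. ?h m s t) \<longlonglongrightarrow> g s * g t - indicator {..<0} s * g t - indicator {..<0} t * g s +
        indicator {..<0} s * indicator {..<0} t"
      unfolding integrable_step_kernel_mult(2)[OF rv] by (intro tendsto_add tendsto_diff tendsto_mult tendsto_const lim joint)
    then show ?thesis
      by (simp add: algebra_simps)
  qed
  have **: "(\<lambda>m. \<integral>t. ?h m s t \<partial>lborel) \<longlonglongrightarrow> (\<integral>t. ?k s * ?k t \<partial>lborel)" for s
  proof (rule integral_dominated_convergence[where w="\<lambda>t. b s * b t"])
    show "(\<lambda>t. ?h m s t) \<in> borel_measurable lborel" for m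
      by (rule T(5))
    show "integrable lborel (\<lambda>t. b s * b t)"
      using b(1) by simp
    show "AE t in lborel. norm (?h m s t) \<le> b s * b t" for m
      unfolding real_norm_def by (intro AE_I2 T(4))
  qed (auto intro: *)
  have "(\<lambda>m. \<integral>s. (\<integral>t. ?h m s t \<partial>lborel) \<partial>lborel) \<longlonglongrightarrow> (\<integral>s. (\<integral>t. ?k s * ?k t \<partial>lborel) \<partial>lborel)"
  proof (rule integral_dominated_convergence[where w="\<lambda>s. b s * (\<integral>t. b t \<partial>lborel)"])
    show "(\<lambda>s. \<integral>t. ?h m s t \<partial>lborel) \<in> borel_measurable lborel" for m
      by (rule T(7))
    show "integrable lborel (\<lambda>s. b s * (\<integral>t. b t \<partial>lborel))"
      using b(1) by simp
    show "AE s in lborel. norm (\<integral>t. ?h m s t \<partial>lborel) \<le> b s * (\<integral>t. b t \<partial>lborel)" for m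
      unfolding real_norm_def by (intro AE_I2 T(6))
    show "(\<lambda>s. \<integral>t. ?k s * ?k t \<partial>lborel) \<in> borel_measurable lborel"
      by simp
  qed (intro AE_I2 **)
  moreover have "(\<integral>s. (\<integral>t. ?k s * ?k t \<partial>lborel) \<partial>lborel) = (\<integral>s. ?k s \<partial>lborel)\<^sup>2"
    by (simp only: power2_eq_square integral_mult_right_zero integral_mult_left_zero)
  moreover have "(\<lambda>m. \<integral>\<omega>. L m \<omega> * L' m \<omega> \<partial>M) = (\<lambda>m. \<integral>s. (\<integral>t. ?h m s t \<partial>lborel) \<partial>lborel)"
    by (intro ext T(3))
  ultimately show ?thesis
    by metis
qed

text \<open>First-moment version of Hoeffding's formula. A single tail is below the square of
  \<open>b\<close>; as \<open>b\<close> is bounded by \<open>K\<close>, this is below the integrable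
  function \<open>K * b\<close>.\<close>

lemma (in prob_space) tail_bound_mean:
  assumes rv[measurable]: "random_variable borel L"
    and b: "integrable lborel b" "\<And>s. 0 \<le> b s" "\<And>s. b s \<le> K" and tails: "tail_bound L b"
  shows "(\<integral>\<omega>. L \<omega> \<partial>M) = (\<integral>s. (prob {\<omega>\<in>space M. s < L \<omega>} - indicator {..<0} s) \<partial>lborel)"
    and "integrable M L"
    and "(\<lambda>s. prob {\<omega>\<in>space M. s < L \<omega>} - indicator {..<0} s) \<in> borel_measurable lborel"
    and "\<bar>prob {\<omega>\<in>space M. s < L \<omega>} - indicator {..<0} s\<bar> \<le> K * b s"
proof -
  have sets[simp]: "{\<omega>\<in>space M. s < L \<omega>} \<in> events" for s
    by measurable
  have eq: "(\<integral>\<omega>. step_kernel s (L \<omega>) * 1 \<partial>M) = prob {\<omega>\<in>space M. s < L \<omega>} - indicator {..<0} s" for s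
  proof -
    have "(\<integral>\<omega>. step_kernel s (L \<omega>) * 1 \<partial>M) =
        (\<integral>\<omega>. indicator {\<omega>\<in>space M. s < L \<omega>} \<omega> - indicator {..<0} s \<partial>M)"
      by (intro Bochner_Integration.integral_cong) (auto simp: step_kernel_def indicator_def)
    then show ?thesis
      by (simp add: prob_space emeasure_eq_measure)
  qed
  have le: "(\<integral>\<^sup>+\<omega>. ennreal (\<bar>step_kernel s (L \<omega>)\<bar> * \<bar>1\<bar>) \<partial>M) \<le> ennreal (K * b s)" for s
  proof -
    \<comment> \<open>The kernel takes the values -1, 0 and 1, so its modulus equals its square and
      the two-variable estimate applies with both variables equal to \<open>L\<close>.\<close>
    have "(\<integral>\<^sup>+\<omega>. ennreal (\<bar>step_kernel s (L \<omega>)\<bar> * \<bar>1\<bar>) \<partial>M) =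
        (\<integral>\<^sup>+\<omega>. ennreal (\<bar>step_kernel s (L \<omega>)\<bar> * \<bar>step_kernel s (L \<omega>)\<bar>) \<partial>M)"
      by (intro nn_integral_cong) (auto simp: step_kernel_def indicator_def)
    also have "\<dots> \<le> ennreal (b s * b s)"
      by (rule nn_integral_step_kernel_mult_le[OF rv rv b(2) tails tails])
    also have "\<dots> \<le> ennreal (K * b s)"
      using b(2,3) by (intro ennreal_leI mult_right_mono) auto
    finally show ?thesis .
  qed
  have nonneg: "0 \<le> K * b s" for s
    using b(2,3)[of s] by (intro mult_nonneg_nonneg) linarith+
  have int: "integrable lborel (\<lambda>s. K * b s)"
    using b(1) by simp
  note I = integral_mult_step_kernel[where L=L and W="\<lambda>_. 1" and B="\<lambda>s. K * b s", OF rv borel_measurable_const int nonneg le]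
  show "(\<integral>\<omega>. L \<omega> \<partial>M) = (\<integral>s. (prob {\<omega>\<in>space M. s < L \<omega>} - indicator {..<0} s) \<partial>lborel)"
    "integrable M L"
    "(\<lambda>s. prob {\<omega>\<in>space M. s < L \<omega>} - indicator {..<0} s) \<in> borel_measurable lborel"
    "\<bar>prob {\<omega>\<in>space M. s < L \<omega>} - indicator {..<0} s\<bar> \<le> K * b s"
    using I(2,3,4,5) unfolding eq by simp_all
qed

section \<open>Poisson limits\<close>

text \<open>Probability that a Poisson variable of mean \<open>s\<close> is strictly below
  \<open>l\<close>.\<close>

definition poisson_cdf :: "nat \<Rightarrow> real \<Rightarrow> real" where
  "poisson_cdf l s = (\<Sum>j<l. s ^ j / fact j) * exp (- s)"

text \<open>For small w, -w - 2 w^2 <= ln (1 - w) <= -w. After multiplication by \<open>N m\<close>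
  the quadratic term vanishes, because \<open>N m * w m\<close> converges while \<open>w m\<close>
  tends to 0.\<close>

lemma tendsto_power_one_minus:
  fixes w :: "nat \<Rightarrow> real" and N :: "nat \<Rightarrow> nat"
  assumes w: "\<And>m. 0 \<le> w m" "w \<longlonglongrightarrow> 0" and N: "(\<lambda>m. real (N m) * w m) \<longlonglongrightarrow> c"
  shows "(\<lambda>m. (1 - w m) ^ N m) \<longlonglongrightarrow> exp (- c)"
proof -
  have ev: "\<forall>\<^sub>F m in sequentially. w m < 1 / 2"
    using w(2) by (rule order_tendstoD) simp
  have "(\<lambda>m. real (N m) * ln (1 - w m)) \<longlonglongrightarrow> - c"
  proof (rule tendsto_sandwich)
    show "\<forall>\<^sub>F m in sequentially. - (real (N m) * w m) - 2 * (real (N m) * w m) * w m \<le> real (N m) * ln (1 - w m)"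
      using ev
    proof eventually_elim
      case (elim m)
      have "real (N m) * (- w m - 2 * (w m)\<^sup>2) \<le> real (N m) * ln (1 - w m)"
        using ln_one_minus_pos_lower_bound[of "w m"] w(1)[of m] elim by (intro mult_left_mono) auto
      then show ?case
        by (simp add: algebra_simps power2_eq_square)
    qed
    show "\<forall>\<^sub>F m in sequentially. real (N m) * ln (1 - w m) \<le> - (real (N m) * w m)"
      using ev
    proof eventually_elim
      case (elim m)
      have "ln (1 - w m) \<le> - w m"
        using ln_le_minus_one[of "1 - w m"] elim by simp
      then have "real (N m) * ln (1 - w m) \<le> real (N m) * (- w m)"
        by (intro mult_left_mono) auto
      then show ?case
        by simp
    qed
    have "(\<lambda>m. - (real (N m) * w m) - 2 * (real (N m) * w m) * w m) \<longlonglongrightarrow> - c - 2 * c * 0"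
      by (intro tendsto_intros N w)
    then show "(\<lambda>m. - (real (N m) * w m) - 2 * (real (N m) * w m) * w m) \<longlonglongrightarrow> - c"
      by simp
    show "(\<lambda>m. - (real (N m) * w m)) \<longlonglongrightarrow> - c"
      by (intro tendsto_intros N)
  qed
  then have "(\<lambda>m. exp (real (N m) * ln (1 - w m))) \<longlonglongrightarrow> exp (- c)"
    by (intro tendsto_intros)
  moreover have "\<forall>\<^sub>F m in sequentially. exp (real (N m) * ln (1 - w m)) = (1 - w m) ^ N m"
    using ev by eventually_elim (simp add: exp_of_nat_mult)
  ultimately show ?thesis
    by (rule Lim_transform_eventually)
qed

lemma tendsto_of_nat_diff_mult:
  fixes u :: "nat \<Rightarrow> real"
  assumes u: "u \<longlonglongrightarrow> 0" and N: "filterlim N at_top sequentially" "(\<lambda>m. real (N m) * u m) \<longlonglongrightarrow> s"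
  shows "(\<lambda>m. real (N m - i) * u m) \<longlonglongrightarrow> s"
proof -
  have "(\<lambda>m. real (N m) * u m - real i * u m) \<longlonglongrightarrow> s - real i * 0"
    by (intro tendsto_intros u N)
  moreover have "\<forall>\<^sub>F m in sequentially. i \<le> N m"
    using N(1) by (simp add: filterlim_at_top)
  then have "\<forall>\<^sub>F m in sequentially. real (N m) * u m - real i * u m = real (N m - i) * u m"
    by eventually_elim (simp add: of_nat_diff algebra_simps)
  ultimately show ?thesis
    using Lim_transform_eventually by fastforce
qed

text \<open>The falling factorial contributes a fixed number of factors
  \<open>(N m - i) * u m\<close>, each tending to \<open>s\<close>.\<close>

lemma tendsto_binomial_power:
  fixes u :: "nat \<Rightarrow> real"
  assumes u: "u \<longlonglongrightarrow> 0" and N: "filterlim N at_top sequentially" "(\<lambda>m. real (N m) * u m) \<longlonglongrightarrow> s"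
  shows "(\<lambda>m. real (N m choose a) * u m ^ a) \<longlonglongrightarrow> s ^ a / fact a"
proof -
  have "(\<lambda>m. (\<Prod>i<a. real (N m - i) * u m) / fact a) \<longlonglongrightarrow> (\<Prod>i<a. s) / fact a"
    by (intro tendsto_intros tendsto_of_nat_diff_mult assms) auto
  moreover have "\<forall>\<^sub>F m in sequentially. a \<le> N m"
    using N(1) by (simp add: filterlim_at_top)
  then have "\<forall>\<^sub>F m in sequentially. (\<Prod>i<a. real (N m - i) * u m) / fact a = real (N m choose a) * u m ^ a"
  proof eventually_elim
    case (elim m)
    have "(\<Prod>i<a. real (N m) - real i) = (\<Prod>i<a. real (N m - i))"
      using elim by (intro prod.cong) (auto simp: of_nat_diff)
    then show ?case
      by (simp add: prod.distrib binomial_gbinomial gbinomial_prod_rev lessThan_atLeast0)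
  qed
  ultimately show ?thesis
    using Lim_transform_eventually by fastforce
qed

text \<open>Poisson limit for two cells at once: the exponential of \<open>s + t\<close> factors,
  which is the asymptotic independence. The sample size \<open>N m\<close> is kept apart from the
  index because for X-neighbours only \<open>m - 1\<close> points remain while the normalising
  factor is \<open>m\<close>.\<close>

lemma multinomial_cdf_tendsto:
  fixes u v :: "nat \<Rightarrow> real"
  assumes N: "filterlim N at_top sequentially"
    and u: "\<And>m. 0 \<le> u m" "u \<longlonglongrightarrow> 0" "(\<lambda>m. real (N m) * u m) \<longlonglongrightarrow> s"
    and v: "\<And>m. 0 \<le> v m" "v \<longlonglongrightarrow> 0" "(\<lambda>m. real (N m) * v m) \<longlonglongrightarrow> t"
  shows "(\<lambda>m. multinomial_cdf l (N m) (u m) (v m)) \<longlonglongrightarrow> poisson_cdf l s * poisson_cdf l t"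
proof -
  have *: "(\<lambda>m. real (N m choose a) * real ((N m - a) choose b) *
      (u m ^ a * v m ^ b * (1 - u m - v m) ^ (N m - a - b))) \<longlonglongrightarrow> s ^ a / fact a * (t ^ b / fact b) * exp (- (s + t))"
    for a b
  proof -
    have Na: "filterlim (\<lambda>m. N m - i) at_top sequentially" for i
      using filterlim_compose[OF filterlim_minus_const_nat_at_top N] by simp
    have "(\<lambda>m. real (N m) * (u m + v m)) \<longlonglongrightarrow> s + t"
      unfolding distrib_left by (intro tendsto_intros u v)
    moreover have "(\<lambda>m. u m + v m) \<longlonglongrightarrow> 0"
      using tendsto_add[OF u(2) v(2)] by simp
    ultimately have "(\<lambda>m. (1 - (u m + v m)) ^ (N m - (a + b))) \<longlonglongrightarrow> exp (- (s + t))"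
      using u(1) v(1) N by (intro tendsto_power_one_minus tendsto_of_nat_diff_mult) auto
    moreover have "(\<lambda>m. real (N m choose a) * u m ^ a) \<longlonglongrightarrow> s ^ a / fact a"
      by (intro tendsto_binomial_power N u)
    moreover have "(\<lambda>m. real ((N m - a) choose b) * v m ^ b) \<longlonglongrightarrow> t ^ b / fact b"
      by (intro tendsto_binomial_power Na v tendsto_of_nat_diff_mult N)
    ultimately have "(\<lambda>m. real (N m choose a) * u m ^ a * (real ((N m - a) choose b) * v m ^ b) *
        (1 - (u m + v m)) ^ (N m - (a + b))) \<longlonglongrightarrow> s ^ a / fact a * (t ^ b / fact b) * exp (- (s + t))"
      by (intro tendsto_mult)
    then show ?thesis
      by (simp add: algebra_simps diff_diff_left)
  qed
  have "(\<lambda>m. multinomial_cdf l (N m) (u m) (v m)) \<longlonglongrightarrow>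
      (\<Sum>a<l. \<Sum>b<l. s ^ a / fact a * (t ^ b / fact b) * exp (- (s + t)))"
    unfolding multinomial_cdf_def by (intro tendsto_sum *)
  also have "(\<Sum>a<l. \<Sum>b<l. s ^ a / fact a * (t ^ b / fact b) * exp (- (s + t))) = poisson_cdf l s * poisson_cdf l t"
  proof -
    have "poisson_cdf l s * poisson_cdf l t = (\<Sum>a<l. s ^ a / fact a) * (\<Sum>b<l. t ^ b / fact b) * exp (- (s + t))"
      by (simp add: poisson_cdf_def mult_exp_exp algebra_simps)
    also have "\<dots> = (\<Sum>a<l. \<Sum>b<l. s ^ a / fact a * (t ^ b / fact b) * exp (- (s + t)))"
      unfolding sum_product by (simp only: sum_distrib_right)
    finally show ?thesis ..
  qed
  finally show ?thesis .
qed

lemma binomial_cdf_tendsto: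
  fixes u :: "nat \<Rightarrow> real"
  assumes "1 \<le> l" "filterlim N at_top sequentially"
    and "\<And>m. 0 \<le> u m" "u \<longlonglongrightarrow> 0" "(\<lambda>m. real (N m) * u m) \<longlonglongrightarrow> s"
  shows "(\<lambda>m. multinomial_cdf l (N m) (u m) 0) \<longlonglongrightarrow> poisson_cdf l s"
proof -
  have "(\<Sum>j<l. (0::real) ^ j / fact j) = (\<Sum>j<l. if j = 0 then 1 else 0)"
    by (intro sum.cong) auto
  then have "poisson_cdf l 0 = 1"
    using assms(1) by (simp add: poisson_cdf_def sum.delta)
  then show ?thesis
    using multinomial_cdf_tendsto[OF assms(2-5), of "\<lambda>_. 0" 0 l] by simp
qed

text \<open>The constant comes from exp (x / 2) >= (x / 2)^(l + 2) / (l + 2)! and from the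
  \<open>l\<close> summands of the binomial distribution function; the root compensates the square
  in \<open>tail_bound\<close>.\<close>

definition log_tail_const :: "nat \<Rightarrow> real" where
  "log_tail_const l = sqrt (real l * (2 ^ (l + 2) * fact (l + 2)))"

text \<open>Majorant for the tails of ln (m * U), independent of \<open>m\<close>: its square is exp
  s for the lower tail and a multiple of exp (- 2 s) for the upper tail.\<close>

definition log_tail_bound :: "nat \<Rightarrow> real \<Rightarrow> real" where
  "log_tail_bound l s = (if s < 0 then exp (s / 2) else log_tail_const l * exp (- s))"

lemma integrable_log_tail_bound: "integrable lborel (log_tail_bound l)"
proof -
  let ?K = "log_tail_const l"
  have 1: "set_integrable lborel (einterval (-\<infinity>) 0) (\<lambda>s::real. exp (s / 2))"
  proof (rule interval_integral_FTC_nonneg(1)[where F="\<lambda>s. 2 * exp (s / 2)"])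
    show "(((\<lambda>s. 2 * exp (s / 2)) \<circ> real_of_ereal) \<longlongrightarrow> 0) (at_right (- \<infinity>))"
      unfolding ereal_tendsto_simps by real_asymp
    show "(((\<lambda>s. 2 * exp (s / 2)) \<circ> real_of_ereal) \<longlongrightarrow> 2) (at_left 0)"
      unfolding zero_ereal_def ereal_tendsto_simps by real_asymp
  qed (auto intro!: derivative_eq_intros)
  have 2: "set_integrable lborel (einterval 0 \<infinity>) (\<lambda>s::real. exp (- s))"
  proof (rule interval_integral_FTC_nonneg(1)[where F="\<lambda>s. - exp (- s)"])
    show "(((\<lambda>s. - exp (- s)) \<circ> real_of_ereal) \<longlongrightarrow> - 1) (at_right 0)"
      unfolding zero_ereal_def ereal_tendsto_simps by real_asymp
    show "(((\<lambda>s. - exp (- s)) \<circ> real_of_ereal) \<longlongrightarrow> 0) (at_left \<infinity>)"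
      unfolding ereal_tendsto_simps by real_asymp
  qed (auto intro!: derivative_eq_intros)
  have "integrable lborel (\<lambda>s::real. indicator {..<0} s * exp (s / 2) + ?K * (indicator {0<..} s * exp (- s)))"
    using 1 2 unfolding set_integrable_def
    by (auto simp: einterval_def greaterThan_def lessThan_def)
  then show ?thesis
  proof (rule integrable_cong_AE_imp)
    show "log_tail_bound l \<in> borel_measurable lborel"
      unfolding log_tail_bound_def[abs_def] by measurable
    have "AE s in lborel. s \<noteq> (0::real)"
      by (rule AE_lborel_singleton)
    then show "AE s in lborel. indicator {..<0} s * exp (s / 2) + ?K * (indicator {0<..} s * exp (- s)) = log_tail_bound l s"
      by eventually_elim (auto simp: log_tail_bound_def indicator_def)
  qed
qed

lemma log_tail_const_nonneg: "0 \<le> log_tail_const l"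
  by (simp add: log_tail_const_def)

lemma log_tail_bound_nonneg: "0 \<le> log_tail_bound l s"
  by (simp add: log_tail_bound_def log_tail_const_nonneg)

lemma log_tail_bound_le: "log_tail_bound l s \<le> 1 + log_tail_const l"
proof -
  have "s < 0 \<Longrightarrow> exp (s / 2) \<le> 1"
    by simp
  moreover have "0 \<le> s \<Longrightarrow> log_tail_const l * exp (- s) \<le> log_tail_const l * 1"
    using log_tail_const_nonneg by (intro mult_left_mono) auto
  ultimately show ?thesis
    using log_tail_const_nonneg[of l] by (auto simp: log_tail_bound_def add_increasing add_increasing2)
qed

text \<open>With x = exp s, each summand is at most x^l * exp (- x / 2), by (m choose a) <= m^a and
  1 - y <= exp (- y). The exponential series then trades x^l * exp (- x / 2) for a multiple of 1 /
  x^2.\<close>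

lemma binomial_cdf_upper:
  assumes l: "1 \<le> l" and m: "2 * l \<le> m" and s: "0 \<le> s" "exp s \<le> real m"
  shows "multinomial_cdf l m (exp s / real m) 0 \<le> (log_tail_bound l s)\<^sup>2"
proof -
  define x where "x = exp s"
  have x: "1 \<le> x" "x \<le> real m" and m0: "0 < real m"
    using s l m by (auto simp: x_def)
  have "multinomial_cdf l m (x / m) 0 = (\<Sum>a<l. real (m choose a) * (x / m) ^ a * (1 - x / m) ^ (m - a))"
    using multinomial_cdf_0[OF l] by simp
  also have "\<dots> \<le> (\<Sum>a<l. x ^ l * exp (- x / 2))"
  proof (rule sum_mono)
    fix a assume "a \<in> {..<l}"
    then have a: "a < l" by simp
    have "real (m choose a) * (x / m) ^ a \<le> real m ^ a * (x / m) ^ a"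
      using x m0 binomial_le_pow[of a m] a m
      by (intro mult_right_mono) (auto simp flip: of_nat_power)
    also have "\<dots> = x ^ a"
      using m0 by (simp add: power_divide)
    also have "\<dots> \<le> x ^ l"
      using x a by (intro power_increasing) auto
    finally have 1: "real (m choose a) * (x / m) ^ a \<le> x ^ l" .
    have "(1 - x / m) ^ (m - a) \<le> exp (- x / m) ^ (m - a)"
      using x m0 exp_ge_add_one_self[of "- x / m"] by (intro power_mono) (auto simp: field_simps)
    also have "\<dots> = exp (- (x * (real (m - a) / m)))"
      by (simp add: exp_of_nat_mult[symmetric] field_simps)
    also have "\<dots> \<le> exp (- (x * (1 / 2)))"
    proof -
      \<comment> \<open>Here \<open>2 * l \<le> m\<close> enters: at least half of the exponent
        \<open>m\<close> survives the subtraction of \<open>a\<close>.\<close>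
      have "1 / 2 \<le> real (m - a) / m"
        using a m m0 by (simp add: field_simps of_nat_diff)
      then show ?thesis
        using x mult_left_mono[of "1 / 2" "real (m - a) / m" x] by simp
    qed
    finally have 2: "(1 - x / m) ^ (m - a) \<le> exp (- x / 2)"
      by simp
    show "real (m choose a) * (x / m) ^ a * (1 - x / m) ^ (m - a) \<le> x ^ l * exp (- x / 2)"
      using 1 2 x m0 by (intro mult_mono) auto
  qed
  also have "\<dots> = real l * (x ^ l * exp (- x / 2))"
    by simp
  also have "\<dots> \<le> real l * ((2 ^ (l + 2) * fact (l + 2)) / x\<^sup>2)"
  proof (intro mult_left_mono)
    define C :: real where "C = 2 ^ (l + 2) * fact (l + 2)"
    have "C > 0"
      by (simp add: C_def)
    \<comment> \<open>A single term of the exponential series. The two powers beyond x^l are what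
      produces the decay exp (- 2 s).\<close>
    have "x ^ (l + 2) / C \<le> exp (x / 2)"
    proof -
      have "x ^ (l + 2) / C = (\<Sum>n\<in>{l + 2}. (x / 2) ^ n /\<^sub>R fact n)"
        unfolding C_def by (simp add: field_simps)
      also have "\<dots> \<le> (\<Sum>n. (x / 2) ^ n /\<^sub>R fact n)"
        using x summable_exp_generic[of "x / 2"] by (intro sum_le_suminf) auto
      finally show ?thesis
        by (simp add: exp_def)
    qed
    then have "x ^ l * x\<^sup>2 \<le> C * exp (x / 2)"
      using \<open>C > 0\<close> by (simp only: power_add pos_divide_le_eq mult.commute)
    then have "x ^ l * x\<^sup>2 * exp (- x / 2) \<le> C * exp (x / 2) * exp (- x / 2)"
      by (intro mult_right_mono) auto
    also have "\<dots> = C"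
      by (simp add: mult_exp_exp)
    finally show "x ^ l * exp (- x / 2) \<le> (2 ^ (l + 2) * fact (l + 2)) / x\<^sup>2"
      using x unfolding C_def[symmetric] by (subst pos_le_divide_eq) (auto simp: mult_ac)
  qed simp
  also have "\<dots> = (log_tail_bound l s)\<^sup>2"
  proof -
    have "(log_tail_const l)\<^sup>2 = real l * (2 ^ (l + 2) * fact (l + 2))"
      unfolding log_tail_const_def by (intro real_sqrt_pow2) auto
    moreover have "(exp (- s))\<^sup>2 = 1 / x\<^sup>2"
      by (simp add: x_def exp_minus power_one_over inverse_eq_divide)
    ultimately show ?thesis
      using s by (simp add: log_tail_bound_def power_mult_distrib del: fact_Suc power_Suc)
  qed
  finally show ?thesis
    by (simp add: x_def)
qed

text \<open>Only the term a = 0 is kept, and Bernoulli's inequality bounds it below by 1 - exp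
  s.\<close>

lemma binomial_cdf_lower:
  assumes l: "1 \<le> l" and m: "1 \<le> m" and s: "s < 0"
  shows "1 - multinomial_cdf l m (exp s / real m) 0 \<le> (log_tail_bound l s)\<^sup>2"
proof -
  have e: "exp s / m \<le> 1" "0 < real m"
    using m s by (auto simp: field_simps intro: order_trans[of _ 1])
  have "1 - exp s \<le> (1 - exp s / m) ^ m"
    using Bernoulli_inequality[of "- (exp s / m)" m] e by simp
  also have "\<dots> = (\<Sum>a\<in>{0}. real (m choose a) * (exp s / m) ^ a * (1 - exp s / m) ^ (m - a))"
    by simp
  also have "\<dots> \<le> (\<Sum>a<l. real (m choose a) * (exp s / m) ^ a * (1 - exp s / m) ^ (m - a))"
    using l e by (intro sum_mono2) auto
  also have "\<dots> = multinomial_cdf l m (exp s / real m) 0"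
    by (rule multinomial_cdf_0[OF l, symmetric])
  finally show ?thesis
    using s by (simp add: log_tail_bound_def power2_eq_square exp_add[symmetric])
qed

text \<open>Tail of ln (m * U) at \<open>s\<close>, that is, the tail of U at exp s / m. Since U <=
  1 it is 0 once exp s exceeds m, where the polynomial \<open>multinomial_cdf\<close> is no longer a
  probability.\<close>

definition log_count_tail :: "nat \<Rightarrow> nat \<Rightarrow> real \<Rightarrow> real" where
  "log_count_tail l m s = (if exp s \<le> real m then multinomial_cdf l m (exp s / real m) 0 else 0)"

lemma log_count_tail_tendsto:
  assumes "1 \<le> l"
  shows "(\<lambda>m. log_count_tail l m s) \<longlonglongrightarrow> poisson_cdf l (exp s)"
proof -
  have "(\<lambda>m. multinomial_cdf l m (exp s / real m) 0) \<longlonglongrightarrow> poisson_cdf l (exp s)"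
  proof (rule binomial_cdf_tendsto[OF assms])
    show "(\<lambda>m. exp s / real m) \<longlonglongrightarrow> 0"
      by real_asymp
    show "(\<lambda>m. real m * (exp s / real m)) \<longlonglongrightarrow> exp s"
      by real_asymp
  qed (auto simp: filterlim_ident)
  moreover have "\<forall>\<^sub>F m in sequentially. exp s \<le> real m"
    by real_asymp
  then have "\<forall>\<^sub>F m in sequentially. multinomial_cdf l m (exp s / real m) 0 = log_count_tail l m s"
    by eventually_elim (simp add: log_count_tail_def)
  ultimately show ?thesis
    by (rule Lim_transform_eventually)
qed

section \<open>The digamma function as an integral of Poisson tails\<close>

lemma poisson_cdf_Suc: "poisson_cdf (Suc l) x = poisson_cdf l x + x ^ l / fact l * exp (- x)"
  by (simp add: poisson_cdf_def algebra_simps)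

lemma poisson_cdf_0: "poisson_cdf (Suc l) 0 = 1"
proof -
  have "(\<Sum>j<Suc l. (0::real) ^ j / fact j) = (\<Sum>j<Suc l. if j = 0 then 1 else 0)"
    by (intro sum.cong) auto
  then show ?thesis
    by (simp add: poisson_cdf_def sum.delta del: sum.lessThan_Suc)
qed

lemma poisson_cdf_measurable[measurable]: "poisson_cdf l \<in> borel_measurable borel"
  unfolding poisson_cdf_def[abs_def] by measurable

text \<open>The sum telescopes: differentiating the newest term cancels the derivative left by the
  previous ones. For x > 0 the result is minus the Gamma density of shape l + 1.\<close>

lemma DERIV_poisson_cdf:
  "(poisson_cdf (Suc l) has_real_derivative - (x ^ l / fact l) * exp (- x)) (at x)"
proof (induction l)
  case 0
  show ?case
    unfolding poisson_cdf_def[abs_def] by (auto intro!: derivative_eq_intros)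
next
  case (Suc l)
  have "((\<lambda>x. x ^ Suc l) has_real_derivative real (Suc l) * x ^ l) (at x)"
    using DERIV_pow[of "Suc l" x UNIV] by simp
  moreover have "((\<lambda>x. exp (- x)) has_real_derivative exp (- x) * - 1) (at x)"
    by (auto intro!: derivative_eq_intros)
  ultimately have "((\<lambda>x. poisson_cdf (Suc l) x + x ^ Suc l / fact (Suc l) * exp (- x)) has_real_derivative
      - (x ^ l / fact l) * exp (- x) + (x ^ Suc l / fact (Suc l) * (exp (- x) * - 1) + (real (Suc l) * x ^ l) / fact (Suc l) * exp (- x))) (at x)"
    by (intro DERIV_add Suc.IH DERIV_mult' DERIV_cdivide)
  moreover have "(real (Suc l) * x ^ l) / fact (Suc l) = x ^ l / fact l"
    by (simp add: fact_Suc del: of_nat_Suc)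
  ultimately have "((\<lambda>x. poisson_cdf (Suc l) x + x ^ Suc l / fact (Suc l) * exp (- x)) has_real_derivative
      - (x ^ Suc l / fact (Suc l)) * exp (- x)) (at x)"
    by (simp only:) simp
  then show ?case
    unfolding poisson_cdf_Suc[of "Suc l", abs_def] .
qed

text \<open>The integrand is exp (l * s) * exp (- exp s) / l!, whose integral is Gamma(l) / l! = 1 /
  l; \<open>- poisson_cdf l (exp s) / l\<close> is a primitive. This is the increment in the
  recurrence of \<open>Digamma\<close>.\<close>

lemma poisson_log_mean_Suc:
  assumes "1 \<le> l"
  shows "integrable lborel (\<lambda>s. poisson_cdf (Suc l) (exp s) - poisson_cdf l (exp s))"
    and "(\<integral>s. poisson_cdf (Suc l) (exp s) - poisson_cdf l (exp s) \<partial>lborel) = 1 / real l"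
proof -
  obtain j where j: "l = Suc j"
    using assms by (cases l) auto
  let ?f = "\<lambda>s::real. exp s ^ l / fact l * exp (- exp s)"
  let ?F = "\<lambda>s. - poisson_cdf l (exp s) / real l"
  have D: "(?F has_real_derivative ?f s) (at s)" for s
  proof -
    have "((\<lambda>s. poisson_cdf l (exp s)) has_real_derivative - (exp s ^ j / fact j) * exp (- exp s) * exp s) (at s)"
      unfolding j by (rule DERIV_chain2[OF DERIV_poisson_cdf DERIV_exp])
    then have "(?F has_real_derivative - (- (exp s ^ j / fact j) * exp (- exp s) * exp s) / real l) (at s)"
      by (intro DERIV_cdivide DERIV_minus)
    also have "- (- (exp s ^ j / fact j) * exp (- exp s) * exp s) / real l = ?f s"
      by (simp add: j divide_simps)
    finally show ?thesis .
  qed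
  have top: "(?F \<longlongrightarrow> 0) at_top"
  proof -
    have "((\<lambda>x. \<Sum>j<l. x ^ j / exp x / fact j) \<longlongrightarrow> (\<Sum>j<l. 0 / fact j)) (at_top :: real filter)"
      by (intro tendsto_sum tendsto_divide tendsto_power_div_exp_0 tendsto_const) auto
    moreover have "(\<Sum>j<l. x ^ j / exp x / fact j) = poisson_cdf l x" for x :: real
      unfolding poisson_cdf_def sum_distrib_right by (intro sum.cong) (simp_all add: exp_minus divide_inverse mult_ac)
    ultimately have "(poisson_cdf l \<longlongrightarrow> 0) at_top"
      by simp
    from filterlim_compose[OF this exp_at_top] have "(?F \<longlongrightarrow> - 0 / real l) at_top"
      using assms by (intro tendsto_divide tendsto_minus tendsto_const) auto
    then show ?thesis by simp
  qed
  have bot: "(?F \<longlongrightarrow> - 1 / real l) at_bot"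
  proof -
    have "isCont (poisson_cdf l) 0"
      unfolding j by (rule DERIV_isCont[OF DERIV_poisson_cdf])
    then have "(poisson_cdf l \<longlongrightarrow> 1) (nhds 0)"
      using tendsto_at_iff_tendsto_nhds[of "poisson_cdf l" 0] poisson_cdf_0[of j] j by (simp add: isCont_def)
    from filterlim_compose[OF this exp_at_bot] show ?thesis
      using assms by (intro tendsto_divide tendsto_minus tendsto_const) auto
  qed
  note FTC = interval_integral_FTC_nonneg[where F="?F" and f="?f" and a="-\<infinity>" and b="\<infinity>" and A="- 1 / real l" and B=0]
  have eq: "poisson_cdf (Suc l) (exp s) - poisson_cdf l (exp s) = ?f s" for s
    by (simp add: poisson_cdf_Suc)
  have cont: "isCont ?f s" for s
    by (intro continuous_intros) auto
  have "set_integrable lborel (einterval (-\<infinity>) \<infinity>) ?f" "(LBINT x=-\<infinity>..\<infinity>. ?f x) = 0 - (- 1 / real l)"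
    using D cont top bot by (intro FTC; auto simp: ereal_tendsto_simps)+
  then show "integrable lborel (\<lambda>s. poisson_cdf (Suc l) (exp s) - poisson_cdf l (exp s))"
    "(\<integral>s. poisson_cdf (Suc l) (exp s) - poisson_cdf l (exp s) \<partial>lborel) = 1 / real l"
    unfolding eq by (simp_all add: set_integrable_def interval_lebesgue_integral_def set_lebesgue_integral_def einterval_def)
qed

text \<open>The exact mean of ln (m * U) for the minimum U of m independent uniform
  variables.\<close>

lemma integral_log_count_tail_1:
  assumes "1 \<le> m"
  shows "(\<integral>s. log_count_tail 1 m s - indicator {..<0} s \<partial>lborel) = ln (real m) - harm m"
proof -
  let ?f = "\<lambda>s. 1 - (1 - exp s / real m) ^ m"
  \<comment> \<open>A primitive of \<open>?f\<close>: with w = 1 - exp s / m, the i-th summand has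
    derivative (1 - w) * w^i, and the geometric sum is 1 - w^m. At s = ln m, where w = 0, it equals
    the harmonic number.\<close>
  let ?F = "\<lambda>s. \<Sum>i<m. (1 - (1 - exp s / real m) ^ Suc i) / real (Suc i)"
  have m: "0 < real m" "0 \<le> ln (real m)"
    using assms by auto
  have D: "(?F has_real_derivative ?f s) (at s)" for s
  proof -
    have "((\<lambda>s. (1 - (1 - exp s / real m) ^ Suc i) / real (Suc i)) has_real_derivative
        exp s / real m * (1 - exp s / real m) ^ i) (at s)" for i
    proof -
      let ?w = "\<lambda>s. 1 - exp s / real m"
      have "(?w has_real_derivative - (exp s / real m)) (at s)"
        using m by (auto intro!: derivative_eq_intros)
      from DERIV_power_Suc[OF this, of i]
      have "((\<lambda>s. (1 - ?w s ^ Suc i) / real (Suc i)) has_real_derivative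
          (0 - (1 + real i) * (- (exp s / real m) * ?w s ^ i)) / real (Suc i)) (at s)"
        by (intro DERIV_cdivide DERIV_diff DERIV_const)
      then show ?thesis
        by (simp add: add.commute)
    qed
    then have "(?F has_real_derivative (\<Sum>i<m. exp s / real m * (1 - exp s / real m) ^ i)) (at s)"
      by (intro DERIV_sum)
    also have "(\<Sum>i<m. exp s / real m * (1 - exp s / real m) ^ i) = ?f s"
      using one_diff_power_eq[of "1 - exp s / real m" m] by (simp add: sum_distrib_left)
    finally show ?thesis .
  qed
  have bot: "(?F \<longlongrightarrow> 0) at_bot"
  proof -
    have "((\<lambda>s. \<Sum>i<m. (1 - (1 - exp s / real m) ^ Suc i) / real (Suc i)) \<longlongrightarrow> (\<Sum>i<m. (1 - (1 - 0 / real m) ^ Suc i) / real (Suc i))) at_bot"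
      using m by (intro tendsto_intros exp_at_bot) auto
    then show ?thesis by simp
  qed
  have left: "(?F \<longlongrightarrow> harm m) (at_left (ln (real m)))"
  proof -
    have "isCont ?F (ln (real m))"
      by (rule DERIV_isCont[OF D])
    moreover have "?F (ln (real m)) = harm m"
    proof -
      have "exp (ln (real m)) / real m = 1"
        using m by simp
      then show ?thesis
        unfolding harm_def by (simp only: One_nat_def sum.atLeast_Suc_atMost_Suc_shift sum.atLeast1_atMost_eq) (simp add: inverse_eq_divide)
    qed
    ultimately show ?thesis
      unfolding isCont_def filterlim_at_split by (simp only:)
  qed
  note FTC = interval_integral_FTC_nonneg[where F="?F" and f="?f" and a="-\<infinity>" and b="ereal (ln (real m))" and A=0 and B="harm m"]
  have cont: "isCont ?f s" for s
    using m by (intro continuous_intros) auto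
  have nonneg: "0 \<le> ?f s" if "s < ln (real m)" for s
  proof -
    have "exp s < real m"
      using that m by (metis exp_less_mono exp_ln)
    then show ?thesis
      using m by (simp add: power_le_one)
  qed
  have I: "set_integrable lborel (einterval (-\<infinity>) (ln (real m))) ?f" "(LBINT x=-\<infinity>..ln (real m). ?f x) = harm m - 0"
  proof -
    have bot': "((?F \<circ> real_of_ereal) \<longlongrightarrow> 0) (at_right (- \<infinity>))"
      unfolding ereal_tendsto_simps by (rule bot)
    have left': "((?F \<circ> real_of_ereal) \<longlongrightarrow> harm m) (at_left (ereal (ln (real m))))"
      unfolding ereal_tendsto_simps by (rule left)
    have ae: "AE s in lborel. - \<infinity> < ereal s \<longrightarrow> ereal s < ereal (ln (real m)) \<longrightarrow> 0 \<le> ?f s"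
      using nonneg by (intro AE_I2) simp
    have less: "- \<infinity> < ereal (ln (real m))"
      by simp
    show "set_integrable lborel (einterval (-\<infinity>) (ln (real m))) ?f" "(LBINT x=-\<infinity>..ln (real m). ?f x) = harm m - 0"
      by (rule FTC[OF less D cont ae bot' left'])+
  qed
  have "(\<integral>s. log_count_tail 1 m s - indicator {..<0} s \<partial>lborel) =
      (\<integral>s. indicator {0..ln (real m)} s - indicator {..<ln (real m)} s * ?f s \<partial>lborel)"
  proof (rule integral_cong_AE)
    have "AE s in lborel. s \<noteq> ln (real m)"
      by (rule AE_lborel_singleton)
    then show "AE s in lborel. log_count_tail 1 m s - indicator {..<0} s =
        indicator {0..ln (real m)} s - indicator {..<ln (real m)} s * ?f s"
    proof eventually_elim
      case (elim s)
      have "0 \<le> s" if "\<not> s \<le> ln (real m)"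
        using that m(2) by linarith
      moreover have "exp s \<le> real m \<longleftrightarrow> s \<le> ln (real m)"
        using m by (metis exp_le_cancel_iff exp_ln)
      ultimately show ?case
        using elim m(1)
        by (cases "0 \<le> s"; cases "s \<le> ln (real m)") (auto simp: log_count_tail_def multinomial_cdf_0 indicator_def)
    qed
    show "(\<lambda>s. log_count_tail 1 m s - indicator {..<0} s) \<in> borel_measurable lborel"
      unfolding log_count_tail_def multinomial_cdf_def by measurable
  qed measurable
  also have "\<dots> = ln (real m) - harm m"
    using I m by (simp add: set_integrable_def interval_lebesgue_integral_def set_lebesgue_integral_def
        einterval_def lessThan_def)
  finally show ?thesis .
qed

text \<open>For l = 1 the exact finite means converge, by dominated convergence, to minus Euler's
  constant, which is Digamma at 1. Induction with \<open>poisson_log_mean_Suc\<close> gives the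
  rest.\<close>

lemma poisson_log_mean:
  assumes "1 \<le> l"
  shows "integrable lborel (\<lambda>s. poisson_cdf l (exp s) - indicator {..<0} s)"
    and "(\<integral>s. poisson_cdf l (exp s) - indicator {..<0} s \<partial>lborel) = Digamma (real l)"
proof -
  let ?h = "\<lambda>m s. log_count_tail 1 m s - indicator {..<0} s :: real"
  let ?b = "\<lambda>s. (1 + log_tail_const 1) * log_tail_bound 1 s"
  have b: "(log_tail_bound 1 s)\<^sup>2 \<le> ?b s" for s
    unfolding power2_eq_square using log_tail_bound_le log_tail_bound_nonneg by (intro mult_right_mono) auto
  \<comment> \<open>The shift by 2 meets the condition \<open>2 * l \<le> m\<close> of the upper
    tail bound for l = 1.\<close>
  have tail: "norm (?h (m + 2) s) \<le> ?b s" for m s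
  proof (cases "s < 0")
    case True
    have "exp s \<le> real (m + 2)"
      by (rule order_trans[of "exp s" 1]) (use True in auto)
    moreover have "multinomial_cdf 1 (m + 2) (exp s / real (m + 2)) 0 \<le> 1"
      using calculation power_le_one[of "1 - exp s / real (m + 2)" "m + 2"]
      by (simp add: multinomial_cdf_0 del: power_Suc power_add_numeral2)
    ultimately show ?thesis
      using True binomial_cdf_lower[of 1 "m + 2" s] b[of s]
      unfolding log_count_tail_def by simp
  next
    case False
    then show ?thesis
      using binomial_cdf_upper[of 1 "m + 2" s] b[of s] log_tail_bound_nonneg[of 1 s] log_tail_const_nonneg[of 1]
      by (auto simp: log_count_tail_def multinomial_cdf_0)
  qed
  have int: "integrable lborel ?b"
    using integrable_log_tail_bound by simp
  have lim: "(\<lambda>m. ?h (m + 2) s) \<longlonglongrightarrow> poisson_cdf 1 (exp s) - indicator {..<0} s" for s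
    using LIMSEQ_ignore_initial_segment[OF log_count_tail_tendsto[of 1 s], of 2]
    by (intro tendsto_diff tendsto_const) auto
  have meas: "?h m \<in> borel_measurable lborel" for m
    unfolding log_count_tail_def multinomial_cdf_def by measurable
  note DCT = _ meas int AE_I2[OF lim] AE_I2[OF tail]
  have 1: "integrable lborel (\<lambda>s. poisson_cdf 1 (exp s) - indicator {..<0} s)"
    by (rule integrable_dominated_convergence[OF DCT]) measurable
  have "(\<lambda>m. \<integral>s. ?h (m + 2) s \<partial>lborel) \<longlonglongrightarrow> (\<integral>s. poisson_cdf 1 (exp s) - indicator {..<0} s \<partial>lborel)"
    by (rule integral_dominated_convergence[OF DCT]) measurable
  moreover have "(\<integral>s. ?h (m + 2) s \<partial>lborel) = - (harm (m + 2) - ln (real (m + 2)))" for m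
    by (subst integral_log_count_tail_1) auto
  moreover have "(\<lambda>m. - (harm (m + 2) - ln (real (m + 2)))) \<longlonglongrightarrow> - euler_mascheroni"
    by (intro tendsto_minus LIMSEQ_ignore_initial_segment[OF euler_mascheroni_LIMSEQ])
  ultimately have 2: "(\<integral>s. poisson_cdf 1 (exp s) - indicator {..<0} s \<partial>lborel) = - euler_mascheroni"
    using LIMSEQ_unique by fastforce
  have "integrable lborel (\<lambda>s. poisson_cdf l (exp s) - indicator {..<0} s) \<and>
    (\<integral>s. poisson_cdf l (exp s) - indicator {..<0} s \<partial>lborel) = Digamma (real l)"
    using assms
  proof (induction l rule: dec_induct)
    case base
    then show ?case
      using 1 2 by simp
  next
    case (step l)
    have eq: "poisson_cdf (Suc l) (exp s) - indicator {..<0} s = (poisson_cdf l (exp s) - indicator {..<0} s) +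
        (poisson_cdf (Suc l) (exp s) - poisson_cdf l (exp s))" for s
      by simp
    have "Digamma (real (Suc l)) = Digamma (real l) + 1 / real l"
      using Digamma_plus1[of "real l"] step by (simp add: add.commute)
    moreover note IH = step.IH[THEN conjunct1] step.IH[THEN conjunct2] and S = poisson_log_mean_Suc[OF step.hyps(1)]
    ultimately show ?case
      unfolding eq using Bochner_Integration.integrable_add[OF IH(1) S(1)]
        Bochner_Integration.integral_add[OF IH(1) S(1)] IH(2) S(2) by metis
  qed
  then show "integrable lborel (\<lambda>s. poisson_cdf l (exp s) - indicator {..<0} s)"
    "(\<integral>s. poisson_cdf l (exp s) - indicator {..<0} s \<partial>lborel) = Digamma (real l)"
    by auto
qed

section \<open>Small balls under a density\<close>

text \<open>Probability integral transform for an atomless law. The distribution function may have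
  flat pieces, so it is not inverted: its sublevel set is identified as a closed half-line, at whose
  end point the value is exactly \<open>u\<close>.\<close>

lemma (in real_distribution) prob_cdf_le:
  assumes cont: "\<And>r. measure M {r} = 0" and u: "0 \<le> u" "u \<le> 1"
  shows "prob {r. cdf M r \<le> u} = u"
proof (cases "u = 1")
  case True
  then have "{r. cdf M r \<le> u} = space M"
    using cdf_bounded_prob by auto
  then show ?thesis
    using True prob_space by simp
next
  case False
  let ?S = "{r. cdf M r \<le> u}"
  have isC: "isCont (cdf M) r" for r
    using cont isCont_cdf by simp
  have closed: "closed ?S"
    using isC by (intro closed_Collect_le continuous_at_imp_continuous_on ballI continuous_on_const) auto
  have "\<forall>\<^sub>F r in at_top. u < cdf M r"
    using False u by (intro order_tendstoD(1)[OF cdf_lim_at_top_prob]) auto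
  then obtain K where K: "\<And>r. K \<le> r \<Longrightarrow> u < cdf M r"
    by (auto simp: eventually_at_top_linorder)
  then have bdd: "bdd_above ?S"
    by (intro bdd_aboveI[of _ K]) (metis linorder_not_less linorder_linear mem_Collect_eq)
  show ?thesis
  proof (cases "?S = {}")
    case True
    then have "u = 0"
    proof -
      have "\<not> 0 < u"
      proof
        assume "0 < u"
        then have "\<forall>\<^sub>F r in at_bot. cdf M r < u"
          by (intro order_tendstoD(2)[OF cdf_lim_at_bot])
        then obtain r where "cdf M r < u"
          by (auto simp: eventually_at_bot_linorder)
        then show False
          using True by (metis empty_Collect_eq less_imp_le)
      qed
      then show ?thesis
        using u by simp
    qed
    then show ?thesis
      using True by simp
  next
    case ne: False
    let ?r = "Sup ?S"
    have S: "?S = {..?r}"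
    proof (intro equalityI subsetI)
      fix r assume "r \<in> ?S"
      then show "r \<in> {..?r}"
        using bdd by (auto intro: cSup_upper)
    next
      fix r assume r: "r \<in> {..?r}"
      have "?r \<in> ?S"
        by (rule closed_contains_Sup[OF ne bdd closed])
      then show "r \<in> ?S"
        using r cdf_nondecreasing[of r ?r] by auto
    qed
    have "cdf M ?r = u"
    proof (rule antisym)
      show "cdf M ?r \<le> u"
        using closed_contains_Sup[OF ne bdd closed] by simp
      \<comment> \<open>To the right of the supremum the value exceeds \<open>u\<close>; right
        continuity carries this to the supremum.\<close>
      have "(cdf M \<longlongrightarrow> cdf M ?r) (at_right ?r)"
        using cdf_is_right_cont[of ?r] by (simp add: continuous_within)
      moreover have "\<forall>\<^sub>F r in at_right ?r. u \<le> cdf M r"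
        using S by (intro eventually_at_right_less[THEN eventually_mono]) (metis atMost_iff linorder_linear mem_Collect_eq not_less)
      ultimately show "u \<le> cdf M ?r"
        by (rule tendsto_lowerbound) simp
    qed
    then show ?thesis
      using S by (simp add: cdf_def)
  qed
qed

text \<open>The lower bound makes the log density and the logarithms of ball averages at most
  quadratic in \<open>norm x\<close> for bounded radii; the fourth moment then makes their squares
  integrable. A single \<open>C\<close> for both sides yields one bound for the modulus of the log
  density.\<close>

locale tame_density =
  fixes q :: "'b::euclidean_space \<Rightarrow> real" and C :: real
  assumes continuous: "continuous_on UNIV q"
    and upper: "q x \<le> exp C"
    and lower: "exp (- (C * (1 + (norm x)\<^sup>2))) \<le> q x"
    and C_nonneg: "0 \<le> C"
    and prob_space_density: "prob_space (density lborel q)"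
    and moment4: "integrable (density lborel q) (\<lambda>x. norm x ^ 4)"
begin

definition Q :: "'b measure" where "Q = density lborel (\<lambda>x. ennreal (q x))"

sublocale Q: prob_space Q
  unfolding Q_def by (rule prob_space_density)

lemma sets_Q[measurable_cong, simp]: "sets Q = sets borel" and space_Q[simp]: "space Q = UNIV"
  by (simp_all add: Q_def)

lemma pos: "0 < q x"
  using lower[of x] exp_gt_zero order_less_le_trans by blast

lemma q_measurable[measurable]: "q \<in> borel_measurable borel"
  by (intro borel_measurable_continuous_onI continuous)

lemma emeasure_Q: "A \<in> sets borel \<Longrightarrow> emeasure Q A = (\<integral>\<^sup>+x. ennreal (q x) * indicator A x \<partial>lborel)"
  unfolding Q_def by (rule emeasure_density) auto

lemma null_sets_Q: "A \<in> null_sets lborel \<Longrightarrow> measure Q A = 0"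
  using absolutely_continuousI_density[of "\<lambda>x. ennreal (q x)" lborel]
  by (auto simp: absolutely_continuous_def Q_def measure_def null_sets_def)

lemma measure_ge:
  assumes A: "A \<in> sets borel" "emeasure lborel A < \<infinity>" and c: "0 \<le> c" "\<And>x. x \<in> A \<Longrightarrow> c \<le> q x"
  shows "c * measure lborel A \<le> measure Q A"
proof -
  have "ennreal (c * measure lborel A) = (\<integral>\<^sup>+x. ennreal c * indicator A x \<partial>lborel)"
    using A c by (simp add: nn_integral_cmult_indicator ennreal_mult' emeasure_eq_ennreal_measure)
  also have "\<dots> \<le> (\<integral>\<^sup>+x. ennreal (q x) * indicator A x \<partial>lborel)"
    using c by (intro nn_integral_mono) (auto simp: indicator_def intro: ennreal_leI)
  also have "\<dots> = ennreal (measure Q A)"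
    using emeasure_Q[OF A(1)] by (simp add: Q.emeasure_eq_measure)
  finally show ?thesis
    by simp
qed

lemma measure_le:
  assumes A: "A \<in> sets borel" "emeasure lborel A < \<infinity>" and c: "0 \<le> c" "\<And>x. x \<in> A \<Longrightarrow> q x \<le> c"
  shows "measure Q A \<le> c * measure lborel A"
proof -
  have "ennreal (measure Q A) = (\<integral>\<^sup>+x. ennreal (q x) * indicator A x \<partial>lborel)"
    using emeasure_Q[OF A(1)] by (simp add: Q.emeasure_eq_measure)
  also have "\<dots> \<le> (\<integral>\<^sup>+x. ennreal c * indicator A x \<partial>lborel)"
    using c by (intro nn_integral_mono) (auto simp: indicator_def intro: ennreal_leI)
  also have "\<dots> = ennreal (c * measure lborel A)"
    using A c by (simp add: nn_integral_cmult_indicator ennreal_mult' emeasure_eq_ennreal_measure)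
  finally show ?thesis
    using c by simp
qed

text \<open>As a function of \<open>r\<close> this is the distribution function of the distance from
  \<open>x\<close> to a point with law \<open>Q\<close>.\<close>

definition ball_prob :: "'b \<Rightarrow> real \<Rightarrow> real" where
  "ball_prob x r = measure Q (cball x r)"

lemma mono_ball_prob: "mono (ball_prob x)"
  unfolding ball_prob_def by (intro monoI Q.finite_measure_mono) auto

lemma ball_prob_0: "ball_prob x 0 = 0"
  unfolding ball_prob_def by (intro null_sets_Q) (simp add: null_sets_def)

lemma ball_prob_le_1: "ball_prob x r \<le> 1"
  unfolding ball_prob_def by simp

text \<open>The ball probability is a parameter integral of an indicator that is jointly measurable
  in centre, radius and point.\<close>

lemma ball_prob_measurable[measurable (raw)]:
  assumes [measurable]: "f \<in> borel_measurable N" "g \<in> borel_measurable N"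
  shows "(\<lambda>\<omega>. ball_prob (f \<omega>) (g \<omega>)) \<in> borel_measurable N"
proof -
  have "(\<lambda>\<omega>. \<integral>y. (if dist (f \<omega>) y \<le> g \<omega> then 1 else 0 :: real) \<partial>Q) \<in> borel_measurable N"
    by measurable
  moreover have "(\<integral>y. (if dist (f \<omega>) y \<le> g \<omega> then 1 else 0 :: real) \<partial>Q) = ball_prob (f \<omega>) (g \<omega>)" for \<omega>
  proof -
    have "(\<integral>y. (if dist (f \<omega>) y \<le> g \<omega> then 1 else 0 :: real) \<partial>Q) = (\<integral>y. indicator (cball (f \<omega>) (g \<omega>)) y \<partial>Q)"
      by (intro Bochner_Integration.integral_cong) (auto simp: indicator_def)
    then show ?thesis
      by (simp add: ball_prob_def)
  qed
  ultimately show ?thesis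
    by simp
qed

text \<open>Spheres are Lebesgue null, so the distance to \<open>x\<close> has an atomless law and
  the probability integral transform applies.\<close>

lemma prob_ball_prob_le:
  assumes "0 \<le> u" "u \<le> 1"
  shows "measure Q {y. ball_prob x (dist x y) \<le> u} = u"
proof -
  define D where "D = distr Q borel (dist x)"
  interpret D: real_distribution D
    unfolding D_def by (intro real_distribution.intro Q.prob_space_distr real_distribution_axioms.intro) auto
  have meas: "measure D A = measure Q (dist x -` A)" if "A \<in> sets borel" for A
    unfolding D_def using that by (subst measure_distr) auto
  have "measure D {r} = 0" for r
  proof -
    have "dist x -` {r} = sphere x r"
      by auto
    moreover have "sphere x r \<in> null_sets lborel"
      using negligible_sphere[of x r]
      by (auto simp: null_sets_completion_iff negligible_iff_null_sets negligible_convex_frontier)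
    ultimately show ?thesis
      by (simp add: meas null_sets_Q)
  qed
  then have "measure D {r. cdf D r \<le> u} = u"
    using assms by (rule D.prob_cdf_le)
  moreover have "cdf D r = ball_prob x r" for r
  proof -
    have "dist x -` {..r} = cball x r"
      by auto
    then show ?thesis
      by (simp add: cdf_def meas ball_prob_def)
  qed
  moreover have "{r. ball_prob x r \<le> u} \<in> sets borel"
  proof -
    have "(\<lambda>r. ball_prob x r) \<in> borel_measurable borel"
      by (rule borel_measurable_mono[OF mono_ball_prob])
    then show ?thesis
      by measurable
  qed
  ultimately show ?thesis
    by (simp add: meas vimage_def)
qed

lemma emeasure_cball_finite: "emeasure lborel (cball x r) < \<infinity>"
  by (rule emeasure_bounded_finite) simp

lemma ball_prob_pos:
  assumes "0 < r"
  shows "0 < ball_prob x r"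
proof -
  obtain y where y: "y \<in> cball x r" "\<And>z. z \<in> cball x r \<Longrightarrow> q y \<le> q z"
    using continuous_attains_inf[of "cball x r" q] assms continuous_on_subset[OF continuous] by auto
  have "q y * measure lborel (cball x r) \<le> ball_prob x r"
    unfolding ball_prob_def using y pos[of y] emeasure_cball_finite by (intro measure_ge) auto
  moreover have "0 < q y * measure lborel (cball x r)"
    using assms pos by (simp add: content_cball_pos)
  ultimately show ?thesis
    by simp
qed

text \<open>For \<open>r > 0\<close>, minus the logarithm of the average density over the
  ball.\<close>

definition log_ratio :: "'b \<Rightarrow> real \<Rightarrow> real" where
  "log_ratio x r = ln (measure lborel (cball x r) / ball_prob x r)"

lemma log_ratio_measurable[measurable (raw)]:
  assumes [measurable]: "f \<in> borel_measurable N" "g \<in> borel_measurable N"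
  shows "(\<lambda>\<omega>. log_ratio (f \<omega>) (g \<omega>)) \<in> borel_measurable N"
proof -
  have "measure lborel (cball (x::'b) r) = (if 0 \<le> r then unit_ball_vol DIM('b) * r ^ DIM('b) else 0)" for x r
    by (simp add: content_cball)
  then show ?thesis
    unfolding log_ratio_def by simp
qed

lemma ln_q_bounds: "\<bar>ln (q x)\<bar> \<le> C * (1 + (norm x)\<^sup>2)"
proof -
  have "ln (q x) \<le> C"
    using upper[of x] pos[of x] by (metis ln_le_cancel_iff exp_gt_zero ln_exp)
  moreover have "- (C * (1 + (norm x)\<^sup>2)) \<le> ln (q x)"
    using lower[of x] pos[of x] by (metis ln_le_cancel_iff exp_gt_zero ln_exp)
  moreover have "C * 1 \<le> C * (1 + (norm x)\<^sup>2)"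
    using C_nonneg by (intro mult_left_mono) auto
  ultimately show ?thesis
    by simp
qed

lemma log_ratio_lower:
  assumes "0 < r"
  shows "- C \<le> log_ratio x r"
proof -
  have "ball_prob x r \<le> exp C * measure lborel (cball x r)"
    unfolding ball_prob_def using upper emeasure_cball_finite by (intro measure_le) auto
  then have "exp (- C) \<le> measure lborel (cball x r) / ball_prob x r"
    using ball_prob_pos[OF assms, of x] by (simp add: exp_minus field_simps)
  then show ?thesis
    unfolding log_ratio_def by (metis ln_exp exp_gt_zero ln_le_cancel_iff order_less_le_trans)
qed

text \<open>On a ball of radius at most 1 around x, 1 + |y|^2 <= 3 + 2 |x|^2, whence the factor 4 in
  the exponent.\<close>

lemma ball_prob_ge:
  fixes r :: real
  assumes "0 < r" "r \<le> 1"
  shows "exp (- (4 * C * (1 + (norm x)\<^sup>2))) * measure lborel (cball x r) \<le> ball_prob x r"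
  unfolding ball_prob_def
proof (rule measure_ge)
  fix y assume "y \<in> cball x r"
  then have "norm y \<le> norm x + 1"
    using assms norm_triangle_ineq2[of y x] by (simp add: dist_norm norm_minus_commute)
  then have "(norm y)\<^sup>2 \<le> (norm x + 1)\<^sup>2"
    by (intro power_mono) auto
  also have "\<dots> \<le> 2 * (norm x)\<^sup>2 + 2"
    using zero_le_power2[of "norm x - 1"] by (simp add: power2_eq_square algebra_simps)
  finally have "1 + (norm y)\<^sup>2 \<le> 4 * (1 + (norm x)\<^sup>2)"
  proof -
    assume a: "(norm y)\<^sup>2 \<le> 2 * (norm x)\<^sup>2 + 2"
    have b: "0 \<le> (norm x)\<^sup>2"
      by simp
    from a b show ?thesis
      by argo
  qed
  from mult_left_mono[OF this C_nonneg]
  have "exp (- (4 * C * (1 + (norm x)\<^sup>2))) \<le> exp (- (C * (1 + (norm y)\<^sup>2)))"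
    by (simp only: exp_le_cancel_iff neg_le_iff_le mult.assoc mult.left_commute[of 4 C])
  then show "exp (- (4 * C * (1 + (norm x)\<^sup>2))) \<le> q y"
    using lower[of y] by linarith
qed (use emeasure_cball_finite in auto)

text \<open>The density bound degrades across a large ball, so for r > 1 the probability is bounded
  below by that of the concentric unit ball. The price is the volume ratio r^d, whose logarithm is
  at most d * r.\<close>

lemma log_ratio_upper:
  assumes "0 < r"
  shows "log_ratio x r \<le> 4 * C * (1 + (norm x)\<^sup>2) + real DIM('b) * r"
proof -
  let ?c = "4 * C * (1 + (norm x)\<^sup>2)"
  define s :: real where "s = min r 1"
  have s: "0 < s" "s \<le> 1" "s \<le> r"
    using assms by (auto simp: s_def)
  have le: "exp (- ?c) * measure lborel (cball x s) \<le> ball_prob x r"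
    using ball_prob_ge[OF s(1,2), of x] monoD[OF mono_ball_prob[of x] s(3)] by linarith
  have pos: "0 < measure lborel (cball x s)"
    using s by (simp add: content_cball_pos)
  have "measure lborel (cball x r) / ball_prob x r \<le> exp ?c * (r / s) ^ DIM('b)"
  proof -
    have "measure lborel (cball x r) = (r / s) ^ DIM('b) * measure lborel (cball x s)"
      using s assms by (simp add: content_cball power_divide)
    also have "measure lborel (cball x s) = exp ?c * (exp (- ?c) * measure lborel (cball x s))"
      by (simp add: mult.assoc[symmetric] mult_exp_exp)
    also have "(r / s) ^ DIM('b) * \<dots> \<le> (r / s) ^ DIM('b) * (exp ?c * ball_prob x r)"
      using le s assms by (intro mult_left_mono) auto
    finally show ?thesis
      using ball_prob_pos[OF assms, of x] by (simp add: pos_divide_le_eq mult_ac)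
  qed
  moreover have "0 < measure lborel (cball x r) / ball_prob x r"
    using ball_prob_pos[OF assms, of x] assms by (simp add: content_cball_pos)
  ultimately have "log_ratio x r \<le> ln (exp ?c * (r / s) ^ DIM('b))"
    unfolding log_ratio_def using ln_le_cancel_iff by (meson order_less_le_trans)
  also have "\<dots> = ?c + real DIM('b) * ln (r / s)"
    using s assms by (simp add: ln_mult ln_realpow)
  also have "ln (r / s) \<le> r"
  proof (cases "r \<le> 1")
    case True
    then show ?thesis
      using assms by (simp add: s_def min_def)
  next
    case False
    then have "ln (r / s) \<le> r - 1"
      using assms ln_le_minus_one[of r] by (simp add: s_def min_def)
    then show ?thesis
      by argo
  qed
  finally show ?thesis
    by (simp add: mult_left_mono)
qed

lemma log_ratio_bound:
  assumes "0 < r"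
  shows "\<bar>log_ratio x r + ln (q x)\<bar> \<le> (5 * C + real DIM('b)) * (1 + (norm x)\<^sup>2 + r)"
proof -
  have "C * 1 \<le> 4 * C * (1 + (norm x)\<^sup>2)"
    using C_nonneg by (simp add: algebra_simps)
  moreover have "0 \<le> real DIM('b) * r"
    using assms by simp
  ultimately have "\<bar>log_ratio x r\<bar> \<le> 4 * C * (1 + (norm x)\<^sup>2) + real DIM('b) * r"
    using log_ratio_upper[OF assms, of x] log_ratio_lower[OF assms, of x] by argo
  then have "\<bar>log_ratio x r + ln (q x)\<bar> \<le> 5 * C * (1 + (norm x)\<^sup>2) + real DIM('b) * r"
    using ln_q_bounds[of x] by (simp add: algebra_simps)
  also have "\<dots> \<le> (5 * C + real DIM('b)) * (1 + (norm x)\<^sup>2 + r)"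
  proof -
    have "0 \<le> 5 * C * r" "0 \<le> real DIM('b) * (1 + (norm x)\<^sup>2)"
      using assms C_nonneg by auto
    then show ?thesis
      by (simp add: algebra_simps)
  qed
  finally show ?thesis .
qed

text \<open>By continuity of the log density, the density on a small ball differs from
  \<open>q x\<close> by a factor between exp (- e / 2) and exp (e / 2), and so does its
  average.\<close>

lemma log_ratio_tendsto:
  "(log_ratio x \<longlongrightarrow> - ln (q x)) (at_right 0)"
proof (rule tendstoI)
  fix e :: real assume "0 < e"
  have "isCont (\<lambda>y. ln (q y)) x"
    using continuous pos[of x] by (intro isCont_ln' continuous_on_interior[of UNIV]) auto
  then obtain d where d: "0 < d" "\<And>y. dist y x < d \<Longrightarrow> dist (ln (q y)) (ln (q x)) < e / 2"
    using \<open>0 < e\<close> unfolding continuous_at_eps_delta by (metis half_gt_zero)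
  have "dist (log_ratio x r) (- ln (q x)) < e" if r: "0 < r" "r < d" for r
  proof -
    have q: "q x * exp (- (e / 2)) \<le> q y" "q y \<le> q x * exp (e / 2)" if "y \<in> cball x r" for y
    proof -
      have "dist (ln (q y)) (ln (q x)) < e / 2"
        using that r by (intro d) (simp add: dist_commute)
      then have "ln (q x) - e / 2 \<le> ln (q y)" "ln (q y) \<le> ln (q x) + e / 2"
        unfolding dist_real_def by linarith+
      then have "exp (ln (q x) - e / 2) \<le> exp (ln (q y))" "exp (ln (q y)) \<le> exp (ln (q x) + e / 2)"
        by simp_all
      then show "q x * exp (- (e / 2)) \<le> q y" "q y \<le> q x * exp (e / 2)"
        using exp_add[of "ln (q x)" "- (e / 2)"] exp_add[of "ln (q x)" "e / 2"] pos[of x] pos[of y]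
        by simp_all
    qed
    have P: "0 < ball_prob x r" "0 < measure lborel (cball x r)"
      using r by (auto simp: ball_prob_pos content_cball_pos)
    have "q x * exp (- (e / 2)) * measure lborel (cball x r) \<le> ball_prob x r"
      unfolding ball_prob_def using q pos[of x] emeasure_cball_finite by (intro measure_ge) (auto intro: mult_nonneg_nonneg less_imp_le)
    then have "ln (q x * exp (- (e / 2)) * measure lborel (cball x r)) \<le> ln (ball_prob x r)"
      using P pos by (subst ln_le_cancel_iff) auto
    moreover have "ball_prob x r \<le> q x * exp (e / 2) * measure lborel (cball x r)"
      unfolding ball_prob_def using q pos[of x] emeasure_cball_finite by (intro measure_le) (auto intro: mult_nonneg_nonneg less_imp_le)
    then have "ln (ball_prob x r) \<le> ln (q x * exp (e / 2) * measure lborel (cball x r))"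
      using P pos by (subst ln_le_cancel_iff) auto
    ultimately show ?thesis
      using P pos[of x] \<open>0 < e\<close> by (simp add: log_ratio_def ln_mult ln_div dist_real_def)
  qed
  then show "\<forall>\<^sub>F r in at_right 0. dist (log_ratio x r) (- ln (q x)) < e"
    unfolding eventually_at_right_field using d(1) by blast
qed

end

section \<open>Gaussian vectors\<close>

text \<open>By Fubini the coordinate along \<open>b\<close> is integrated first; with the other
  coordinates fixed, the shear is a translation in it.\<close>

lemma distr_lborel_shear:
  fixes b c :: "'b::euclidean_space"
  assumes b: "b \<in> Basis" and c: "c \<in> Basis" "c \<noteq> b"
  shows "distr lborel borel (\<lambda>x. x + (x \<bullet> c) *\<^sub>R b) = lborel"
proof (rule measure_eqI)
  interpret P: product_sigma_finite "\<lambda>_::'b. lborel :: real measure" ..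
  fix A :: "'b set" assume "A \<in> sets (distr lborel borel (\<lambda>x. x + (x \<bullet> c) *\<^sub>R b))"
  then have A[measurable]: "A \<in> sets borel"
    by simp
  let ?I = "Basis - {b} :: 'b set"
  have Basis: "Basis = insert b ?I"
    using b by auto
  have I: "finite ?I" "b \<notin> ?I" "c \<in> ?I"
    using c by auto
  define s where "s = (\<lambda>f::'b \<Rightarrow> real. \<Sum>d\<in>?I. f d *\<^sub>R d)"
  have sum_eq: "(\<Sum>d\<in>Basis. (f(b := y)) d *\<^sub>R d) = s f + y *\<^sub>R b" for f y
    unfolding s_def by (subst Basis, subst sum.insert) (auto intro!: sum.cong simp: add.commute)
  have inner_eq: "(s f + y *\<^sub>R b) \<bullet> c = f c" for f y
  proof -
    have "s f \<bullet> c = (\<Sum>d\<in>?I. if d = c then f c else 0)"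
      unfolding s_def inner_sum_left using c by (intro sum.cong) (auto simp: inner_Basis)
    then show ?thesis
      using I b c by (simp add: inner_add_left inner_Basis sum.delta)
  qed
  have nn: "(\<integral>\<^sup>+x. g x \<partial>lborel) = (\<integral>\<^sup>+f. (\<integral>\<^sup>+y. g (s f + y *\<^sub>R b) \<partial>lborel) \<partial>(\<Pi>\<^sub>M d\<in>?I. lborel))"
    if [measurable]: "g \<in> borel_measurable borel" for g :: "'b \<Rightarrow> ennreal"
  proof -
    have "(\<integral>\<^sup>+x. g x \<partial>lborel) = (\<integral>\<^sup>+f. g (\<Sum>d\<in>Basis. f d *\<^sub>R d) \<partial>(\<Pi>\<^sub>M d\<in>Basis. lborel))"
      by (subst lborel_eq) (simp add: nn_integral_distr)
    also have "\<dots> = (\<integral>\<^sup>+f. g (\<Sum>d\<in>Basis. f d *\<^sub>R d) \<partial>(\<Pi>\<^sub>M d\<in>insert b ?I. lborel))"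
      using Basis by simp
    also have "\<dots> = (\<integral>\<^sup>+f. (\<integral>\<^sup>+y. g (\<Sum>d\<in>Basis. (f(b := y)) d *\<^sub>R d) \<partial>lborel) \<partial>(\<Pi>\<^sub>M d\<in>?I. lborel))"
      using I Basis by (intro P.product_nn_integral_insert) auto
    finally show ?thesis
      unfolding sum_eq .
  qed
  have "emeasure (distr lborel borel (\<lambda>x. x + (x \<bullet> c) *\<^sub>R b)) A =
      (\<integral>\<^sup>+x. indicator A (x + (x \<bullet> c) *\<^sub>R b) \<partial>lborel)"
  proof -
    have "(\<integral>\<^sup>+x. indicator A (x + (x \<bullet> c) *\<^sub>R b) \<partial>lborel) =
        (\<integral>\<^sup>+x. indicator A x \<partial>distr lborel borel (\<lambda>x. x + (x \<bullet> c) *\<^sub>R b))"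
      by (subst nn_integral_distr) (auto simp del: nn_integral_indicator)
    also have "\<dots> = emeasure (distr lborel borel (\<lambda>x. x + (x \<bullet> c) *\<^sub>R b)) A"
      by (rule nn_integral_indicator) (simp add: A)
    finally show ?thesis ..
  qed
  also have "\<dots> = (\<integral>\<^sup>+f. (\<integral>\<^sup>+y. indicator A (s f + (f c + 1 * y) *\<^sub>R b) \<partial>lborel) \<partial>(\<Pi>\<^sub>M d\<in>?I. lborel))"
    by (subst nn, measurable) (simp only: inner_eq scaleR_add_left add_ac mult_1)
  also have "\<dots> = (\<integral>\<^sup>+f. (\<integral>\<^sup>+y. indicator A (s f + y *\<^sub>R b) \<partial>lborel) \<partial>(\<Pi>\<^sub>M d\<in>?I. lborel))"
  proof (rule nn_integral_cong)
    fix f :: "'b \<Rightarrow> real"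
    have "(\<lambda>y. indicator A (s f + y *\<^sub>R b) :: ennreal) \<in> borel_measurable borel"
      by measurable
    from nn_integral_real_affine[OF this, of 1 "f c"]
    show "(\<integral>\<^sup>+y. indicator A (s f + (f c + 1 * y) *\<^sub>R b) \<partial>lborel) = (\<integral>\<^sup>+y. indicator A (s f + y *\<^sub>R b) \<partial>lborel)"
      by simp
  qed
  also have "\<dots> = emeasure lborel A"
    by (subst nn[symmetric]) simp_all
  finally show "emeasure (distr lborel borel (\<lambda>x. x + (x \<bullet> c) *\<^sub>R b)) A = emeasure lborel A" .
qed simp

text \<open>Linear change of variables, by induction over elementary matrices. The formula is
  multiplicative; there remain a zero row, excluded by the determinant, diagonal matrices, swaps of
  coordinates and shears.\<close>

lemma distr_lborel_matrix:
  fixes A :: "real ^ 'n ^ 'n"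
  assumes "det A \<noteq> 0"
  shows "distr lborel borel ((*v) A) = density lborel (\<lambda>_. ennreal (1 / \<bar>det A\<bar>))"
proof -
  have [measurable]: "(*v) A \<in> borel_measurable borel" for A :: "real ^ 'n ^ 'n"
    by (intro borel_measurable_continuous_onI linear_continuous_on) (simp add: linear_linear)
  have "det A \<noteq> 0 \<longrightarrow> distr lborel borel ((*v) A) = density lborel (\<lambda>_. ennreal (1 / \<bar>det A\<bar>))"
  proof (rule induct_matrix_elementary_alt, goal_cases)
    case (1 A B)
    show ?case
    proof
      assume AB: "det (A ** B) \<noteq> 0"
      then have "det A \<noteq> 0" "det B \<noteq> 0"
        by (auto simp: det_mul)
      have "distr lborel borel ((*v) (A ** B)) = distr (distr lborel borel ((*v) B)) borel ((*v) A)"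
        by (subst distr_distr) (auto simp: comp_def matrix_vector_mul_assoc)
      also have "\<dots> = distr (density lborel (\<lambda>_. ennreal (1 / \<bar>det B\<bar>))) borel ((*v) A)"
        using 1 \<open>det B \<noteq> 0\<close> by simp
      also have "\<dots> = density (distr lborel borel ((*v) A)) (\<lambda>_. ennreal (1 / \<bar>det B\<bar>))"
        by (subst density_distr) auto
      also have "\<dots> = density (density lborel (\<lambda>_. ennreal (1 / \<bar>det A\<bar>))) (\<lambda>_. ennreal (1 / \<bar>det B\<bar>))"
        using 1 \<open>det A \<noteq> 0\<close> by simp
      also have "\<dots> = density lborel (\<lambda>_. ennreal (1 / \<bar>det (A ** B)\<bar>))"
        by (subst density_density_eq) (auto simp: det_mul abs_mult simp flip: ennreal_mult)
      finally show "distr lborel borel ((*v) (A ** B)) = density lborel (\<lambda>_. ennreal (1 / \<bar>det (A ** B)\<bar>))" .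
    qed
  next
    case (2 A i)
    then show ?case
      using det_zero_row(1) by blast
  next
    case (3 A)
    show ?case
    proof
      assume d: "det A \<noteq> 0"
      have detA: "det A = (\<Prod>i\<in>UNIV. A $ i $ i)"
        using 3 by (intro det_diagonal) auto
      have nz: "A $ i $ i \<noteq> 0" for i
        using d unfolding detA by (simp add: prod_zero_iff)
      \<comment> \<open>The diagonal map in the coordinatewise form that
        \<open>lborel_affine_euclidean\<close> treats.\<close>
      let ?T = "\<lambda>x::real^'n. 0 + (\<Sum>j\<in>Basis. ((\<lambda>j. (A *v j) \<bullet> j) j * (x \<bullet> j)) *\<^sub>R j)"
      have col: "(A *v axis i 1) \<bullet> axis i 1 = A $ i $ i" for i
        by (simp add: matrix_vector_mult_basis inner_axis column_def)
      have col': "(A *v axis i 1) $ i = A $ i $ i" for i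
        by (simp add: matrix_vector_mult_basis column_def)
      have T: "?T = (*v) A"
      proof
        fix x :: "real^'n"
        have "A *v x = (\<Sum>i\<in>UNIV. (A $ i $ i * x $ i) *\<^sub>R axis i 1)"
        proof (subst vec_eq_iff, intro allI)
          fix k
          have "(\<Sum>j\<in>UNIV. A $ k $ j * x $ j) = (\<Sum>j\<in>UNIV. if j = k then A $ k $ k * x $ k else 0)"
            using 3 by (intro sum.cong) auto
          then show "(A *v x) $ k = (\<Sum>i\<in>UNIV. (A $ i $ i * x $ i) *\<^sub>R axis i 1) $ k"
            by (simp add: matrix_vector_mult_def axis_def if_distrib sum.delta cong: if_cong)
        qed
        then show "?T x = A *v x"
          by (simp add: Basis_vec_def sum.UNION_disjoint UNION_singleton_eq_range sum.reindex inj_on_def axis_eq_axis col' inner_axis)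
      qed
      have "lborel = density (distr lborel borel ?T) (\<lambda>_. (\<Prod>j\<in>Basis. \<bar>(A *v j) \<bullet> j\<bar>))"
        using nz col by (intro lborel_affine_euclidean[where c="\<lambda>j. (A *v j) \<bullet> j" and t=0]) (auto simp: Basis_vec_def)
      also have "(\<Prod>j\<in>Basis. \<bar>(A *v j) \<bullet> j\<bar>) = \<bar>det A\<bar>"
        unfolding detA abs_prod
        by (simp add: Basis_vec_def UNION_singleton_eq_range prod.reindex inj_on_def axis_eq_axis col)
      finally have eq: "lborel = density (distr lborel borel ((*v) A)) (\<lambda>_. ennreal \<bar>det A\<bar>)"
        unfolding T .
      have "density lborel (\<lambda>_. ennreal (1 / \<bar>det A\<bar>)) = density (distr lborel borel ((*v) A)) (\<lambda>_. ennreal \<bar>det A\<bar> * ennreal (1 / \<bar>det A\<bar>))"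
        by (subst eq, subst density_density_eq) auto
      also have "(\<lambda>_. ennreal \<bar>det A\<bar> * ennreal (1 / \<bar>det A\<bar>)) = (\<lambda>_. 1)"
        using d by (simp flip: ennreal_mult)
      finally show "distr lborel borel ((*v) A) = density lborel (\<lambda>_. ennreal (1 / \<bar>det A\<bar>))"
        by (simp add: density_1)
    qed
  next
    case (4 m n)
    let ?p = "Transposition.transpose m n"
    let ?A = "(\<chi> i j. mat 1 $ i $ ?p j) :: real^'n^'n"
    have Av: "(?A *v x) $ i = x $ ?p i" for x i
    proof -
      have "i = ?p j \<longleftrightarrow> j = ?p i" for j
        by (metis transpose_involutory)
      then have "(?A *v x) $ i = (\<Sum>j\<in>UNIV. if j = ?p i then x $ j else 0)"
        unfolding matrix_vector_mult_def vec_lambda_beta by (intro sum.cong refl) (simp add: mat_def)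
      then show ?thesis
        by (simp add: sum.delta)
    qed
    have "\<bar>det ?A\<bar> = 1"
      using det_permute_columns[of ?p "mat 1 :: real^'n^'n"] by (simp add: permutes_swap_id sign_swap_id \<open>m \<noteq> n\<close>)
    moreover have "lborel = distr lborel borel ((*v) ?A)"
    proof (rule lborel_eqI)
      fix l u :: "real^'n" assume lu: "\<And>b. b \<in> Basis \<Longrightarrow> l \<bullet> b \<le> u \<bullet> b"
      have "(*v) ?A -` box l u = box (?A *v l) (?A *v u)"
        by (auto simp: mem_box_cart Av) (metis transpose_involutory)+
      then have "emeasure (distr lborel borel ((*v) ?A)) (box l u) = emeasure lborel (box (?A *v l) (?A *v u))"
        by (subst emeasure_distr) auto
      also have "\<dots> = (\<Prod>b\<in>Basis. (?A *v u - ?A *v l) \<bullet> b)"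
      proof (rule emeasure_lborel_box)
        fix b :: "real^'n" assume "b \<in> Basis"
        then obtain i where "b = axis i 1"
          by (auto simp: Basis_vec_def)
        then show "(?A *v l) \<bullet> b \<le> (?A *v u) \<bullet> b"
          using lu[of "axis (?p i) 1"] by (simp add: inner_axis Av)
      qed
      also have "\<dots> = (\<Prod>i\<in>UNIV. u $ ?p i - l $ ?p i)"
        by (simp add: Basis_vec_def UNION_singleton_eq_range prod.reindex inj_on_def axis_eq_axis inner_axis Av)
      also have "\<dots> = (\<Prod>i\<in>UNIV. u $ i - l $ i)"
        by (intro arg_cong[of _ _ ennreal] prod.reindex_bij_betw[of ?p UNIV UNIV "\<lambda>i. u $ i - l $ i"]) simp
      also have "\<dots> = (\<Prod>b\<in>Basis. (u - l) \<bullet> b)"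
        by (simp add: Basis_vec_def UNION_singleton_eq_range prod.reindex inj_on_def axis_eq_axis inner_axis)
      finally show "emeasure (distr lborel borel ((*v) ?A)) (box l u) = (\<Prod>b\<in>Basis. (u - l) \<bullet> b)" .
    qed simp
    ultimately show ?case
      by (simp add: density_1)
  next
    case (5 m n)
    let ?A = "(\<chi> i j. of_bool (i = m \<and> j = n \<or> i = j)) :: real^'n^'n"
    have Av: "?A *v x = x + (x \<bullet> axis n 1) *\<^sub>R axis m 1" for x
    proof (subst vec_eq_iff, intro allI)
      fix i
      have "(?A *v x) $ i = (\<Sum>j\<in>UNIV. (if j = i then x $ j else 0) + (if j = n then if i = m then x $ j else 0 else 0))"
        unfolding matrix_vector_mult_def using \<open>m \<noteq> n\<close> by (auto intro!: sum.cong)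
      also have "\<dots> = x $ i + (if i = m then x $ n else 0)"
        by (simp add: sum.distrib sum.delta)
      finally show "(?A *v x) $ i = (x + (x \<bullet> axis n 1) *\<^sub>R axis m 1) $ i"
        unfolding cart_eq_inner_axis[symmetric] by (auto simp: axis_def)
    qed
    have "det ?A = 1"
    proof -
      have "?A = (\<chi> k. if k = m then row m (mat 1) + 1 *s row n (mat 1) else row k (mat 1))"
        using \<open>m \<noteq> n\<close> by (auto simp: vec_eq_iff row_def mat_def)
      then show ?thesis
        using det_row_operation[OF \<open>m \<noteq> n\<close>, of "mat 1 :: real^'n^'n" 1] by simp
    qed
    moreover have "distr lborel borel ((*v) ?A) = lborel"
      unfolding Av[abs_def] using \<open>m \<noteq> n\<close> by (intro distr_lborel_shear) (auto simp: axis_in_Basis_iff axis_eq_axis)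
    ultimately show ?case
      by (simp add: density_1)
  qed
  then show ?thesis
    using assms by simp
qed

text \<open>Lebesgue measure is the image of a product measure over \<open>Basis\<close>, so the
  one-variable functions are transported from indices to basis vectors before Fubini is
  applied.\<close>

lemma lborel_integral_prod_vec:
  fixes f :: "'n::finite \<Rightarrow> real \<Rightarrow> real"
  assumes f: "\<And>i. integrable lborel (f i)"
  shows "integrable lborel (\<lambda>x::real^'n. \<Prod>i\<in>UNIV. f i (x $ i))"
    and "(\<integral>x. (\<Prod>i\<in>UNIV. f i ((x::real^'n) $ i)) \<partial>lborel) = (\<Prod>i\<in>UNIV. \<integral>x. f i x \<partial>lborel)"
proof -
  interpret P: product_sigma_finite "\<lambda>_::real^'n. lborel :: real measure" ..
  define g where "g = (\<lambda>b::real^'n. f (inv (\<lambda>i. axis i 1) b))"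
  have inj: "inj (\<lambda>i::'n. axis i (1::real))"
    by (auto simp: inj_on_def axis_eq_axis)
  have [measurable]: "f i \<in> borel_measurable borel" for i
    using borel_measurable_integrable[OF f] by simp
  have prod_eq: "(\<Prod>i\<in>UNIV. h (axis i 1)) = (\<Prod>b\<in>Basis. h b)" for h :: "real^'n \<Rightarrow> real"
    using inj by (simp add: Basis_vec_def UNION_singleton_eq_range prod.reindex)
  have g_axis: "g (axis i 1) = f i" for i
    by (simp add: g_def inv_f_f[OF inj])
  have eq: "(\<Prod>i\<in>UNIV. f i (x $ i)) = (\<Prod>b\<in>Basis. g b (x \<bullet> b))" for x :: "real^'n"
    using prod_eq[of "\<lambda>b. g b (x \<bullet> b)"] by (simp add: g_axis inner_axis)
  have eq2: "(\<Prod>i\<in>UNIV. f i ((\<Sum>b\<in>Basis. x b *\<^sub>R b) $ i)) = (\<Prod>b\<in>Basis. g b (x b))" for x :: "real^'n \<Rightarrow> real"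
    unfolding eq by (intro prod.cong refl) simp
  have int: "integrable (\<Pi>\<^sub>M b\<in>Basis. lborel) (\<lambda>x. \<Prod>b\<in>Basis. g b (x b))"
    by (rule P.product_integrable_prod) (auto simp: g_def f)
  have meas: "(\<lambda>x::real^'n. \<Prod>i\<in>UNIV. f i (x $ i)) \<in> borel_measurable borel"
    by measurable
  have meas2: "(\<lambda>f. \<Sum>b\<in>Basis. f b *\<^sub>R b) \<in> (\<Pi>\<^sub>M b\<in>(Basis::(real^'n) set). lborel) \<rightarrow>\<^sub>M borel"
    by measurable
  show "integrable lborel (\<lambda>x::real^'n. \<Prod>i\<in>UNIV. f i (x $ i))"
    by (subst lborel_eq, subst integrable_distr_eq[OF meas2 meas]) (simp only: eq2 int)
  have "(\<integral>x. (\<Prod>i\<in>UNIV. f i ((x::real^'n) $ i)) \<partial>lborel) = (\<integral>x. (\<Prod>b\<in>Basis. g b (x b)) \<partial>(\<Pi>\<^sub>M b\<in>Basis. lborel))"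
    by (subst lborel_eq, subst integral_distr[OF meas2 meas]) (simp only: eq2)
  also have "\<dots> = (\<Prod>b\<in>Basis. \<integral>x. g b x \<partial>lborel)"
    by (rule P.product_integral_prod) (auto simp: g_def f)
  also have "\<dots> = (\<Prod>i\<in>UNIV. \<integral>x. f i x \<partial>lborel)"
    using prod_eq[of "\<lambda>b. \<integral>x. g b x \<partial>lborel"] by (simp add: g_axis)
  finally show "(\<integral>x. (\<Prod>i\<in>UNIV. f i ((x::real^'n) $ i)) \<partial>lborel) = (\<Prod>i\<in>UNIV. \<integral>x. f i x \<partial>lborel)" .
qed

section \<open>Moments and affine images of the standard Gaussian vector\<close>

lemma std_gaussian_density_eq:
  "(\<Prod>i\<in>UNIV. std_normal_density ((z::real^'n) $ i)) = exp (- (norm z)\<^sup>2 / 2) / sqrt (2 * pi) ^ CARD('n)"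
proof -
  have "(\<Prod>i\<in>UNIV. std_normal_density (z $ i)) = (\<Prod>i\<in>(UNIV::'n set). 1 / sqrt (2 * pi)) * exp (\<Sum>i\<in>UNIV. - (z $ i)\<^sup>2 / 2)"
    unfolding std_normal_density_def prod.distrib exp_sum[OF finite] by simp
  also have "(\<Sum>i\<in>UNIV. - (z $ i)\<^sup>2 / 2) = - (norm z)\<^sup>2 / 2"
    unfolding power2_norm_eq_inner inner_vec_def by (simp add: power2_eq_square sum_negf sum_divide_distrib[symmetric])
  finally show ?thesis
    by (simp add: power_one_over)
qed

lemma std_gaussian_sets[simp, measurable_cong]: "sets std_gaussian = sets borel"
  by (simp add: std_gaussian_def)

lemma std_gaussian_space[simp]: "space std_gaussian = UNIV"
  by (simp add: std_gaussian_def)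

lemma std_gaussian_moment:
  fixes e :: "'n::finite \<Rightarrow> nat"
  shows "integrable std_gaussian (\<lambda>z. \<Prod>i\<in>UNIV. (z $ i) ^ e i)"
    and "(\<integral>z. (\<Prod>i\<in>UNIV. (z $ i) ^ e i) \<partial>std_gaussian) = (\<Prod>i\<in>UNIV. \<integral>x. std_normal_density x * x ^ e i \<partial>lborel)"
proof -
  have nonneg: "AE z in lborel. 0 \<le> (\<Prod>i\<in>UNIV. std_normal_density ((z::real^'n) $ i))"
    by (intro AE_I2 prod_nonneg) auto
  have [measurable]: "(\<lambda>z::real^'n. \<Prod>i\<in>UNIV. std_normal_density (z $ i)) \<in> borel_measurable lborel"
    "(\<lambda>z::real^'n. \<Prod>i\<in>UNIV. (z $ i) ^ e i) \<in> borel_measurable lborel"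
    by measurable
  have eq: "(\<Prod>i\<in>UNIV. std_normal_density (z $ i)) * (\<Prod>i\<in>UNIV. (z $ i) ^ e i) = (\<Prod>i\<in>UNIV. std_normal_density (z $ i) * (z $ i) ^ e i)"
    for z :: "real^'n"
    by (simp add: prod.distrib)
  note P = lborel_integral_prod_vec[of "\<lambda>i x. std_normal_density x * x ^ e i", OF integrable_std_normal_moment]
  show "integrable std_gaussian (\<lambda>z. \<Prod>i\<in>UNIV. (z $ i) ^ e i)"
    unfolding std_gaussian_def by (subst integrable_density[OF _ _ nonneg]) (auto simp: eq P)
  show "(\<integral>z. (\<Prod>i\<in>UNIV. (z $ i) ^ e i) \<partial>std_gaussian) = (\<Prod>i\<in>UNIV. \<integral>x. std_normal_density x * x ^ e i \<partial>lborel)"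
    unfolding std_gaussian_def by (subst integral_density[OF _ _ nonneg]) (auto simp: eq P)
qed

lemma std_normal_moments:
  "(\<integral>x. std_normal_density x * x ^ 0 \<partial>lborel) = 1" "(\<integral>x. std_normal_density x * x ^ 1 \<partial>lborel) = 0"
  "(\<integral>x. std_normal_density x * x ^ 2 \<partial>lborel) = 1"
  using integral_std_normal_moment_even[of 0] integral_std_normal_moment_odd[of 0] integral_std_normal_moment_even[of 1]
  by (simp_all add: fact_numeral)

lemma prod_UNIV_of_bool:
  fixes g :: "nat \<Rightarrow> 'b::comm_monoid_mult" and i :: "'n::finite"
  assumes "g 0 = 1"
  shows "(\<Prod>k\<in>UNIV. g (if k = i then c else 0)) = g c"
proof -
  have "(\<Prod>k\<in>UNIV. g (if k = i then c else 0)) = (\<Prod>k\<in>UNIV. if k = i then g c else 1)"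
    by (intro prod.cong) (auto simp: assms)
  then show ?thesis
    by (simp add: prod.delta)
qed

lemma std_gaussian_moments:
  fixes i j :: "'n::finite"
  shows "prob_space (std_gaussian :: (real^'n) measure)"
    and "integrable std_gaussian (\<lambda>z. z $ i ^ c)"
    and "(\<integral>z. z $ i \<partial>std_gaussian) = 0"
    and "integrable std_gaussian (\<lambda>z. z $ i * z $ j)"
    and "(\<integral>z. z $ i * z $ j \<partial>std_gaussian) = of_bool (i = j)"
proof -
  have "measure (std_gaussian :: (real^'n) measure) UNIV = 1"
    using std_gaussian_moment[of "\<lambda>_::'n. 0"] std_normal_moments by simp
  then show "prob_space (std_gaussian :: (real^'n) measure)"
    by (intro prob_spaceI) (metis emeasure_eq_ennreal_measure measure_zero_top ennreal_1 std_gaussian_space zero_neq_one)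
  have pw: "(\<Prod>k\<in>UNIV. (z $ k) ^ (if k = i then c else 0)) = z $ i ^ c" for z :: "real^'n" and c
  proof -
    have "(\<Prod>k\<in>UNIV. (z $ k) ^ (if k = i then c else 0)) = (\<Prod>k\<in>UNIV. if k = i then z $ k ^ c else 1)"
      by (intro prod.cong) auto
    then show ?thesis
      by (simp add: prod.delta)
  qed
  show "integrable std_gaussian (\<lambda>z. z $ i ^ c)"
    using std_gaussian_moment(1)[of "\<lambda>k. if k = i then c else 0"] by (simp add: pw)
  show "(\<integral>z. z $ i \<partial>std_gaussian) = 0"
    using std_gaussian_moment(2)[of "\<lambda>k. if k = i then 1 else 0"] pw[of _ 1]
      prod_UNIV_of_bool[of "\<lambda>c. \<integral>x. std_normal_density x * x ^ c \<partial>lborel" i 1] std_normal_moments by simp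
  let ?e = "\<lambda>k. (if k = i then 1 else 0) + (if k = j then 1 else 0) :: nat"
  have "(\<Prod>k\<in>UNIV. (z $ k) ^ ?e k) = z $ i * z $ j" for z :: "real^'n"
  proof -
    have "(\<Prod>k\<in>UNIV. (z $ k) ^ ?e k) = (\<Prod>k\<in>UNIV. (if k = i then z $ k else 1) * (if k = j then z $ k else 1))"
      by (intro prod.cong) auto
    then show ?thesis
      by (simp add: prod.distrib prod.delta)
  qed
  note E = std_gaussian_moment[of ?e, unfolded this]
  show "integrable std_gaussian (\<lambda>z. z $ i * z $ j)"
    by (rule E(1))
  show "(\<integral>z. z $ i * z $ j \<partial>std_gaussian) = of_bool (i = j)"
  proof (cases "i = j")
    case True
    have "(\<Prod>k\<in>UNIV. \<integral>x. std_normal_density x * x ^ ?e k \<partial>lborel) =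
        (\<Prod>k\<in>UNIV. \<integral>x. std_normal_density x * x ^ (if k = i then 2 else 0) \<partial>lborel)"
      by (intro prod.cong refl) (simp add: True numeral_2_eq_2)
    also have "\<dots> = 1"
      using prod_UNIV_of_bool[of "\<lambda>c. \<integral>x. std_normal_density x * x ^ c \<partial>lborel" i 2] std_normal_moments
      by simp
    finally show ?thesis
      using E(2) True by simp
  next
    case False
    then have "(\<Prod>k\<in>UNIV. \<integral>x. std_normal_density x * x ^ ?e k \<partial>lborel) = 0"
      using std_normal_moments by (intro prod_zero bexI[of _ i]) auto
    then show ?thesis
      using E(2) False by simp
  qed
qed

text \<open>Density of A z + b for a standard Gaussian z. It is expressed by \<open>A\<close> and
  not by the covariance A A^T because \<open>gaussian_vector\<close> supplies \<open>A\<close>; then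
  |det A| is the square root of the determinant of the covariance.\<close>

definition gauss_density :: "real ^ 'n ^ 'n \<Rightarrow> real ^ 'n \<Rightarrow> real ^ 'n \<Rightarrow> real" where
  "gauss_density A b x =
     exp (- (norm (matrix_inv A *v (x - b)))\<^sup>2 / 2) / (sqrt (2 * pi) ^ CARD('n) * \<bar>det A\<bar>)"

lemma matrix_vector_mult_measurable[measurable (raw)]:
  fixes A :: "real ^ 'n ^ 'm"
  assumes "f \<in> borel_measurable N"
  shows "(\<lambda>x. A *v f x) \<in> borel_measurable N"
  using measurable_compose[OF assms borel_measurable_continuous_onI[OF linear_continuous_on]]
    matrix_vector_mul_bounded_linear by blast

lemma matrix_inv_cancel:
  fixes A :: "real ^ 'n ^ 'n"
  assumes "det A \<noteq> 0"
  shows "A ** matrix_inv A = mat 1" "matrix_inv A ** A = mat 1"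
proof -
  have "\<exists>B. A ** B = mat 1 \<and> B ** A = mat 1"
    using assms by (simp add: invertible_det_nz[symmetric] invertible_def)
  from someI_ex[OF this] show "A ** matrix_inv A = mat 1" "matrix_inv A ** A = mat 1"
    unfolding matrix_inv_def by auto
qed

lemma matrix_inv_eqI:
  fixes A :: "real ^ 'n ^ 'n"
  assumes "A ** B = mat 1" "B ** A = mat 1"
  shows "matrix_inv A = B"
proof -
  have "invertible A"
    using assms by (auto simp: invertible_def)
  then have "matrix_inv A = matrix_inv A ** (A ** B)"
    by (simp add: assms(1))
  also have "\<dots> = B"
    using matrix_inv_cancel(2)[of A] \<open>invertible A\<close> by (simp add: matrix_mul_assoc invertible_det_nz)
  finally show ?thesis .
qed

lemma distr_std_gaussian:
  fixes A :: "real ^ 'n ^ 'n"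
  assumes A: "det A \<noteq> 0"
  shows "distr std_gaussian borel (\<lambda>z. A *v z + b) = density lborel (\<lambda>x. ennreal (gauss_density A b x))"
proof -
  let ?T = "\<lambda>z. A *v z + b" and ?S = "\<lambda>x. matrix_inv A *v (x - b)"
  let ?\<phi> = "\<lambda>z::real^'n. ennreal (exp (- (norm z)\<^sup>2 / 2) / sqrt (2 * pi) ^ CARD('n))"
  have ST: "?S (?T z) = z" for z
    using matrix_inv_cancel[OF A] by (simp add: matrix_vector_mul_assoc)
  have lb: "distr lborel borel ?T = density lborel (\<lambda>_. ennreal (1 / \<bar>det A\<bar>))"
  proof -
    have "distr lborel borel ?T = distr (distr lborel borel ((*v) A)) borel ((+) b)"
      by (subst distr_distr) (auto simp: comp_def add.commute)
    also have "\<dots> = density (distr lborel borel ((+) b)) (\<lambda>_. ennreal (1 / \<bar>det A\<bar>))"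
      unfolding distr_lborel_matrix[OF A] by (subst density_distr) auto
    finally show ?thesis
      by (simp add: lborel_distr_plus)
  qed
  \<comment> \<open>The density is rewritten as a function of the image point, so that the
    push-forward only has to act on Lebesgue measure.\<close>
  have "std_gaussian = density lborel (\<lambda>z. ?\<phi> (?S (?T z)))"
    unfolding std_gaussian_def std_gaussian_density_eq ST ..
  then have "distr std_gaussian borel ?T = density (distr lborel borel ?T) (\<lambda>x. ?\<phi> (?S x))"
    by (subst density_distr) auto
  also have "\<dots> = density lborel (\<lambda>x. ennreal (1 / \<bar>det A\<bar>) * ?\<phi> (?S x))"
    unfolding lb by (subst density_density_eq) auto
  also have "(\<lambda>x. ennreal (1 / \<bar>det A\<bar>) * ?\<phi> (?S x)) = (\<lambda>x. ennreal (gauss_density A b x))"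
    by (intro ext) (simp add: gauss_density_def mult_ac flip: ennreal_mult)
  finally show ?thesis .
qed

lemma std_gaussian_linear:
  fixes u v :: "real ^ 'n"
  shows "integrable std_gaussian (\<lambda>z. u \<bullet> z)" "(\<integral>z. u \<bullet> z \<partial>std_gaussian) = 0"
    and "integrable std_gaussian (\<lambda>z. (u \<bullet> z) * (v \<bullet> z))" "(\<integral>z. (u \<bullet> z) * (v \<bullet> z) \<partial>std_gaussian) = u \<bullet> v"
proof -
  have lin: "u \<bullet> z = (\<Sum>k\<in>UNIV. u $ k * z $ k)" for u z :: "real^'n"
    by (simp add: inner_vec_def)
  have bil: "(u \<bullet> z) * (v \<bullet> z) = (\<Sum>k\<in>UNIV. \<Sum>l\<in>UNIV. (u $ k * v $ l) * (z $ k * z $ l))" for z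
    by (simp add: lin sum_product mult_ac)
  have int1: "integrable std_gaussian (\<lambda>z. z $ k)" for k :: 'n
    using std_gaussian_moments(2)[of k 1] by simp
  show "integrable std_gaussian (\<lambda>z. u \<bullet> z)" "(\<integral>z. u \<bullet> z \<partial>std_gaussian) = 0"
    unfolding lin using int1 by (auto simp: std_gaussian_moments(3))
  have I: "integrable std_gaussian (\<lambda>z. (u $ k * v $ l) * (z $ k * z $ l))" for k l
    by (intro integrable_mult_right std_gaussian_moments(4))
  show "integrable std_gaussian (\<lambda>z. (u \<bullet> z) * (v \<bullet> z))"
    unfolding bil by (intro Bochner_Integration.integrable_sum I)
  have "(\<integral>z. (u \<bullet> z) * (v \<bullet> z) \<partial>std_gaussian) =
      (\<Sum>k\<in>UNIV. \<integral>z. (\<Sum>l\<in>UNIV. (u $ k * v $ l) * (z $ k * z $ l)) \<partial>std_gaussian)"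
    unfolding bil by (intro Bochner_Integration.integral_sum Bochner_Integration.integrable_sum I)
  also have "\<dots> = (\<Sum>k\<in>UNIV. \<Sum>l\<in>UNIV. \<integral>z. (u $ k * v $ l) * (z $ k * z $ l) \<partial>std_gaussian)"
    by (intro sum.cong refl Bochner_Integration.integral_sum I)
  also have "\<dots> = (\<Sum>k\<in>UNIV. \<Sum>l\<in>UNIV. (u $ k * v $ l) * of_bool (k = l))"
    unfolding integral_mult_right_zero std_gaussian_moments(5) ..
  also have "\<dots> = u \<bullet> v"
    by (simp add: lin of_bool_def if_distrib cong: if_cong)
  finally show "(\<integral>z. (u \<bullet> z) * (v \<bullet> z) \<partial>std_gaussian) = u \<bullet> v" .
qed

text \<open>The linear term has mean zero, and the quadratic one contributes the squared norms of
  the rows of \<open>W\<close>.\<close>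

lemma std_gaussian_norm_square:
  fixes W :: "real ^ 'n ^ 'n"
  shows "integrable std_gaussian (\<lambda>z. (norm (W *v z + w))\<^sup>2)"
    and "(\<integral>z. (norm (W *v z + w))\<^sup>2 \<partial>std_gaussian) = trace (W ** transpose W) + (norm w)\<^sup>2"
proof -
  interpret G: prob_space "std_gaussian :: (real^'n) measure"
    by (rule std_gaussian_moments(1))
  have row: "(W *v z) $ i = row i W \<bullet> z" for z i
    by (simp add: matrix_vector_mult_def row_def inner_vec_def)
  have eq: "(norm (W *v z + w))\<^sup>2 = (\<Sum>i\<in>UNIV. (row i W \<bullet> z) * (row i W \<bullet> z) + 2 * w $ i * (row i W \<bullet> z) + w $ i * w $ i)" for z
    unfolding power2_norm_eq_inner by (simp add: inner_vec_def row[unfolded inner_vec_def] algebra_simps)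
  let ?f = "\<lambda>i z. (row i W \<bullet> z) * (row i W \<bullet> z) + 2 * w $ i * (row i W \<bullet> z)"
  have i1: "integrable std_gaussian (?f i)" for i
    by (intro Bochner_Integration.integrable_add std_gaussian_linear integrable_mult_right)
  have I: "integrable std_gaussian (\<lambda>z. ?f i z + w $ i * w $ i)" for i
    using i1[of i] by simp
  have "(\<integral>z. ?f i z \<partial>std_gaussian) = row i W \<bullet> row i W" for i
    using std_gaussian_linear(1)[of "row i W"] std_gaussian_linear(3)[of "row i W" "row i W"]
    by (subst Bochner_Integration.integral_add) (auto simp: std_gaussian_linear)
  then have E: "(\<integral>z. ?f i z + w $ i * w $ i \<partial>std_gaussian) = row i W \<bullet> row i W + w $ i * w $ i" for i
    using i1[of i] G.prob_space[unfolded std_gaussian_space] by (subst Bochner_Integration.integral_add) auto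
  show "integrable std_gaussian (\<lambda>z. (norm (W *v z + w))\<^sup>2)"
    unfolding eq by (intro Bochner_Integration.integrable_sum I)
  have "(\<integral>z. (norm (W *v z + w))\<^sup>2 \<partial>std_gaussian) = (\<Sum>i\<in>UNIV. \<integral>z. ?f i z + w $ i * w $ i \<partial>std_gaussian)"
    unfolding eq by (intro Bochner_Integration.integral_sum I)
  also have "\<dots> = (\<Sum>i\<in>UNIV. row i W \<bullet> row i W + w $ i * w $ i)"
    unfolding E ..
  also have "\<dots> = trace (W ** transpose W) + (norm w)\<^sup>2"
    unfolding power2_norm_eq_inner
    by (simp add: trace_def matrix_matrix_mult_def transpose_def row_def inner_vec_def sum.distrib)
  finally show "(\<integral>z. (norm (W *v z + w))\<^sup>2 \<partial>std_gaussian) = trace (W ** transpose W) + (norm w)\<^sup>2" .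
qed

text \<open>The fourth power of the norm is a double sum over coordinates; mixed terms are absorbed
  by a^2 * b^2 <= a^4 + b^4.\<close>

lemma integrable_std_gaussian_norm4:
  "integrable std_gaussian (\<lambda>z::real^'n. norm z ^ 4)"
proof -
  have eq: "norm z ^ 4 = (\<Sum>i\<in>UNIV. \<Sum>j\<in>UNIV. (z $ i)\<^sup>2 * (z $ j)\<^sup>2)" for z :: "real^'n"
  proof -
    have "norm z ^ 4 = ((norm z)\<^sup>2)\<^sup>2"
      by simp
    also have "(norm z)\<^sup>2 = (\<Sum>i\<in>UNIV. (z $ i)\<^sup>2)"
      unfolding power2_norm_eq_inner by (simp add: inner_vec_def power2_eq_square)
    finally show ?thesis
      by (simp add: power2_eq_square sum_product)
  qed
  have "integrable std_gaussian (\<lambda>z::real^'n. (z $ i)\<^sup>2 * (z $ j)\<^sup>2)" for i j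
  proof (rule Bochner_Integration.integrable_bound)
    show "integrable std_gaussian (\<lambda>z::real^'n. z $ i ^ 4 + z $ j ^ 4)"
      by (intro Bochner_Integration.integrable_add std_gaussian_moments(2))
    have "a\<^sup>2 * b\<^sup>2 \<le> a ^ 4 + b ^ 4" for a b :: real
    proof -
      have "0 \<le> (a\<^sup>2 - b\<^sup>2)\<^sup>2" "0 \<le> a\<^sup>2 * b\<^sup>2"
        by simp_all
      moreover have "(a\<^sup>2 - b\<^sup>2)\<^sup>2 = a ^ 4 + b ^ 4 - 2 * (a\<^sup>2 * b\<^sup>2)"
        by (simp add: power2_eq_square power4_eq_xxxx algebra_simps)
      ultimately show ?thesis
        by argo
    qed
    then show "AE z in std_gaussian. norm ((z $ i)\<^sup>2 * (z $ j)\<^sup>2) \<le> norm ((z::real^'n) $ i ^ 4 + z $ j ^ 4)"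
      by (intro AE_I2) simp
  qed measurable
  then show ?thesis
    unfolding eq by auto
qed

text \<open>For any representation A z + b of the law, the mean is b and the covariance is A A^T. An
  invertible covariance therefore forces det A to be nonzero.\<close>

lemma gaussian_vector_affine:
  fixes X :: "'a \<Rightarrow> real ^ 'n"
  assumes "prob_space M" and gauss: "gaussian_vector M X" and inv: "invertible (covariance_matrix M X)"
  obtains A where "det A \<noteq> 0" "covariance_matrix M X = A ** transpose A"
    "distr M borel X = distr std_gaussian borel (\<lambda>z. A *v z + (\<integral>\<omega>. X \<omega> \<partial>M))"
proof -
  interpret prob_space M by fact
  interpret G: prob_space "std_gaussian :: (real^'n) measure"
    by (rule std_gaussian_moments(1))
  have [measurable]: "X \<in> borel_measurable M"
    using gauss by (simp add: gaussian_vector_def)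
  obtain A :: "real^'n^'n" and b where D: "distr M borel X = distr std_gaussian borel (\<lambda>z. A *v z + b)"
    using gauss by (auto simp: gaussian_vector_def)
  have E: "(\<integral>\<omega>. f (X \<omega>) \<partial>M) = (\<integral>z. f (A *v z + b) \<partial>std_gaussian)"
    if [measurable]: "f \<in> borel_measurable borel" for f :: "real^'n \<Rightarrow> 'c::{banach, second_countable_topology}"
  proof -
    have "(\<integral>\<omega>. f (X \<omega>) \<partial>M) = (\<integral>x. f x \<partial>distr M borel X)"
      by (rule integral_distr[symmetric]) measurable
    also have "\<dots> = (\<integral>z. f (A *v z + b) \<partial>std_gaussian)"
      unfolding D by (rule integral_distr) measurable
    finally show ?thesis .
  qed
  have row: "(A *v z) $ i = row i A \<bullet> z" for z i
    by (simp add: matrix_vector_mult_def row_def inner_vec_def)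
  have int: "integrable std_gaussian (\<lambda>z. A *v z + b)"
  proof (rule Bochner_Integration.integrable_bound)
    show "integrable std_gaussian (\<lambda>z. 1 + (norm (A *v z + b))\<^sup>2)"
      by (intro Bochner_Integration.integrable_add std_gaussian_norm_square(1)) simp
    have "r \<le> 1 + r\<^sup>2" for r :: real
    proof -
      have "0 \<le> (r - 1)\<^sup>2 + r\<^sup>2 + 1"
        by simp
      moreover have "(r - 1)\<^sup>2 + r\<^sup>2 + 1 = 2 * (1 + r\<^sup>2 - r)"
        by (simp add: power2_eq_square algebra_simps)
      ultimately show ?thesis
        by simp
    qed
    then show "AE z in std_gaussian. norm (A *v z + b) \<le> norm (1 + (norm (A *v z + b))\<^sup>2)"
      by (intro AE_I2) simp
  qed measurable
  have mean: "(\<integral>\<omega>. X \<omega> \<partial>M) = b"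
  proof -
    have "(\<integral>\<omega>. X \<omega> \<partial>M) = (\<integral>z. A *v z + b \<partial>std_gaussian)"
      using E[of "\<lambda>x. x"] by simp
    also have "\<dots> = b"
    proof (subst vec_eq_iff, intro allI)
      fix i
      have "(\<integral>z. A *v z + b \<partial>std_gaussian) $ i = (\<integral>z. (A *v z + b) $ i \<partial>std_gaussian)"
        using integral_bounded_linear[OF bounded_linear_vec_nth int] by simp
      also have "\<dots> = b $ i"
        using std_gaussian_linear(1,2)[of "row i A"] by (simp add: row G.prob_space[unfolded std_gaussian_space])
      finally show "(\<integral>z. A *v z + b \<partial>std_gaussian) $ i = b $ i" .
    qed
    finally show ?thesis .
  qed
  have cov: "covariance_matrix M X = A ** transpose A"
  proof -
    have "covariance_matrix M X $ i $ j = (A ** transpose A) $ i $ j" for i j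
    proof -
      have "covariance_matrix M X $ i $ j = (\<integral>\<omega>. (X \<omega> $ i - b $ i) * (X \<omega> $ j - b $ j) \<partial>M)"
        by (simp add: covariance_matrix_def mean)
      also have "\<dots> = (\<integral>z. (row i A \<bullet> z) * (row j A \<bullet> z) \<partial>std_gaussian)"
        using E[of "\<lambda>x. (x $ i - b $ i) * (x $ j - b $ j)"] by (simp add: row)
      also have "\<dots> = (A ** transpose A) $ i $ j"
        unfolding std_gaussian_linear(4)
        by (simp add: matrix_matrix_mult_def transpose_def row_def inner_vec_def)
      finally show ?thesis .
    qed
    then show ?thesis
      by (simp add: vec_eq_iff)
  qed
  have "det A \<noteq> 0"
    using inv unfolding cov invertible_det_nz by (simp add: det_mul)
  then show thesis
    using that[of A] cov D mean by simp
qed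

section \<open>Gaussian densities: tameness and divergence\<close>

lemma gauss_density_pos:
  fixes A :: "real ^ 'n ^ 'n"
  assumes "det A \<noteq> 0"
  shows "0 < gauss_density A b x"
  using assms by (simp add: gauss_density_def)

lemma ln_gauss_density:
  fixes A :: "real ^ 'n ^ 'n"
  assumes "det A \<noteq> 0"
  shows "ln (gauss_density A b x) =
    - (norm (matrix_inv A *v (x - b)))\<^sup>2 / 2 - ln (sqrt (2 * pi) ^ CARD('n)) - ln \<bar>det A\<bar>"
  using assms by (simp add: gauss_density_def ln_div ln_mult)

lemma matrix_vector_mult_bound:
  fixes A :: "real ^ 'n ^ 'm"
  obtains L where "0 < L" "\<And>x. norm (A *v x) \<le> L * norm x"
  using bounded_linear.pos_bounded[OF matrix_vector_mul_bounded_linear[of A]] by (metis mult.commute)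

lemma tame_gauss_density:
  fixes A :: "real ^ 'n ^ 'n"
  assumes A: "det A \<noteq> 0"
  obtains C where "tame_density (gauss_density A b) C"
proof -
  define K where "K = ln (sqrt (2 * pi) ^ CARD('n)) + ln \<bar>det A\<bar>"
  obtain L where L: "0 < L" "\<And>x. norm (matrix_inv A *v x) \<le> L * norm x"
    using matrix_vector_mult_bound[of "matrix_inv A"] by blast
  obtain L' where L': "0 < L'" "\<And>x. norm (A *v x) \<le> L' * norm x"
    using matrix_vector_mult_bound[of A] by blast
  \<comment> \<open>\<open>K\<close> collects the logarithms of the normalising factors. Half the
    squared norm of \<open>matrix_inv A *v (x - b)\<close> is at most L^2 * (|x|^2 + |b|^2); this
    plus |K| stays below C * (1 + |x|^2).\<close>
  define C where "C = \<bar>K\<bar> + L\<^sup>2 * (1 + (norm b)\<^sup>2)"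
  have K_le: "\<bar>K\<bar> \<le> C"
    by (simp add: C_def)
  have lnp: "ln (gauss_density A b x) = - (norm (matrix_inv A *v (x - b)))\<^sup>2 / 2 - K" for x
    unfolding K_def ln_gauss_density[OF A] by simp
  have expl: "exp (ln (gauss_density A b x)) = gauss_density A b x" for x
    using gauss_density_pos[OF A] by simp
  have "tame_density (gauss_density A b) C"
  proof (rule tame_density.intro)
    show "continuous_on UNIV (gauss_density A b)"
      unfolding gauss_density_def[abs_def] using A
      by (intro continuous_intros linear_continuous_on_compose[OF _ matrix_vector_mul_linear]) auto
    show "gauss_density A b x \<le> exp C" for x
    proof -
      have "ln (gauss_density A b x) \<le> C"
        unfolding lnp using K_le zero_le_power2[of "norm (matrix_inv A *v (x - b))"] by argo
      then show ?thesis
        by (metis expl exp_le_cancel_iff)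
    qed
    show "exp (- (C * (1 + (norm x)\<^sup>2))) \<le> gauss_density A b x" for x
    proof -
      have "norm (matrix_inv A *v (x - b)) \<le> L * (norm x + norm b)"
        using L(2)[of "x - b"] norm_triangle_ineq4[of x b] L(1) by (meson mult_left_mono order.trans less_imp_le)
      then have "(norm (matrix_inv A *v (x - b)))\<^sup>2 \<le> (L * (norm x + norm b))\<^sup>2"
        by (intro power_mono) auto
      also have "\<dots> \<le> L\<^sup>2 * (2 * ((norm x)\<^sup>2 + (norm b)\<^sup>2))"
      proof -
        have "0 \<le> (norm x - norm b)\<^sup>2"
          by simp
        then have "(norm x + norm b)\<^sup>2 \<le> 2 * ((norm x)\<^sup>2 + (norm b)\<^sup>2)"
          by (simp add: power2_eq_square algebra_simps)
        then show ?thesis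
          unfolding power_mult_distrib by (intro mult_left_mono) auto
      qed
      finally have 1: "(norm (matrix_inv A *v (x - b)))\<^sup>2 / 2 \<le> L\<^sup>2 * ((norm x)\<^sup>2 + (norm b)\<^sup>2)"
        by (simp add: algebra_simps)
      have "0 \<le> \<bar>K\<bar> * (norm x)\<^sup>2" "0 \<le> L\<^sup>2 * ((norm b)\<^sup>2 * (norm x)\<^sup>2)" "0 \<le> L\<^sup>2"
        by simp_all
      then have "L\<^sup>2 * ((norm x)\<^sup>2 + (norm b)\<^sup>2) + \<bar>K\<bar> \<le> C * (1 + (norm x)\<^sup>2)"
        unfolding C_def by (simp add: algebra_simps)
      then have "- (C * (1 + (norm x)\<^sup>2)) \<le> ln (gauss_density A b x)"
        unfolding lnp using 1 by argo
      then show ?thesis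
        by (metis expl exp_le_cancel_iff)
    qed
    show "0 \<le> C"
      by (simp add: C_def)
    have D: "density lborel (\<lambda>x. ennreal (gauss_density A b x)) = distr std_gaussian borel (\<lambda>z. A *v z + b)"
      using distr_std_gaussian[OF A] by simp
    interpret G: prob_space "std_gaussian :: (real^'n) measure"
      by (rule std_gaussian_moments(1))
    show "prob_space (density lborel (\<lambda>x. ennreal (gauss_density A b x)))"
      unfolding D by (rule G.prob_space_distr) measurable
    show "integrable (density lborel (\<lambda>x. ennreal (gauss_density A b x))) (\<lambda>x. norm x ^ 4)"
      unfolding D
    proof (subst integrable_distr_eq)
      show "integrable std_gaussian (\<lambda>z. norm (A *v z + b) ^ 4)"
      proof (rule Bochner_Integration.integrable_bound)
        show "integrable std_gaussian (\<lambda>z::real^'n. 8 * (L' ^ 4 * norm z ^ 4 + norm b ^ 4))"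
          by (intro integrable_mult_right Bochner_Integration.integrable_add integrable_std_gaussian_norm4 G.integrable_const)
        \<comment> \<open>The factor 8 results from two uses of (s + t)^2 <= 2 (s^2 + t^2), on the
          sum and then on the sum of squares.\<close>
        have "norm (A *v z + b) ^ 4 \<le> 8 * (L' ^ 4 * norm z ^ 4 + norm b ^ 4)" for z
        proof -
          have sq: "(s + t)\<^sup>2 \<le> 2 * (s\<^sup>2 + t\<^sup>2)" for s t :: real
            using zero_le_power2[of "s - t"] by (simp add: power2_eq_square algebra_simps)
          have "norm (A *v z + b) \<le> L' * norm z + norm b"
            using L'(2)[of z] norm_triangle_ineq[of "A *v z" b] by linarith
          then have "norm (A *v z + b) ^ 4 \<le> (L' * norm z + norm b) ^ 4"
            by (intro power_mono) auto
          also have "\<dots> = ((L' * norm z + norm b)\<^sup>2)\<^sup>2"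
            by simp
          also have "\<dots> \<le> (2 * ((L' * norm z)\<^sup>2 + (norm b)\<^sup>2))\<^sup>2"
            by (intro power_mono sq) auto
          also have "\<dots> = 4 * ((L' * norm z)\<^sup>2 + (norm b)\<^sup>2)\<^sup>2"
            unfolding power_mult_distrib by simp
          also have "\<dots> \<le> 4 * (2 * (((L' * norm z)\<^sup>2)\<^sup>2 + ((norm b)\<^sup>2)\<^sup>2))"
            by (intro mult_left_mono sq) auto
          finally show ?thesis
            by (simp add: power_mult_distrib)
        qed
        then show "AE z in std_gaussian. norm (norm (A *v z + b) ^ 4) \<le> norm (8 * (L' ^ 4 * norm z ^ 4 + norm b ^ 4))"
          by (intro AE_I2) (simp add: abs_of_nonneg)
      qed measurable
    qed measurable
  qed
  then show thesis
    by (rule that)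
qed

lemma kl_div_density:
  fixes p q :: "'b::euclidean_space \<Rightarrow> real"
  assumes [measurable]: "p \<in> borel_measurable borel" "q \<in> borel_measurable borel"
    and pos: "\<And>x. 0 < p x" "\<And>x. 0 < q x"
  shows "kl_div (density lborel p) (density lborel q) = (\<integral>x. ln (p x) - ln (q x) \<partial>density lborel p)"
proof -
  have "kl_div (density lborel p) (density lborel q) = (\<integral>x. p x * log (exp 1) (p x / q x) \<partial>lborel)"
    unfolding kl_div_def using pos by (intro lborel.KL_density_density) (auto simp: less_imp_le less_imp_neq[symmetric])
  also have "\<dots> = (\<integral>x. p x * (ln (p x) - ln (q x)) \<partial>lborel)"
    using pos[THEN less_imp_neq] pos by (simp add: log_def ln_div less_imp_neq[symmetric, OF pos(1)] less_imp_neq[symmetric, OF pos(2)])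
  also have "\<dots> = (\<integral>x. ln (p x) - ln (q x) \<partial>density lborel p)"
    using pos by (subst integral_density) (auto simp: less_imp_le)
  finally show ?thesis .
qed

text \<open>Under x = A z + b both log densities become minus half a squared norm, up to constants:
  that of z, and that of W z + w with W = C^-1 A and w = C^-1 (b - c). The powers of 2 pi cancel,
  and \<open>std_gaussian_norm_square\<close> evaluates both expectations.\<close>

lemma kl_div_gauss:
  fixes A C :: "real ^ 'n ^ 'n"
  assumes A: "det A \<noteq> 0" and C: "det C \<noteq> 0"
  shows "(\<integral>x. ln (gauss_density A b x) - ln (gauss_density C c x) \<partial>density lborel (gauss_density A b)) =
    1 / 2 * (trace (matrix_inv (C ** transpose C) ** (A ** transpose A))
      + (c - b) \<bullet> (matrix_inv (C ** transpose C) *v (c - b))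
      - real CARD('n) + ln (det (C ** transpose C) / det (A ** transpose A)))"
proof -
  interpret G: prob_space "std_gaussian :: (real^'n) measure"
    by (rule std_gaussian_moments(1))
  let ?C = "matrix_inv C"
  define W where "W = ?C ** A"
  define w where "w = ?C *v (b - c)"
  have inv: "matrix_inv (C ** transpose C) = transpose ?C ** ?C"
  proof (rule matrix_inv_eqI)
    have "transpose C ** transpose ?C = transpose (?C ** C)" "transpose ?C ** transpose C = transpose (C ** ?C)"
      by (simp_all add: matrix_transpose_mul)
    then have t: "transpose C ** transpose ?C = mat 1" "transpose ?C ** transpose C = mat 1"
      by (simp_all add: matrix_inv_cancel[OF C] transpose_mat)
    show "C ** transpose C ** (transpose ?C ** ?C) = mat 1" "transpose ?C ** ?C ** (C ** transpose C) = mat 1"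
      by (metis matrix_mul_assoc matrix_mul_rid t matrix_inv_cancel[OF C])+
  qed
  have "(\<integral>x. ln (gauss_density A b x) - ln (gauss_density C c x) \<partial>density lborel (gauss_density A b)) =
      (\<integral>x. ln (gauss_density A b x) - ln (gauss_density C c x) \<partial>distr std_gaussian borel (\<lambda>z. A *v z + b))"
    using distr_std_gaussian[OF A, of b] by simp
  also have "\<dots> = (\<integral>z. ln (gauss_density A b (A *v z + b)) - ln (gauss_density C c (A *v z + b)) \<partial>std_gaussian)"
    unfolding ln_gauss_density[OF A] ln_gauss_density[OF C] by (rule integral_distr) measurable
  \<comment> \<open>The norm of z is written as that of \<open>mat 1 *v z + 0\<close>, so that the
    same formula applies and the dimension appears as the trace of the identity.\<close>
  also have "\<dots> = (\<integral>z. (norm (W *v z + w))\<^sup>2 / 2 - (norm (mat 1 *v z + 0))\<^sup>2 / 2 + ((ln \<bar>det C\<bar>) - (ln \<bar>det A\<bar>)) \<partial>std_gaussian)"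
  proof (rule Bochner_Integration.integral_cong[OF refl])
    fix z :: "real^'n"
    have "matrix_inv A *v (A *v z) = z"
      by (simp add: matrix_vector_mul_assoc matrix_inv_cancel[OF A])
    moreover have "?C *v (A *v z + b - c) = W *v z + w"
      by (simp only: W_def w_def matrix_vector_mul_assoc[symmetric] matrix_vector_right_distrib[symmetric] add_diff_eq)
    ultimately show "ln (gauss_density A b (A *v z + b)) - ln (gauss_density C c (A *v z + b)) =
      (norm (W *v z + w))\<^sup>2 / 2 - (norm (mat 1 *v z + 0))\<^sup>2 / 2 + ((ln \<bar>det C\<bar>) - (ln \<bar>det A\<bar>))"
      unfolding ln_gauss_density[OF A] ln_gauss_density[OF C] by simp
  qed
  also have "\<dots> = (trace (W ** transpose W) + (norm w)\<^sup>2) / 2 - (trace (mat 1 ** transpose (mat 1 :: real^'n^'n)) + (norm (0::real^'n))\<^sup>2) / 2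
      + ((ln \<bar>det C\<bar>) - (ln \<bar>det A\<bar>))"
    using std_gaussian_norm_square[of W w] std_gaussian_norm_square[of "mat 1" "0::real^'n"] G.prob_space[unfolded std_gaussian_space]
    by (simp del: matrix_vector_mul_lid matrix_mul_lid add_0_right norm_zero)
  also have "trace (mat 1 ** transpose (mat 1 :: real^'n^'n)) = real CARD('n)"
    unfolding transpose_mat matrix_mul_lid by (simp add: trace_def mat_def)
  also have "trace (W ** transpose W) = trace (matrix_inv (C ** transpose C) ** (A ** transpose A))"
  proof -
    have "W ** transpose W = (?C ** (A ** transpose A)) ** transpose ?C"
      by (simp add: W_def matrix_transpose_mul matrix_mul_assoc)
    also have "trace \<dots> = trace (transpose ?C ** (?C ** (A ** transpose A)))"
      by (rule trace_mul_sym)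
    finally show ?thesis
      by (simp add: inv matrix_mul_assoc)
  qed
  also have "(norm w)\<^sup>2 = (c - b) \<bullet> (matrix_inv (C ** transpose C) *v (c - b))"
  proof -
    have "(norm w)\<^sup>2 = (?C *v (c - b)) \<bullet> (?C *v (c - b))"
    proof -
      have "w = - (?C *v (c - b))"
        by (simp add: w_def matrix_vector_mult_diff_distrib)
      then show ?thesis
        by (simp add: power2_norm_eq_inner)
    qed
    also have "\<dots> = (c - b) \<bullet> (transpose ?C *v (?C *v (c - b)))"
      by (metis dot_lmul_matrix inner_commute transpose_matrix_vector)
    finally show ?thesis
      by (simp add: inv matrix_vector_mul_assoc)
  qed
  also have "(ln \<bar>det C\<bar>) - (ln \<bar>det A\<bar>) = ln (det (C ** transpose C) / det (A ** transpose A)) / 2"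
  proof -
    have "det (B ** transpose B) = \<bar>det B\<bar>\<^sup>2" for B :: "real^'n^'n"
      by (simp add: det_mul power2_eq_square)
    moreover have "ln (\<bar>det C\<bar>\<^sup>2 / \<bar>det A\<bar>\<^sup>2) = 2 * ln \<bar>det C\<bar> - 2 * (ln \<bar>det A\<bar>)"
    proof -
      have pos: "0 < \<bar>det C\<bar>" "0 < \<bar>det A\<bar>"
        using A C by auto
      show ?thesis
        unfolding ln_divide_pos[OF zero_less_power[OF pos(1)] zero_less_power[OF pos(2)]]
          ln_realpow by simp
    qed
    ultimately show ?thesis
      by (simp only:) simp
  qed
  finally show ?thesis
    by (simp add: field_simps)
qed

section \<open>Nearest neighbours of a sample\<close>

lemma sets_Collect_card_less:
  fixes m :: nat
  assumes [measurable]: "\<And>j. j < m \<Longrightarrow> {p\<in>space N. P j p} \<in> sets N"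
  shows "{p\<in>space N. card {j\<in>{..<m}. P j p} < l} \<in> sets N"
proof -
  have "(\<lambda>p. \<Sum>j<m. indicator {p\<in>space N. P j p} p :: real) \<in> borel_measurable N"
    by (intro borel_measurable_sum borel_measurable_indicator) simp
  then have "{p\<in>space N. (\<Sum>j<m. indicator {p\<in>space N. P j p} p :: real) < real l} \<in> sets N"
    by measurable
  also have "{p\<in>space N. (\<Sum>j<m. indicator {p\<in>space N. P j p} p :: real) < real l} =
      {p\<in>space N. card {j\<in>{..<m}. P j p} < l}"
  proof (intro Collect_cong conj_cong refl)
    fix p assume "p \<in> space N"
    then have "(\<Sum>j<m. indicator {p\<in>space N. P j p} p :: real) = (\<Sum>j\<in>{j\<in>{..<m}. P j p}. 1)"
      by (intro sum.mono_neutral_cong_right) auto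
    then show "(\<Sum>j<m. indicator {p\<in>space N. P j p} p :: real) < real l \<longleftrightarrow> card {j\<in>{..<m}. P j p} < l"
      by simp
  qed
  finally show ?thesis .
qed

text \<open>Independence makes the joint law a product, so Fubini evaluates the event with the value
  of \<open>X\<close> held fixed: the elementary form of conditioning on \<open>X\<close>.\<close>

lemma (in prob_space) prob_indep_var_freeze:
  assumes indep: "indep_var S X T Y" and E: "E \<in> sets (S \<Otimes>\<^sub>M T)"
  shows "prob {\<omega>\<in>space M. (X \<omega>, Y \<omega>) \<in> E} = (\<integral>\<omega>'. prob {\<omega>\<in>space M. (X \<omega>', Y \<omega>) \<in> E} \<partial>M)"
    and "(\<lambda>\<omega>'. prob {\<omega>\<in>space M. (X \<omega>', Y \<omega>) \<in> E}) \<in> borel_measurable M"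
proof -
  have [measurable]: "random_variable S X" "random_variable T Y"
    using indep by (auto dest: indep_var_rv1 indep_var_rv2)
  note E[measurable]
  interpret X: prob_space "distr M S X"
    by (rule prob_space_distr) measurable
  interpret Y: prob_space "distr M T Y"
    by (rule prob_space_distr) measurable
  have slice: "emeasure (distr M T Y) (Pair x -` E) = ennreal (prob {\<omega>\<in>space M. (x, Y \<omega>) \<in> E})" for x
  proof -
    have "Pair x -` E \<in> sets T"
      using sets_Pair1[OF E] by simp
    then have "emeasure (distr M T Y) (Pair x -` E) = emeasure M (Y -` (Pair x -` E) \<inter> space M)"
      by (subst emeasure_distr) auto
    also have "Y -` (Pair x -` E) \<inter> space M = {\<omega>\<in>space M. (x, Y \<omega>) \<in> E}"
      by auto
    finally show ?thesis
      by (simp add: emeasure_eq_measure)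
  qed
  have E': "E \<in> sets (distr M S X \<Otimes>\<^sub>M distr M T Y)"
    using E by (simp cong: sets_pair_measure_cong)
  have "(\<lambda>x. emeasure (distr M T Y) (Pair x -` E)) \<in> borel_measurable (distr M S X)"
    by (rule Y.measurable_emeasure_Pair[OF E'])
  then have "(\<lambda>x. emeasure (distr M T Y) (Pair x -` E)) \<in> borel_measurable S"
    by simp
  then have "(\<lambda>x. enn2real (emeasure (distr M T Y) (Pair x -` E))) \<in> borel_measurable S"
    by measurable
  then have meas: "(\<lambda>x. prob {\<omega>\<in>space M. (x, Y \<omega>) \<in> E}) \<in> borel_measurable S"
    by (simp add: slice)
  then show m: "(\<lambda>\<omega>'. prob {\<omega>\<in>space M. (X \<omega>', Y \<omega>) \<in> E}) \<in> borel_measurable M"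
    by (rule measurable_compose[rotated]) measurable
  have "ennreal (prob {\<omega>\<in>space M. (X \<omega>, Y \<omega>) \<in> E}) = emeasure (distr M (S \<Otimes>\<^sub>M T) (\<lambda>\<omega>. (X \<omega>, Y \<omega>))) E"
    using E by (subst emeasure_distr) (auto simp: emeasure_eq_measure vimage_def Int_def conj_commute intro!: arg_cong[of _ _ prob])
  also have "\<dots> = emeasure (distr M S X \<Otimes>\<^sub>M distr M T Y) E"
    using indep by (simp add: indep_var_distribution_eq)
  also have "\<dots> = (\<integral>\<^sup>+x. emeasure (distr M T Y) (Pair x -` E) \<partial>distr M S X)"
    by (rule Y.emeasure_pair_measure_alt[OF E'])
  also have "\<dots> = (\<integral>\<^sup>+\<omega>'. ennreal (prob {\<omega>\<in>space M. (X \<omega>', Y \<omega>) \<in> E}) \<partial>M)"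
    unfolding slice using meas by (subst nn_integral_distr) auto
  also have "\<dots> = ennreal (\<integral>\<omega>'. prob {\<omega>\<in>space M. (X \<omega>', Y \<omega>) \<in> E} \<partial>M)"
    using m by (intro nn_integral_eq_integral integrable_const_bound[of _ 1]) auto
  finally show "prob {\<omega>\<in>space M. (X \<omega>, Y \<omega>) \<in> E} = (\<integral>\<omega>'. prob {\<omega>\<in>space M. (X \<omega>', Y \<omega>) \<in> E} \<partial>M)"
    by (subst (asm) ennreal_inj) (auto intro: Bochner_Integration.integral_nonneg)
qed

lemma (in prob_space) indep_vars_reindex:
  assumes indep: "indep_vars N V UNIV" and f: "inj f"
  shows "indep_vars (\<lambda>j. N (f j)) (\<lambda>j. V (f j)) UNIV"
proof -
  let ?F = "\<lambda>i. {V i -` A \<inter> space M | A. A \<in> sets (N i)}"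
  have rv: "\<And>i. random_variable (N i) (V i)" and ind: "indep_sets ?F UNIV"
    using indep by (auto simp: indep_vars_def2)
  have "indep_sets (\<lambda>j. ?F (f j)) UNIV"
    unfolding indep_sets_def
  proof (intro conjI ballI allI impI)
    fix J A assume J: "J \<noteq> {}" "finite J" and A: "A \<in> Pi J (\<lambda>j. ?F (f j))"
    have inv: "inv f (f j) = j" for j
      using f by simp
    have "prob (\<Inter>i\<in>f ` J. A (inv f i)) = (\<Prod>i\<in>f ` J. prob (A (inv f i)))"
      using J A by (intro indep_setsD[OF ind]) (auto simp: inv Pi_iff)
    then show "prob (\<Inter>j\<in>J. A j) = (\<Prod>j\<in>J. prob (A j))"
      using f by (simp add: inv prod.reindex inj_on_def inj_def)
  next
    fix j show "?F (f j) \<subseteq> events"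
      using measurable_sets[OF rv] by auto
  qed
  then show ?thesis
    using rv by (simp add: indep_vars_def2)
qed

text \<open>The law of the \<open>l\<close>-th smallest of \<open>m\<close> independent uniform
  variables, described by its tail: the order statistic exceeds \<open>u\<close> iff fewer than
  \<open>l\<close> of the variables are at most \<open>u\<close>.\<close>

definition (in prob_space) uniform_order_stat :: "nat \<Rightarrow> nat \<Rightarrow> ('a \<Rightarrow> real) \<Rightarrow> bool" where
  "uniform_order_stat l m U \<longleftrightarrow> random_variable borel U \<and> (\<forall>\<omega>\<in>space M. 0 \<le> U \<omega> \<and> U \<omega> \<le> 1) \<and>
     (\<forall>u. 0 \<le> u \<and> u \<le> 1 \<longrightarrow> prob {\<omega>\<in>space M. u < U \<omega>} = multinomial_cdf l m u 0)"

lemma (in prob_space) uniform_order_stat_AE_pos: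
  assumes U: "uniform_order_stat l m U" and l: "1 \<le> l"
  shows "AE \<omega> in M. 0 < U \<omega>"
proof -
  have [measurable]: "random_variable borel U"
    using U by (simp add: uniform_order_stat_def)
  have "(\<Sum>a<l. real (m choose a) * 0 ^ a * (1 - 0) ^ (m - a)) = (\<Sum>a<l. if a = 0 then 1 else 0 :: real)"
    by (intro sum.cong) auto
  then have "multinomial_cdf l m 0 0 = 1"
    using multinomial_cdf_0[OF l, of m 0] l by (simp add: sum.delta)
  then have "prob {\<omega>\<in>space M. 0 < U \<omega>} = 1"
    using U by (simp add: uniform_order_stat_def)
  then show ?thesis
    by (subst (asm) prob_Collect_eq_1) measurable
qed

lemma (in prob_space) uniform_order_stat_log_tail:
  assumes U: "uniform_order_stat l m U" and l: "1 \<le> l" "1 \<le> m"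
  shows "prob {\<omega>\<in>space M. s < ln (real m * U \<omega>)} = log_count_tail l m s"
proof -
  have [measurable]: "random_variable borel U"
    using U by (simp add: uniform_order_stat_def)
  have m: "0 < real m"
    using l by simp
  have "prob {\<omega>\<in>space M. s < ln (real m * U \<omega>)} = prob {\<omega>\<in>space M. exp s / real m < U \<omega>}"
  proof (rule measure_eq_AE)
    \<comment> \<open>Passing between \<open>s < ln (m * U)\<close> and \<open>exp s / m < U\<close>
      requires U > 0, hence only an almost sure equality: at 0 the logarithm has a mere default
      value.\<close>
    show "AE \<omega> in M. (\<omega> \<in> {\<omega>\<in>space M. s < ln (real m * U \<omega>)}) = (\<omega> \<in> {\<omega>\<in>space M. exp s / real m < U \<omega>})"
      using uniform_order_stat_AE_pos[OF U l(1)]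
    proof eventually_elim
      case (elim \<omega>)
      have "s < ln (real m * U \<omega>) \<longleftrightarrow> exp s < real m * U \<omega>"
        using elim m by (metis exp_less_cancel_iff exp_ln mult_pos_pos)
      then show ?case
        using m by (simp add: field_simps)
    qed
  qed measurable
  also have "\<dots> = log_count_tail l m s"
  proof (cases "exp s \<le> real m")
    case True
    then show ?thesis
      using U m by (simp add: uniform_order_stat_def log_count_tail_def)
  next
    case False
    then have "1 < exp s / real m"
      using m by simp
    then have "\<not> exp s / real m < U \<omega>" if "\<omega> \<in> space M" for \<omega>
      using U that by (auto simp: uniform_order_stat_def intro: order_trans less_imp_le simp: not_less)
    then have empty: "{\<omega>\<in>space M. exp s / real m < U \<omega>} = {}"
      by blast
    show ?thesis
      unfolding empty using False by (simp add: log_count_tail_def)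
  qed
  finally show ?thesis .
qed

lemma (in prob_space) uniform_order_stat_tail_bound:
  assumes U: "uniform_order_stat l m U" and l: "1 \<le> l" "2 * l \<le> m"
  shows "tail_bound (\<lambda>\<omega>. ln (real m * U \<omega>)) (log_tail_bound l)"
  unfolding tail_bound_def
proof (intro conjI allI impI)
  have [measurable]: "random_variable borel U"
    using U by (simp add: uniform_order_stat_def)
  have m: "1 \<le> m"
    using l by simp
  note tail = uniform_order_stat_log_tail[OF U l(1) m]
  show "prob {\<omega>\<in>space M. s < ln (real m * U \<omega>)} \<le> (log_tail_bound l s)\<^sup>2" if "0 \<le> s" for s
    unfolding tail log_count_tail_def using binomial_cdf_upper[OF l that] by auto
  show "prob {\<omega>\<in>space M. ln (real m * U \<omega>) \<le> s} \<le> (log_tail_bound l s)\<^sup>2" if "s < 0" for s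
  proof -
    have "exp s \<le> real m"
      by (rule order_trans[of _ 1]) (use that m in auto)
    have "{\<omega>\<in>space M. ln (real m * U \<omega>) \<le> s} = space M - {\<omega>\<in>space M. s < ln (real m * U \<omega>)}"
      by auto
    then have "prob {\<omega>\<in>space M. ln (real m * U \<omega>) \<le> s} = 1 - prob {\<omega>\<in>space M. s < ln (real m * U \<omega>)}"
      using prob_compl[of "{\<omega>\<in>space M. s < ln (real m * U \<omega>)}"] by simp
    also have "\<dots> \<le> (log_tail_bound l s)\<^sup>2"
      unfolding tail log_count_tail_def using binomial_cdf_lower[OF l(1) m that] \<open>exp s \<le> real m\<close> by simp
    finally show ?thesis .
  qed
qed

text \<open>The marginal tails have their Poisson limits by \<open>uniform_order_stat\<close>; all
  information on the dependence is in \<open>joint\<close>. The uncentred product moment tends to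
  the square of \<open>Digamma l\<close> and both means tend to \<open>Digamma l\<close>, which
  cancels after centring.\<close>

lemma (in prob_space) uniform_order_stat_log_moments:
  fixes U U' :: "nat \<Rightarrow> 'a \<Rightarrow> real"
  assumes U: "\<And>m. l \<le> m \<Longrightarrow> uniform_order_stat l m (U m)" "\<And>m. l \<le> m \<Longrightarrow> uniform_order_stat l m (U' m)"
    and l: "1 \<le> l"
    and joint: "\<And>s t. (\<lambda>m. prob {\<omega>\<in>space M. exp s / real m < U m \<omega> \<and> exp t / real m < U' m \<omega>})
      \<longlonglongrightarrow> poisson_cdf l (exp s) * poisson_cdf l (exp t)"
  defines "a \<equiv> \<lambda>m \<omega>. ln (real m * U m \<omega>) - Digamma (real l)"
    and "a' \<equiv> \<lambda>m \<omega>. ln (real m * U' m \<omega>) - Digamma (real l)"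
  shows "(\<lambda>m. \<integral>\<omega>. a m \<omega> * a' m \<omega> \<partial>M) \<longlonglongrightarrow> 0"
    and "\<exists>B. \<forall>m\<ge>2 * l. (\<integral>\<omega>. (a m \<omega>)\<^sup>2 \<partial>M) \<le> B"
    and "\<And>m. 2 * l \<le> m \<Longrightarrow> integrable M (\<lambda>\<omega>. (a m \<omega>)\<^sup>2)"
proof -
  let ?L = "\<lambda>m \<omega>. ln (real m * U m \<omega>)" and ?L' = "\<lambda>m \<omega>. ln (real m * U' m \<omega>)"
  let ?b = "log_tail_bound l" and ?\<psi> = "Digamma (real l)"
  define g where "g s = poisson_cdf l (exp s)" for s
  have [measurable]: "g \<in> borel_measurable borel"
    unfolding g_def by measurable
  have rv: "random_variable borel (?L m)" "random_variable borel (?L' m)" if "2 * l \<le> m" for m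
  proof -
    have [measurable]: "random_variable borel (U m)" "random_variable borel (U' m)"
      using U that by (auto simp: uniform_order_stat_def)
    show "random_variable borel (?L m)" "random_variable borel (?L' m)"
      by measurable
  qed
  have tails: "tail_bound (?L m) ?b" "tail_bound (?L' m) ?b" if "2 * l \<le> m" for m
    using that l by (auto intro!: uniform_order_stat_tail_bound U)
  note b = integrable_log_tail_bound log_tail_bound_nonneg
  note bK = b log_tail_bound_le
  have mean_int: "(\<integral>s. (g s - indicator {..<0} s) \<partial>lborel) = ?\<psi>"
    unfolding g_def by (rule poisson_log_mean[OF l])
  \<comment> \<open>Indices are shifted by \<open>2 * l\<close>, from where on the tail bounds
    hold.\<close>
  have tail_lim: "(\<lambda>m. prob {\<omega>\<in>space M. s < ?L (m + 2 * l) \<omega>}) \<longlonglongrightarrow> g s"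
     "(\<lambda>m. prob {\<omega>\<in>space M. s < ?L' (m + 2 * l) \<omega>}) \<longlonglongrightarrow> g s" for s
  proof -
    have "prob {\<omega>\<in>space M. s < ?L (m + 2 * l) \<omega>} = log_count_tail l (m + 2 * l) s"
      "prob {\<omega>\<in>space M. s < ?L' (m + 2 * l) \<omega>} = log_count_tail l (m + 2 * l) s" for m
      using l by (intro uniform_order_stat_log_tail U; simp)+
    moreover have "(\<lambda>m. log_count_tail l (m + 2 * l) s) \<longlonglongrightarrow> g s"
      unfolding g_def by (rule LIMSEQ_ignore_initial_segment[OF log_count_tail_tendsto[OF l]])
    ultimately show "(\<lambda>m. prob {\<omega>\<in>space M. s < ?L (m + 2 * l) \<omega>}) \<longlonglongrightarrow> g s"
      "(\<lambda>m. prob {\<omega>\<in>space M. s < ?L' (m + 2 * l) \<omega>}) \<longlonglongrightarrow> g s"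
      by simp_all
  qed
  have joint_lim: "(\<lambda>m. prob {\<omega>\<in>space M. s < ?L (m + 2 * l) \<omega> \<and> t < ?L' (m + 2 * l) \<omega>}) \<longlonglongrightarrow> g s * g t" for s t
  proof -
    have "prob {\<omega>\<in>space M. s < ?L (m + 2 * l) \<omega> \<and> t < ?L' (m + 2 * l) \<omega>} =
        prob {\<omega>\<in>space M. exp s / real (m + 2 * l) < U (m + 2 * l) \<omega> \<and> exp t / real (m + 2 * l) < U' (m + 2 * l) \<omega>}" for m
    proof (rule measure_eq_AE)
      let ?m = "m + 2 * l"
      have m: "0 < real ?m"
        using l by simp
      have Um: "uniform_order_stat l ?m (U ?m)" "uniform_order_stat l ?m (U' ?m)"
        by (auto intro: U)
      then have [measurable]: "random_variable borel (U ?m)" "random_variable borel (U' ?m)"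
        by (auto simp: uniform_order_stat_def)
      have iff: "s < ln (real ?m * v) \<longleftrightarrow> exp s / real ?m < v" if "0 < v" for s v
      proof -
        have "s < ln (real ?m * v) \<longleftrightarrow> exp s < real ?m * v"
          using that m by (metis exp_less_cancel_iff exp_ln mult_pos_pos)
        then show ?thesis
          using m by (simp add: pos_divide_less_eq mult.commute)
      qed
      show "AE \<omega> in M. (\<omega> \<in> {\<omega>\<in>space M. s < ?L ?m \<omega> \<and> t < ?L' ?m \<omega>}) =
         (\<omega> \<in> {\<omega>\<in>space M. exp s / real ?m < U ?m \<omega> \<and> exp t / real ?m < U' ?m \<omega>})"
        using uniform_order_stat_AE_pos[OF Um(1) l] uniform_order_stat_AE_pos[OF Um(2) l]
        by eventually_elim (simp only: mem_Collect_eq iff)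
      show "{\<omega>\<in>space M. s < ?L ?m \<omega> \<and> t < ?L' ?m \<omega>} \<in> events"
        "{\<omega>\<in>space M. exp s / real ?m < U ?m \<omega> \<and> exp t / real ?m < U' ?m \<omega>} \<in> events"
        by measurable
    qed
    then show ?thesis
      using LIMSEQ_ignore_initial_segment[OF joint[of s t], of "2 * l"] by (simp add: g_def)
  qed
  have LL: "(\<lambda>m. \<integral>\<omega>. ?L (m + 2 * l) \<omega> * ?L' (m + 2 * l) \<omega> \<partial>M) \<longlonglongrightarrow> ?\<psi>\<^sup>2"
    unfolding mean_int[symmetric]
    by (rule asymptotically_independent_moments[OF rv b tails _ tail_lim joint_lim]) auto
  have means: "(\<lambda>m. \<integral>\<omega>. Lm (m + 2 * l) \<omega> \<partial>M) \<longlonglongrightarrow> ?\<psi>"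
    if rv: "\<And>m. 2 * l \<le> m \<Longrightarrow> random_variable borel (Lm m)" and tb: "\<And>m. 2 * l \<le> m \<Longrightarrow> tail_bound (Lm m) ?b"
      and lim: "\<And>s. (\<lambda>m. prob {\<omega>\<in>space M. s < Lm (m + 2 * l) \<omega>}) \<longlonglongrightarrow> g s" for Lm :: "nat \<Rightarrow> 'a \<Rightarrow> real"
  proof -
    note T = tail_bound_mean[OF rv bK tb]
    have "(\<lambda>m. \<integral>s. (prob {\<omega>\<in>space M. s < Lm (m + 2 * l) \<omega>} - indicator {..<0} s) \<partial>lborel) \<longlonglongrightarrow>
        (\<integral>s. (g s - indicator {..<0} s) \<partial>lborel)"
    proof (rule integral_dominated_convergence[where w="\<lambda>s. (1 + log_tail_const l) * ?b s"])
      show "integrable lborel (\<lambda>s. (1 + log_tail_const l) * ?b s)"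
        using integrable_log_tail_bound by simp
      show "(\<lambda>s. prob {\<omega>\<in>space M. s < Lm (m + 2 * l) \<omega>} - indicator {..<0} s) \<in> borel_measurable lborel" for m
        by (rule T(3)) auto
      show "AE s in lborel. norm (prob {\<omega>\<in>space M. s < Lm (m + 2 * l) \<omega>} - indicator {..<0} s) \<le>
          (1 + log_tail_const l) * ?b s" for m
        unfolding real_norm_def by (intro AE_I2 T(4)) auto
      show "AE s in lborel. (\<lambda>m. prob {\<omega>\<in>space M. s < Lm (m + 2 * l) \<omega>} - indicator {..<0} s) \<longlonglongrightarrow> g s - indicator {..<0} s"
        by (intro AE_I2 tendsto_diff lim tendsto_const)
    qed measurable
    moreover have "(\<integral>\<omega>. Lm (m + 2 * l) \<omega> \<partial>M) = (\<integral>s. (prob {\<omega>\<in>space M. s < Lm (m + 2 * l) \<omega>} - indicator {..<0} s) \<partial>lborel)" for m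
      by (rule T(1)) auto
    ultimately show ?thesis
      by (simp only: mean_int)
  qed
  have int: "integrable M (?L m)" "integrable M (?L' m)" "integrable M (\<lambda>\<omega>. ?L m \<omega> * ?L' m \<omega>)"
    "integrable M (\<lambda>\<omega>. ?L m \<omega> * ?L m \<omega>)" "\<bar>\<integral>\<omega>. ?L m \<omega> * ?L m \<omega> \<partial>M\<bar> \<le> (\<integral>s. ?b s \<partial>lborel)\<^sup>2" if m: "2 * l \<le> m" for m
    using tail_bound_mean(2)[OF rv(1)[OF m] bK tails(1)[OF m]] tail_bound_mean(2)[OF rv(2)[OF m] bK tails(2)[OF m]]
      tail_bound_integrals(1)[OF rv[OF m] b tails[OF m]]
      tail_bound_integrals(1,2)[OF rv(1)[OF m] rv(1)[OF m] b tails(1)[OF m] tails(1)[OF m]]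
    by blast+
  have aa': "(\<integral>\<omega>. a m \<omega> * a' m \<omega> \<partial>M) = (\<integral>\<omega>. ?L m \<omega> * ?L' m \<omega> \<partial>M) - ?\<psi> * (\<integral>\<omega>. ?L m \<omega> \<partial>M) - ?\<psi> * (\<integral>\<omega>. ?L' m \<omega> \<partial>M) + ?\<psi>\<^sup>2"
    if "2 * l \<le> m" for m
  proof -
    have "a m \<omega> * a' m \<omega> = ?L m \<omega> * ?L' m \<omega> - ?\<psi> * ?L m \<omega> - ?\<psi> * ?L' m \<omega> + ?\<psi>\<^sup>2" for \<omega>
      by (simp add: a_def a'_def power2_eq_square algebra_simps)
    then show ?thesis
      using int(1-3)[OF that] by (simp add: prob_space)
  qed
  have "(\<lambda>m. (\<integral>\<omega>. ?L (m + 2 * l) \<omega> * ?L' (m + 2 * l) \<omega> \<partial>M) - ?\<psi> * (\<integral>\<omega>. ?L (m + 2 * l) \<omega> \<partial>M) -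
      ?\<psi> * (\<integral>\<omega>. ?L' (m + 2 * l) \<omega> \<partial>M) + ?\<psi>\<^sup>2) \<longlonglongrightarrow> ?\<psi>\<^sup>2 - ?\<psi> * ?\<psi> - ?\<psi> * ?\<psi> + ?\<psi>\<^sup>2"
    by (intro tendsto_add tendsto_diff tendsto_mult tendsto_const LL
        means[of ?L, OF rv(1) tails(1) tail_lim(1)] means[of ?L', OF rv(2) tails(2) tail_lim(2)])
  then have "(\<lambda>m. \<integral>\<omega>. a (m + 2 * l) \<omega> * a' (m + 2 * l) \<omega> \<partial>M) \<longlonglongrightarrow> 0"
    by (simp add: aa' power2_eq_square)
  then show "(\<lambda>m. \<integral>\<omega>. a m \<omega> * a' m \<omega> \<partial>M) \<longlonglongrightarrow> 0"
    by (rule LIMSEQ_offset)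
  have aa: "(a m \<omega>)\<^sup>2 = ?L m \<omega> * ?L m \<omega> - 2 * ?\<psi> * ?L m \<omega> + ?\<psi>\<^sup>2" for m \<omega>
    by (simp add: a_def power2_eq_square algebra_simps)
  show int2: "integrable M (\<lambda>\<omega>. (a m \<omega>)\<^sup>2)" if "2 * l \<le> m" for m
    unfolding aa using int[OF that] by simp
  show "\<exists>B. \<forall>m\<ge>2 * l. (\<integral>\<omega>. (a m \<omega>)\<^sup>2 \<partial>M) \<le> B"
  proof (intro exI allI impI)
    fix m assume m: "2 * l \<le> m"
    have le: "(a m \<omega>)\<^sup>2 \<le> 2 * (?L m \<omega> * ?L m \<omega>) + 2 * ?\<psi>\<^sup>2" for \<omega>
      using zero_le_power2[of "?L m \<omega> + ?\<psi>"] unfolding aa by (simp add: power2_eq_square algebra_simps)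
    have "(\<integral>\<omega>. (a m \<omega>)\<^sup>2 \<partial>M) \<le> (\<integral>\<omega>. 2 * (?L m \<omega> * ?L m \<omega>) + 2 * ?\<psi>\<^sup>2 \<partial>M)"
      using int[OF m] by (intro integral_mono int2[OF m] le) auto
    also have "\<dots> = 2 * (\<integral>\<omega>. ?L m \<omega> * ?L m \<omega> \<partial>M) + 2 * ?\<psi>\<^sup>2"
      using int(4)[OF m] by (simp add: prob_space)
    also have "\<dots> \<le> 2 * (\<integral>s. ?b s \<partial>lborel)\<^sup>2 + 2 * ?\<psi>\<^sup>2"
      using int(5)[OF m] by simp
    finally show "(\<integral>\<omega>. (a m \<omega>)\<^sup>2 \<partial>M) \<le> 2 * (\<integral>s. ?b s \<partial>lborel)\<^sup>2 + 2 * ?\<psi>\<^sup>2" .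
  qed
qed

text \<open>For large m, the upper tail bound at s = ln (m * u) reads (K / (m * u))^2, which tends
  to 0 for fixed \<open>u\<close>.\<close>

lemma multinomial_cdf_tendsto_0:
  assumes l: "1 \<le> l" and u: "0 < u" "u \<le> 1"
  shows "(\<lambda>m. multinomial_cdf l m u 0) \<longlonglongrightarrow> 0"
proof (rule tendsto_sandwich[of "\<lambda>_. 0"])
  let ?K = "log_tail_const l"
  have ev: "\<forall>\<^sub>F m in sequentially. 2 * l \<le> m \<and> 1 / u \<le> real m \<and> 1 \<le> m"
    by (intro eventually_conj eventually_ge_at_top eventually_compose_filterlim[OF eventually_ge_at_top filterlim_real_sequentially])
  show "\<forall>\<^sub>F m in sequentially. multinomial_cdf l m u 0 \<le> (?K / (real m * u))\<^sup>2"
    using ev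
  proof eventually_elim
    case (elim m)
    then have mu: "1 \<le> real m * u" "real m * u \<le> real m" "0 < real m"
      using u by (auto simp: field_simps mult_left_le)
    have "multinomial_cdf l m (exp (ln (real m * u)) / real m) 0 \<le> (log_tail_bound l (ln (real m * u)))\<^sup>2"
      using mu elim u by (intro binomial_cdf_upper[OF l]) auto
    moreover have "exp (ln (real m * u)) / real m = u"
      using mu u by simp
    moreover have "(log_tail_bound l (ln (real m * u)))\<^sup>2 = (?K / (real m * u))\<^sup>2"
      using mu u by (simp add: log_tail_bound_def exp_minus divide_inverse)
    ultimately show ?case
      by (simp only:)
  qed
  show "\<forall>\<^sub>F m in sequentially. 0 \<le> multinomial_cdf l m u 0"
    using u by (intro always_eventually allI) (simp add: multinomial_cdf_def sum_nonneg)
  show "(\<lambda>m. (?K / (real m * u))\<^sup>2) \<longlonglongrightarrow> 0"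
  proof -
    have "(\<lambda>m. ?K / u * (1 / real m)) \<longlonglongrightarrow> 0"
      by (intro tendsto_mult_right_zero lim_1_over_n)
    then have "(\<lambda>m. (?K / u * (1 / real m))\<^sup>2) \<longlonglongrightarrow> 0\<^sup>2"
      by (rule tendsto_power)
    then show ?thesis
      by (simp add: mult.commute)
  qed
qed auto

section \<open>Counts and ranks around query points\<close>

context tame_density
begin

text \<open>Mass of the ball around \<open>x\<close> that reaches out to \<open>y\<close>. For
  \<open>y\<close> of law \<open>Q\<close> it is uniform on [0, 1], whatever \<open>x\<close>
  is.\<close>

definition score :: "'b \<Rightarrow> 'b \<Rightarrow> real" where
  "score x y = ball_prob x (dist x y)"

lemma score_measurable[measurable (raw)]:
  assumes [measurable]: "f \<in> borel_measurable N" "g \<in> borel_measurable N"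
  shows "(\<lambda>\<omega>. score (f \<omega>) (g \<omega>)) \<in> borel_measurable N"
  unfolding score_def by measurable

lemma score_bounds: "0 \<le> score x y" "score x y \<le> 1"
  by (auto simp: score_def ball_prob_le_1) (simp add: ball_prob_def)

lemma score_sets: "{w. score x w \<le> u} \<in> sets borel"
  by measurable

lemma measure_score_le: "0 \<le> u \<Longrightarrow> u \<le> 1 \<Longrightarrow> measure Q {w. score x w \<le> u} = u"
  unfolding score_def by (rule prob_ball_prob_le)

lemma score_self: "score x x = 0"
  by (simp add: score_def ball_prob_0)

end

text \<open>W 0 and W 1 are query points of arbitrary law; the sample with law Q starts at W 2.\<close>

locale nn_sample = prob_space M + tame_density q C
  for M :: "'a measure" and q :: "'b::euclidean_space \<Rightarrow> real" and C +
  fixes W :: "nat \<Rightarrow> 'a \<Rightarrow> 'b"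
  assumes indep: "indep_vars (\<lambda>_. borel) W UNIV"
    and sample_law: "\<And>j. distr M borel (W (j + 2)) = Q"
begin

lemma W_measurable[measurable]: "random_variable borel (W i)"
  using indep by (simp add: indep_vars_def2)

abbreviation count :: "'b \<Rightarrow> nat \<Rightarrow> real \<Rightarrow> 'a \<Rightarrow> nat" where
  "count x m u \<omega> \<equiv> card {j\<in>{..<m}. score x (W (j + 2) \<omega>) \<le> u}"

lemma prob_counts:
  assumes "{w. score x w \<le> u} \<inter> {w. score y w \<le> v} = {}"
  shows "prob {\<omega>\<in>space M. count x m u \<omega> < l \<and> count y m v \<omega> < l} =
    multinomial_cdf l m (measure Q {w. score x w \<le> u}) (measure Q {w. score y w \<le> v})"
proof -
  have ind: "indep_vars (\<lambda>_. borel) (\<lambda>j. W (j + 2)) {..<m}"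
    by (rule indep_vars_subset[OF indep_vars_reindex[OF indep]]) (auto simp: inj_def)
  have pr: "prob (W (j + 2) -` A \<inter> space M) = measure Q A" if "A \<in> sets borel" for A j
    using that unfolding sample_law[of j, symmetric] by (subst measure_distr) auto
  have "prob {\<omega>\<in>space M. card {j\<in>{..<m}. W (j + 2) \<omega> \<in> {w. score x w \<le> u}} < l \<and>
      card {j\<in>{..<m}. W (j + 2) \<omega> \<in> {w. score y w \<le> v}} < l} =
    multinomial_cdf l m (measure Q {w. score x w \<le> u}) (measure Q {w. score y w \<le> v})"
    by (rule prob_counts_less[OF ind score_sets score_sets assms pr[OF score_sets] pr[OF score_sets]])
  then show ?thesis
    by (simp only: mem_Collect_eq)
qed

text \<open>The event is a set of pairs of query block and sample block. The coordinates {0, 1} and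
  {2..<m + 2} are independent, so the query points may be frozen.\<close>

lemma prob_counts_freeze:
  "prob {\<omega>\<in>space M. count (W 0 \<omega>) m u \<omega> < l \<and> count (W 1 \<omega>) m v \<omega> < l} =
    (\<integral>\<omega>'. prob {\<omega>\<in>space M. count (W 0 \<omega>') m u \<omega> < l \<and> count (W 1 \<omega>') m v \<omega> < l} \<partial>M)" (is ?A)
  "(\<lambda>\<omega>'. prob {\<omega>\<in>space M. count (W 0 \<omega>') m u \<omega> < l \<and> count (W 1 \<omega>') m v \<omega> < l}) \<in> borel_measurable M" (is ?B)
proof -
  let ?S = "PiM {0, 1::nat} (\<lambda>_. borel :: 'b measure)" and ?T = "PiM {2..<m + 2} (\<lambda>_. borel :: 'b measure)"
  let ?E = "{p\<in>space (?S \<Otimes>\<^sub>M ?T). card {j\<in>{..<m}. score (fst p 0) (snd p (j + 2)) \<le> u} < l \<and>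
     card {j\<in>{..<m}. score (fst p 1) (snd p (j + 2)) \<le> v} < l}"
  have ind: "indep_var ?S (\<lambda>\<omega>. restrict (\<lambda>i. W i \<omega>) {0, 1}) ?T (\<lambda>\<omega>. restrict (\<lambda>i. W i \<omega>) {2..<m + 2})"
    by (rule indep_var_restrict[OF indep]) auto
  have c1: "{p\<in>space (?S \<Otimes>\<^sub>M ?T). card {j\<in>{..<m}. score (fst p i) (snd p (j + 2)) \<le> r} < l} \<in> sets (?S \<Otimes>\<^sub>M ?T)"
    if "i \<in> {0, 1}" for i r
  proof (rule sets_Collect_card_less)
    fix j assume "j < m"
    then have [measurable]: "(\<lambda>p. snd p (j + 2)) \<in> borel_measurable (?S \<Otimes>\<^sub>M ?T)" "(\<lambda>p. fst p i) \<in> borel_measurable (?S \<Otimes>\<^sub>M ?T)"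
      using that by (auto intro!: measurable_compose[OF measurable_fst measurable_component_singleton] measurable_compose[OF measurable_snd measurable_component_singleton])
    show "{p\<in>space (?S \<Otimes>\<^sub>M ?T). score (fst p i) (snd p (j + 2)) \<le> r} \<in> sets (?S \<Otimes>\<^sub>M ?T)"
      by measurable
  qed
  have E: "?E \<in> sets (?S \<Otimes>\<^sub>M ?T)"
    using sets.Int[OF c1[of 0 u] c1[of 1 v]] by (simp add: Collect_conj_eq[symmetric] conj_ac cong: conj_cong)
  have mem: "(restrict (\<lambda>i. W i \<omega>') {0, 1}, restrict (\<lambda>i. W i \<omega>) {2..<m + 2}) \<in> ?E \<longleftrightarrow>
      count (W 0 \<omega>') m u \<omega> < l \<and> count (W 1 \<omega>') m v \<omega> < l" for \<omega>' \<omega>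
  proof -
    have "{j\<in>{..<m}. score x (restrict (\<lambda>i. W i \<omega>) {2..<m + 2} (j + 2)) \<le> r} = {j\<in>{..<m}. score x (W (j + 2) \<omega>) \<le> r}" for x r
      by (intro Collect_cong conj_cong refl) auto
    then show ?thesis
      by (simp add: space_pair_measure space_PiM)
  qed
  show ?A ?B
    using prob_indep_var_freeze[OF ind E] unfolding mem by simp_all
qed

text \<open>For a frozen query point the count has a binomial law in which the point does not occur,
  so integrating over the query point changes nothing.\<close>

lemma prob_count_query:
  assumes u: "0 \<le> u" "u \<le> 1" and l: "1 \<le> l" and i: "i < 2"
  shows "prob {\<omega>\<in>space M. count (W i \<omega>) m u \<omega> < l} = multinomial_cdf l m u 0"
proof -
  \<comment> \<open>A threshold of -1 makes the other count 0, hence below \<open>l\<close>: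
    statements about two query points specialise to one.\<close>
  have neg: "\<not> score x w \<le> -1" for x w
    using score_bounds(1)[of x w] by simp
  have *: "prob {\<omega>\<in>space M. count x m u \<omega> < l} = multinomial_cdf l m u 0" for x
    using prob_counts[of x u x "-1" m l] u l by (simp add: neg measure_score_le)
  show ?thesis
  proof (cases "i = 0")
    case True
    then show ?thesis
      using prob_counts_freeze(1)[of m u l "-1"] l by (simp add: neg *[simplified] prob_space)
  next
    case False
    then have "i = 1"
      using i by simp
    then show ?thesis
      using prob_counts_freeze(1)[of m "-1" l u] l by (simp add: neg *[simplified] prob_space)
  qed
qed

text \<open>Small scores force sample points into balls of half the distance between the query
  points. For large m the two score sets are thus disjoint and the counts exactly multinomial;
  dominated convergence then integrates the limit over the query points.\<close>

lemma joint_count_tendsto: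
  fixes u v :: "nat \<Rightarrow> real" and N :: "nat \<Rightarrow> nat"
  assumes ne: "AE \<omega> in M. W 0 \<omega> \<noteq> W 1 \<omega>"
    and N: "filterlim N at_top sequentially"
    and u: "\<And>m. 0 \<le> u m" "u \<longlonglongrightarrow> 0" "(\<lambda>m. real (N m) * u m) \<longlonglongrightarrow> s"
    and v: "\<And>m. 0 \<le> v m" "v \<longlonglongrightarrow> 0" "(\<lambda>m. real (N m) * v m) \<longlonglongrightarrow> t"
  shows "(\<lambda>m. prob {\<omega>\<in>space M. count (W 0 \<omega>) (N m) (u m) \<omega> < l \<and> count (W 1 \<omega>) (N m) (v m) \<omega> < l})
    \<longlonglongrightarrow> poisson_cdf l s * poisson_cdf l t"
proof -
  let ?p = "\<lambda>m x y. prob {\<omega>\<in>space M. count x (N m) (u m) \<omega> < l \<and> count y (N m) (v m) \<omega> < l}"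
  have pt: "(\<lambda>m. ?p m x y) \<longlonglongrightarrow> poisson_cdf l s * poisson_cdf l t" if "x \<noteq> y" for x y
  proof -
    define r where "r = dist x y / 2"
    have r: "0 < r"
      using that by (simp add: r_def)
    have "\<forall>\<^sub>F m in sequentially. u m < min 1 (ball_prob x r) \<and> v m < min 1 (ball_prob y r)"
      using ball_prob_pos[OF r]
      by (intro eventually_conj order_tendstoD(2)[OF u(2)] order_tendstoD(2)[OF v(2)]) auto
    then have "\<forall>\<^sub>F m in sequentially. multinomial_cdf l (N m) (u m) (v m) = ?p m x y"
    proof eventually_elim
      case (elim m)
      have close: "dist z w < r" if "score z w \<le> c" "c < ball_prob z r" for z w c
        using that monoD[OF mono_ball_prob, of r "dist z w" z] by (force simp: score_def)
      have "{w. score x w \<le> u m} \<inter> {w. score y w \<le> v m} = {}"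
      proof (intro equals0I)
        fix w assume "w \<in> {w. score x w \<le> u m} \<inter> {w. score y w \<le> v m}"
        then have "dist x w < r" "dist y w < r"
          using close elim by auto
        then show False
          using dist_triangle2[of x y w] by (simp add: r_def)
      qed
      from prob_counts[OF this] show ?case
        using elim u(1) v(1) by (simp add: measure_score_le)
    qed
    with multinomial_cdf_tendsto[OF N u v] show ?thesis
      by (rule Lim_transform_eventually)
  qed
  have "(\<lambda>m. \<integral>\<omega>'. ?p m (W 0 \<omega>') (W 1 \<omega>') \<partial>M) \<longlonglongrightarrow> (\<integral>\<omega>'. poisson_cdf l s * poisson_cdf l t \<partial>M)"
  proof (rule integral_dominated_convergence[where w="\<lambda>_. 1"])
    show "AE \<omega>' in M. (\<lambda>m. ?p m (W 0 \<omega>') (W 1 \<omega>')) \<longlonglongrightarrow> poisson_cdf l s * poisson_cdf l t"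
      using ne by eventually_elim (rule pt)
  qed (auto intro: prob_counts_freeze(2))
  also have "(\<integral>\<omega>'. poisson_cdf l s * poisson_cdf l t \<partial>M) = poisson_cdf l s * poisson_cdf l t"
    by (simp add: prob_space)
  finally show ?thesis
    unfolding prob_counts_freeze(1) .
qed

lemma uniform_order_stat_score:
  assumes l: "1 \<le> l" "l \<le> m" and i: "i < 2"
  shows "uniform_order_stat l m (\<lambda>\<omega>. order_stat l (\<lambda>j. score (W i \<omega>) (W (j + 2) \<omega>)) {..<m})"
  unfolding uniform_order_stat_def
proof (intro conjI ballI allI impI)
  have l': "finite {..<m}" "1 \<le> l" "l \<le> card {..<m}"
    using l by auto
  show "random_variable borel (\<lambda>\<omega>. order_stat l (\<lambda>j. score (W i \<omega>) (W (j + 2) \<omega>)) {..<m})"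
    by (rule order_stat_measurable[OF l']) measurable
  fix \<omega>
  have "order_stat l (\<lambda>j. score (W i \<omega>) (W (j + 2) \<omega>)) {..<m} \<in> (\<lambda>j. score (W i \<omega>) (W (j + 2) \<omega>)) ` {..<m}"
    by (rule order_stat_in_image[OF l'])
  then show "0 \<le> order_stat l (\<lambda>j. score (W i \<omega>) (W (j + 2) \<omega>)) {..<m}"
    "order_stat l (\<lambda>j. score (W i \<omega>) (W (j + 2) \<omega>)) {..<m} \<le> 1"
    using score_bounds by auto
next
  fix u :: real assume "0 \<le> u \<and> u \<le> 1"
  then show "prob {\<omega>\<in>space M. u < order_stat l (\<lambda>j. score (W i \<omega>) (W (j + 2) \<omega>)) {..<m}} = multinomial_cdf l m u 0"
    using prob_count_query[of u l i m] l i by (subst order_stat_gt_iff) auto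
qed

abbreviation nn_dist :: "nat \<Rightarrow> nat \<Rightarrow> 'a \<Rightarrow> real" where
  "nn_dist l m \<omega> \<equiv> order_stat l (\<lambda>j. dist (W 0 \<omega>) (W (j + 2) \<omega>)) {..<m}"

lemma ball_prob_nn_dist:
  assumes "1 \<le> l" "l \<le> m"
  shows "ball_prob (W 0 \<omega>) (nn_dist l m \<omega>) = order_stat l (\<lambda>j. score (W 0 \<omega>) (W (j + 2) \<omega>)) {..<m}"
  using mono_order_stat[of "{..<m}" l "ball_prob (W 0 \<omega>)"] mono_ball_prob assms by (simp add: score_def)

lemma nn_dist_measurable: "1 \<le> l \<Longrightarrow> l \<le> m \<Longrightarrow> random_variable borel (nn_dist l m)"
  by (rule order_stat_measurable) (auto, measurable)

lemma nn_dist_antimono: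
  assumes "1 \<le> l" "l \<le> m" "m \<le> m'"
  shows "nn_dist l m' \<omega> \<le> nn_dist l m \<omega>"
  using assms by (intro order_stat_mono_set) auto

text \<open>A distance of at most 0 would make the rank 0 by monotonicity of
  \<open>ball_prob\<close>, and ranks are almost surely positive.\<close>

lemma AE_nn_dist_pos:
  assumes l: "1 \<le> l" "l \<le> m"
  shows "AE \<omega> in M. 0 < nn_dist l m \<omega>"
  using uniform_order_stat_AE_pos[OF uniform_order_stat_score[where i=0, OF l zero_less_numeral] l(1)]
proof (eventually_elim, simp)
  fix \<omega>
  assume "0 < order_stat l (\<lambda>j. score (W 0 \<omega>) (W (Suc (Suc j)) \<omega>)) {..<m}"
  then have "0 < ball_prob (W 0 \<omega>) (nn_dist l m \<omega>)"
    using ball_prob_nn_dist[OF l] by simp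
  then have "\<not> nn_dist l m \<omega> \<le> 0"
    using monoD[OF mono_ball_prob, of "nn_dist l m \<omega>" 0 "W 0 \<omega>"] by (auto simp: ball_prob_0)
  then show "0 < order_stat l (\<lambda>j. dist (W 0 \<omega>) (W (Suc (Suc j)) \<omega>)) {..<m}"
    by simp
qed

text \<open>The distances decrease in \<open>m\<close>, so it suffices that almost surely each level
  is undercut by the rank at some index. This holds because the probability of a rank above a fixed
  u tends to 0.\<close>

lemma AE_nn_dist_tendsto:
  assumes l: "1 \<le> l"
  shows "AE \<omega> in M. (\<lambda>m. nn_dist l (m + l) \<omega>) \<longlonglongrightarrow> 0"
proof -
  define U where "U m \<omega> = order_stat l (\<lambda>j. score (W 0 \<omega>) (W (j + 2) \<omega>)) {..<m + l}" for m \<omega>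
  have U: "uniform_order_stat l (m + l) (U m)" for m
    unfolding U_def using l by (intro uniform_order_stat_score) auto
  then have [measurable]: "random_variable borel (U m)" for m
    by (auto simp: uniform_order_stat_def)
  have "AE \<omega> in M. \<exists>m. U m \<omega> \<le> u" if u: "0 < u" "u \<le> 1" for u
  proof -
    let ?B = "{\<omega>\<in>space M. \<forall>m. u < U m \<omega>}"
    have [measurable]: "?B \<in> events"
      by measurable
    have "prob ?B \<le> multinomial_cdf l (m + l) u 0" for m
    proof -
      have "prob ?B \<le> prob {\<omega>\<in>space M. u < U m \<omega>}"
        by (intro finite_measure_mono) (auto, measurable)
      then show ?thesis
        using U[of m] u by (simp add: uniform_order_stat_def)
    qed
    then have "prob ?B \<le> 0"
      using LIMSEQ_ignore_initial_segment[OF multinomial_cdf_tendsto_0[OF l u], of l]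
      by (intro tendsto_lowerbound[of _ 0 sequentially]) auto
    then have "prob ?B = 0"
      by (simp add: measure_le_0_iff)
    then have "AE \<omega> in M. \<not> (\<forall>m. u < U m \<omega>)"
      by (subst AE_iff_measurable[OF _ refl]) (auto simp: emeasure_eq_measure)
    then show ?thesis
      by eventually_elim (simp add: not_less)
  qed
  then have "AE \<omega> in M. \<forall>k. \<exists>m. U m \<omega> \<le> 1 / real (Suc k)"
    unfolding AE_all_countable by simp
  then show ?thesis
  proof eventually_elim
    case (elim \<omega>)
    show ?case
    proof (rule LIMSEQ_I)
      fix \<delta> :: real assume \<delta>: "0 < \<delta>"
      obtain k where k: "1 / real (Suc k) < ball_prob (W 0 \<omega>) \<delta>"
        using nat_approx_posE[OF ball_prob_pos[OF \<delta>]] by blast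
      obtain m0 where "U m0 \<omega> \<le> 1 / real (Suc k)"
        using elim by blast
      then have "ball_prob (W 0 \<omega>) (nn_dist l (m0 + l) \<omega>) < ball_prob (W 0 \<omega>) \<delta>"
        using k ball_prob_nn_dist[of l "m0 + l" \<omega>] l by (simp add: U_def)
      then have small: "nn_dist l (m0 + l) \<omega> < \<delta>"
        using monoD[OF mono_ball_prob, of \<delta> "nn_dist l (m0 + l) \<omega>" "W 0 \<omega>"] by (meson not_le)
      have "norm (nn_dist l (m + l) \<omega> - 0) < \<delta>" if "m0 \<le> m" for m
      proof -
        have "nn_dist l (m + l) \<omega> \<in> (\<lambda>j. dist (W 0 \<omega>) (W (j + 2) \<omega>)) ` {..<m + l}"
          using l by (intro order_stat_in_image) auto
        then have "0 \<le> nn_dist l (m + l) \<omega>"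
          by auto
        then show ?thesis
          using nn_dist_antimono[of l "m0 + l" "m + l" \<omega>] l that small by simp
      qed
      then show "\<exists>no. \<forall>n\<ge>no. norm (nn_dist l (n + l) \<omega> - 0) < \<delta>"
        by blast
    qed
  qed
qed

text \<open>Almost surely the distance tends to 0, and there \<open>log_ratio\<close> tends to minus
  the log density. Dominated convergence needs a square-integrable majorant that does not depend on
  \<open>m\<close>.\<close>

lemma log_ratio_error:
  assumes l: "1 \<le> l" and moment: "integrable M (\<lambda>\<omega>. norm (W 0 \<omega>) ^ 4)"
  defines "e \<equiv> \<lambda>m \<omega>. log_ratio (W 0 \<omega>) (nn_dist l m \<omega>) + ln (q (W 0 \<omega>))"
  shows "(\<lambda>m. \<integral>\<omega>. (e m \<omega>)\<^sup>2 \<partial>M) \<longlonglongrightarrow> 0"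
    and "\<And>m. l \<le> m \<Longrightarrow> integrable M (\<lambda>\<omega>. (e m \<omega>)\<^sup>2)"
proof -
  let ?K = "5 * C + real DIM('b)"
  \<comment> \<open>For m \<ge> l the distance is at most that for m = l, which is attained at one
    of the first l sample points and is therefore below the sum. The fourth moments make the square
    of \<open>h\<close> integrable.\<close>
  define h where "h \<omega> = 1 + (norm (W 0 \<omega>))\<^sup>2 + (\<Sum>j<l. norm (W 0 \<omega>) + norm (W (j + 2) \<omega>))" for \<omega>
  have e_meas: "random_variable borel (e m)" if "l \<le> m" for m
    unfolding e_def using nn_dist_measurable[OF l that] by measurable
  have K: "0 \<le> ?K"
    using C_nonneg by simp
  have h_nonneg: "0 \<le> h \<omega>" for \<omega>
    unfolding h_def by (intro add_nonneg_nonneg sum_nonneg) auto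
  have h2: "integrable M (\<lambda>\<omega>. (h \<omega>)\<^sup>2)"
  proof -
    have sq_add: "integrable M (\<lambda>\<omega>. (f \<omega> + g \<omega>)\<^sup>2)"
      if [measurable]: "random_variable borel f" "random_variable borel g" and "integrable M (\<lambda>\<omega>. (f \<omega>)\<^sup>2)" "integrable M (\<lambda>\<omega>. (g \<omega>)\<^sup>2)"
      for f g :: "'a \<Rightarrow> real"
    proof (rule Bochner_Integration.integrable_bound)
      show "integrable M (\<lambda>\<omega>. 2 * (f \<omega>)\<^sup>2 + 2 * (g \<omega>)\<^sup>2)"
        using that by simp
      have "(a + b)\<^sup>2 \<le> 2 * a\<^sup>2 + 2 * b\<^sup>2" for a b :: real
        using zero_le_power2[of "a - b"] by (simp add: power2_eq_square algebra_simps)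
      then show "AE \<omega> in M. norm ((f \<omega> + g \<omega>)\<^sup>2) \<le> norm (2 * (f \<omega>)\<^sup>2 + 2 * (g \<omega>)\<^sup>2)"
        by (intro AE_I2) simp
    qed measurable
    have sq: "integrable M (\<lambda>\<omega>. (norm (X \<omega>))\<^sup>2)" if [measurable]: "random_variable borel X" and "integrable M (\<lambda>\<omega>. norm (X \<omega>) ^ 4)"
      for X :: "'a \<Rightarrow> 'b"
    proof (rule Bochner_Integration.integrable_bound)
      show "integrable M (\<lambda>\<omega>. 1 + norm (X \<omega>) ^ 4)"
        using that by simp
      have "r\<^sup>2 \<le> 1 + r ^ 4" for r :: real
      proof -
        have "0 \<le> (r\<^sup>2 - 1)\<^sup>2" "0 \<le> r\<^sup>2"
          by simp_all
        moreover have "(r\<^sup>2 - 1)\<^sup>2 = r ^ 4 - 2 * r\<^sup>2 + 1"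
          by (simp add: power2_eq_square power4_eq_xxxx algebra_simps)
        ultimately show ?thesis
          by argo
      qed
      then show "AE \<omega> in M. norm ((norm (X \<omega>))\<^sup>2) \<le> norm (1 + norm (X \<omega>) ^ 4)"
        by (intro AE_I2) simp
    qed measurable
    have z: "integrable M (\<lambda>\<omega>. norm (W (j + 2) \<omega>) ^ 4)" for j
    proof -
      have "integrable (distr M borel (W (j + 2))) (\<lambda>x. norm x ^ 4)"
        unfolding sample_law Q_def by (rule moment4)
      then show ?thesis
        by (subst (asm) integrable_distr_eq) auto
    qed
    have w0: "integrable M (\<lambda>\<omega>. (norm (W 0 \<omega>))\<^sup>2)" and wj: "integrable M (\<lambda>\<omega>. (norm (W (j + 2) \<omega>))\<^sup>2)" for j
      by (rule sq[OF W_measurable moment], rule sq[OF W_measurable z])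
    have sums: "integrable M (\<lambda>\<omega>. (\<Sum>j<n. norm (W 0 \<omega>) + norm (W (j + 2) \<omega>))\<^sup>2)" for n
    proof (induction n)
      case (Suc n)
      have "integrable M (\<lambda>\<omega>. (norm (W 0 \<omega>) + norm (W (n + 2) \<omega>))\<^sup>2)"
        by (rule sq_add[OF _ _ w0 wj]) measurable
      then show ?case
        unfolding sum.lessThan_Suc by (intro sq_add[OF _ _ Suc.IH]) measurable
    qed simp
    show ?thesis
      unfolding h_def
    proof (intro sq_add sums)
      show "integrable M (\<lambda>\<omega>. ((norm (W 0 \<omega>))\<^sup>2)\<^sup>2)"
        using moment by simp
    qed auto
  qed
  have e_le: "AE \<omega> in M. norm ((e m \<omega>)\<^sup>2) \<le> ?K\<^sup>2 * (h \<omega>)\<^sup>2" if m: "l \<le> m" for m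
    using AE_nn_dist_pos[OF l m]
  proof eventually_elim
    case (elim \<omega>)
    have "nn_dist l l \<omega> \<in> (\<lambda>j. dist (W 0 \<omega>) (W (j + 2) \<omega>)) ` {..<l}"
      using l by (intro order_stat_in_image) auto
    then obtain j where j: "j < l" "nn_dist l l \<omega> = dist (W 0 \<omega>) (W (j + 2) \<omega>)"
      by auto
    have "nn_dist l m \<omega> \<le> norm (W 0 \<omega>) + norm (W (j + 2) \<omega>)"
      using nn_dist_antimono[of l l m \<omega>] l m j norm_triangle_ineq4[of "W 0 \<omega>" "W (j + 2) \<omega>"] by (simp add: dist_norm)
    also have "\<dots> \<le> (\<Sum>j<l. norm (W 0 \<omega>) + norm (W (j + 2) \<omega>))"
      using j by (intro member_le_sum) auto
    finally have "?K * (1 + (norm (W 0 \<omega>))\<^sup>2 + nn_dist l m \<omega>) \<le> ?K * h \<omega>"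
      unfolding h_def using K by (intro mult_left_mono add_left_mono) auto
    then have "\<bar>e m \<omega>\<bar> \<le> ?K * h \<omega>"
      unfolding e_def using log_ratio_bound[OF elim, of "W 0 \<omega>"] by linarith
    then have "\<bar>e m \<omega>\<bar>\<^sup>2 \<le> (?K * h \<omega>)\<^sup>2"
      by (intro power_mono) auto
    then show ?case
      by (simp add: power_mult_distrib)
  qed
  have dom: "integrable M (\<lambda>\<omega>. ?K\<^sup>2 * (h \<omega>)\<^sup>2)"
    using h2 by simp
  show "integrable M (\<lambda>\<omega>. (e m \<omega>)\<^sup>2)" if "l \<le> m" for m
  proof (rule Bochner_Integration.integrable_bound[OF dom])
    show "AE \<omega> in M. norm ((e m \<omega>)\<^sup>2) \<le> norm (?K\<^sup>2 * (h \<omega>)\<^sup>2)"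
      using e_le[OF that] by eventually_elim simp
  qed (use e_meas[OF that] in measurable)
  have lim: "AE \<omega> in M. (\<lambda>m. (e (m + l) \<omega>)\<^sup>2) \<longlonglongrightarrow> 0"
  proof -
    have pos: "AE \<omega> in M. \<forall>m. 0 < nn_dist l (m + l) \<omega>"
      unfolding AE_all_countable using AE_nn_dist_pos[OF l] by simp
    show ?thesis
      using AE_nn_dist_tendsto[OF l] pos
    proof eventually_elim
      case (elim \<omega>)
      have "filterlim (\<lambda>m. nn_dist l (m + l) \<omega>) (at_right 0) sequentially"
        using elim by (intro tendsto_imp_filterlim_at_right always_eventually) auto
      from filterlim_compose[OF log_ratio_tendsto this]
      have "(\<lambda>m. e (m + l) \<omega>) \<longlonglongrightarrow> - ln (q (W 0 \<omega>)) + ln (q (W 0 \<omega>))"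
        unfolding e_def by (intro tendsto_add tendsto_const)
      then have "(\<lambda>m. (e (m + l) \<omega>)\<^sup>2) \<longlonglongrightarrow> (- ln (q (W 0 \<omega>)) + ln (q (W 0 \<omega>)))\<^sup>2"
        by (rule tendsto_power)
      then show ?case
        by simp
    qed
  qed
  have "(\<lambda>m. \<integral>\<omega>. (e (m + l) \<omega>)\<^sup>2 \<partial>M) \<longlonglongrightarrow> (\<integral>\<omega>. 0 \<partial>M)"
  proof (rule integral_dominated_convergence[OF _ _ dom lim e_le])
    show "(\<lambda>\<omega>. (e (m + l) \<omega>)\<^sup>2) \<in> borel_measurable M" for m
      by (intro borel_measurable_power e_meas) simp
  qed simp_all
  then show "(\<lambda>m. \<integral>\<omega>. (e m \<omega>)\<^sup>2 \<partial>M) \<longlonglongrightarrow> 0"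
    using LIMSEQ_offset[of "\<lambda>m. \<integral>\<omega>. (e m \<omega>)\<^sup>2 \<partial>M" l 0] by simp
qed

end

section \<open>Averages of exchangeable variables\<close>

text \<open>Both families are independent with the same marginals, hence have the same product law,
  and the expectation of \<open>F\<close> depends only on that law.\<close>

lemma (in prob_space) indep_vars_reindex_law:
  fixes F :: "('i \<Rightarrow> 'b) \<Rightarrow> real"
  assumes indep: "indep_vars (\<lambda>_. N) V UNIV" and \<sigma>: "inj \<sigma>"
    and law: "\<And>i. distr M N (V (\<sigma> i)) = distr M N (V i)"
    and F: "F \<in> borel_measurable (PiM UNIV (\<lambda>_. N))"
  shows "(\<integral>\<omega>. F (\<lambda>i. V (\<sigma> i) \<omega>) \<partial>M) = (\<integral>\<omega>. F (\<lambda>i. V i \<omega>) \<partial>M)"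
    and "integrable M (\<lambda>\<omega>. F (\<lambda>i. V (\<sigma> i) \<omega>)) \<longleftrightarrow> integrable M (\<lambda>\<omega>. F (\<lambda>i. V i \<omega>))"
proof -
  have rv: "\<And>i. random_variable N (V i)"
    using indep by (auto simp: indep_vars_def2)
  have meas: "(\<lambda>\<omega> i. V (\<sigma> i) \<omega>) \<in> measurable M (PiM UNIV (\<lambda>_. N))" "(\<lambda>\<omega> i. V i \<omega>) \<in> measurable M (PiM UNIV (\<lambda>_. N))"
    using rv measurable_space[OF rv] by (auto intro!: measurable_PiM_single' simp: space_PiM PiE_iff)
  have "distr M (PiM UNIV (\<lambda>_. N)) (\<lambda>\<omega> i. V (\<sigma> i) \<omega>) = PiM UNIV (\<lambda>i. distr M N (V (\<sigma> i)))"
    using indep_vars_iff_distr_eq_PiM[where I=UNIV and M'="\<lambda>_. N" and X="\<lambda>i. V (\<sigma> i)"] indep_vars_reindex[OF indep \<sigma>] rv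
    by (simp add: restrict_UNIV)
  also have "\<dots> = PiM UNIV (\<lambda>i. distr M N (V i))"
    by (simp only: law)
  also have "\<dots> = distr M (PiM UNIV (\<lambda>_. N)) (\<lambda>\<omega> i. V i \<omega>)"
    using indep_vars_iff_distr_eq_PiM[where I=UNIV and M'="\<lambda>_. N" and X=V] indep rv by (simp add: restrict_UNIV)
  finally have eq: "distr M (PiM UNIV (\<lambda>_. N)) (\<lambda>\<omega> i. V (\<sigma> i) \<omega>) = distr M (PiM UNIV (\<lambda>_. N)) (\<lambda>\<omega> i. V i \<omega>)" .
  show "(\<integral>\<omega>. F (\<lambda>i. V (\<sigma> i) \<omega>) \<partial>M) = (\<integral>\<omega>. F (\<lambda>i. V i \<omega>) \<partial>M)"
    using integral_distr[OF meas(1) F] integral_distr[OF meas(2) F] eq by simp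
  show "integrable M (\<lambda>\<omega>. F (\<lambda>i. V (\<sigma> i) \<omega>)) \<longleftrightarrow> integrable M (\<lambda>\<omega>. F (\<lambda>i. V i \<omega>))"
    using integrable_distr_eq[OF meas(1) F] integrable_distr_eq[OF meas(2) F] eq by simp
qed

text \<open>Two bounds for two situations: the mean of the squares serves when each
  \<open>G i\<close> is small in mean square; the expansion into n diagonal and n (n - 1)
  off-diagonal terms serves when only the cross moments are small.\<close>

lemma (in prob_space) average_square_le:
  fixes G :: "nat \<Rightarrow> 'a \<Rightarrow> real"
  assumes n: "2 \<le> n" and rv: "\<And>i. i < n \<Longrightarrow> random_variable borel (G i)"
    and int: "\<And>i. i < n \<Longrightarrow> integrable M (\<lambda>\<omega>. (G i \<omega>)\<^sup>2)"
    and A: "\<And>i. i < n \<Longrightarrow> (\<integral>\<omega>. (G i \<omega>)\<^sup>2 \<partial>M) = A"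
    and B: "\<And>i j. i < n \<Longrightarrow> j < n \<Longrightarrow> i \<noteq> j \<Longrightarrow> (\<integral>\<omega>. G i \<omega> * G j \<omega> \<partial>M) = B"
  defines "S \<equiv> \<lambda>\<omega>. (1 / real n * (\<Sum>i<n. G i \<omega>))\<^sup>2"
  shows "integrable M S" and "(\<integral>\<omega>. S \<omega> \<partial>M) \<le> A" and "(\<integral>\<omega>. S \<omega> \<partial>M) \<le> A / real n + \<bar>B\<bar>"
proof -
  have n0: "0 < real n"
    using n by simp
  have int2: "integrable M (\<lambda>\<omega>. G i \<omega> * G j \<omega>)" if "i < n" "j < n" for i j
  proof (rule Bochner_Integration.integrable_bound)
    show "integrable M (\<lambda>\<omega>. (G i \<omega>)\<^sup>2 + (G j \<omega>)\<^sup>2)"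
      using int that by simp
    show "(\<lambda>\<omega>. G i \<omega> * G j \<omega>) \<in> borel_measurable M"
      using rv that by simp
    have "\<bar>x * y\<bar> \<le> x\<^sup>2 + y\<^sup>2" for x y :: real
    proof -
      have "0 \<le> \<bar>x\<bar> * \<bar>y\<bar>" "2 * (\<bar>x\<bar> * \<bar>y\<bar>) \<le> x\<^sup>2 + y\<^sup>2"
        using sum_squares_bound[of "\<bar>x\<bar>" "\<bar>y\<bar>"] by simp_all
      then show ?thesis
        unfolding abs_mult by argo
    qed
    then show "AE \<omega> in M. norm (G i \<omega> * G j \<omega>) \<le> norm ((G i \<omega>)\<^sup>2 + (G j \<omega>)\<^sup>2)"
      by (intro AE_I2) simp
  qed
  have eq: "S \<omega> = (1 / (real n)\<^sup>2) * (\<Sum>i<n. \<Sum>j<n. G i \<omega> * G j \<omega>)" for \<omega>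
  proof -
    have "(\<Sum>i<n. G i \<omega>)\<^sup>2 = (\<Sum>i<n. \<Sum>j<n. G i \<omega> * G j \<omega>)"
      by (simp add: power2_eq_square sum_product)
    then show ?thesis
      by (simp add: S_def power_divide)
  qed
  have I: "integrable M (\<lambda>\<omega>. \<Sum>i<n. \<Sum>j<n. G i \<omega> * G j \<omega>)"
    using int2 by (intro Bochner_Integration.integrable_sum) auto
  show S: "integrable M S"
    unfolding eq[abs_def] using I by (rule integrable_mult_right)
  have "(\<integral>\<omega>. (\<Sum>i<n. \<Sum>j<n. G i \<omega> * G j \<omega>) \<partial>M) = (\<Sum>i<n. \<Sum>j<n. \<integral>\<omega>. G i \<omega> * G j \<omega> \<partial>M)"
  proof -
    have "(\<integral>\<omega>. (\<Sum>i<n. \<Sum>j<n. G i \<omega> * G j \<omega>) \<partial>M) = (\<Sum>i<n. \<integral>\<omega>. (\<Sum>j<n. G i \<omega> * G j \<omega>) \<partial>M)"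
      using int2 by (intro Bochner_Integration.integral_sum Bochner_Integration.integrable_sum) auto
    also have "\<dots> = (\<Sum>i<n. \<Sum>j<n. \<integral>\<omega>. G i \<omega> * G j \<omega> \<partial>M)"
      using int2 by (intro sum.cong refl Bochner_Integration.integral_sum) auto
    finally show ?thesis .
  qed
  also have "\<dots> = (\<Sum>i<n. \<Sum>j<n. if j = i then A else B)"
    using A B by (intro sum.cong refl) (auto simp: power2_eq_square)
  also have "\<dots> = (\<Sum>i<n. A + (real n - 1) * B)"
  proof (rule sum.cong[OF refl])
    fix i assume "i \<in> {..<n}"
    then have "(\<Sum>j<n. if j = i then A else B) = A + (\<Sum>j\<in>{..<n} - {i}. B)"
      by (subst sum.remove[of _ i]) auto
    then show "(\<Sum>j<n. if j = i then A else B) = A + (real n - 1) * B"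
      using \<open>i \<in> {..<n}\<close> n by (simp add: of_nat_diff)
  qed
  finally have "(\<integral>\<omega>. S \<omega> \<partial>M) = 1 / (real n)\<^sup>2 * (real n * (A + (real n - 1) * B))"
    unfolding eq by simp
  also have "\<dots> = A / real n + (real n - 1) / real n * B"
    using n0 by (simp add: field_simps power2_eq_square)
  also have "\<dots> \<le> A / real n + \<bar>B\<bar>"
  proof -
    have "(real n - 1) / real n * B \<le> (real n - 1) / real n * \<bar>B\<bar>"
      using n0 n by (intro mult_left_mono) auto
    also have "\<dots> \<le> 1 * \<bar>B\<bar>"
      using n0 by (intro mult_right_mono) auto
    finally show ?thesis by simp
  qed
  finally show "(\<integral>\<omega>. S \<omega> \<partial>M) \<le> A / real n + \<bar>B\<bar>" .
  have "S \<omega> \<le> 1 / real n * (\<Sum>i<n. (G i \<omega>)\<^sup>2)" for \<omega>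
  proof -
    have "(\<Sum>i<n. G i \<omega>)\<^sup>2 \<le> (\<Sum>i<n. (G i \<omega>)\<^sup>2) * real n"
      using sum_squared_le_sum_of_squares[of "\<lambda>i. G i \<omega>" "{..<n}"] by simp
    then have "1 / (real n)\<^sup>2 * (\<Sum>i<n. G i \<omega>)\<^sup>2 \<le> 1 / (real n)\<^sup>2 * ((\<Sum>i<n. (G i \<omega>)\<^sup>2) * real n)"
      by (intro mult_left_mono) auto
    then show ?thesis
      using n0 by (simp add: S_def power_divide power2_eq_square[of "real n"])
  qed
  then have "(\<integral>\<omega>. S \<omega> \<partial>M) \<le> (\<integral>\<omega>. 1 / real n * (\<Sum>i<n. (G i \<omega>)\<^sup>2) \<partial>M)"
    using int by (intro integral_mono S integrable_mult_right Bochner_Integration.integrable_sum) auto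
  also have "\<dots> = 1 / real n * (\<Sum>i<n. \<integral>\<omega>. (G i \<omega>)\<^sup>2 \<partial>M)"
    using int by (subst integral_mult_right_zero, subst Bochner_Integration.integral_sum) auto
  also have "\<dots> = A"
    using A n0 by simp
  finally show "(\<integral>\<omega>. S \<omega> \<partial>M) \<le> A" .
qed

lemma permutation_two_points:
  fixes n :: nat
  assumes "2 \<le> n" "i < n" "j < n" "i \<noteq> j"
  obtains \<pi> where "\<pi> permutes {..<n}" "\<pi> 0 = i" "\<pi> 1 = j"
proof -
  \<comment> \<open>\<open>c\<close> is the point that the swap of 0 and i sends to
    \<open>j\<close>. It is not 0 because i and j differ, so swapping 1 with \<open>c\<close> first
    leaves 0 in place.\<close>
  define c where "c = Transposition.transpose 0 i j"
  let ?\<pi> = "Transposition.transpose 0 i \<circ> Transposition.transpose 1 c"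
  have c: "c < n" "c \<noteq> 0"
    using assms by (auto simp: c_def Transposition.transpose_def)
  have "?\<pi> permutes {..<n}"
    using assms c by (intro permutes_compose permutes_swap_id) auto
  moreover have "?\<pi> 0 = i" "?\<pi> 1 = j"
  proof -
    have "Transposition.transpose 1 c 0 = 0" "Transposition.transpose 1 c 1 = c"
      using c by (auto simp: Transposition.transpose_def)
    then show "?\<pi> 0 = i" "?\<pi> 1 = j"
      by (simp_all add: c_def)
  qed
  ultimately show thesis
    by (rule that)
qed

lemma order_stat_permute_lessThan:
  assumes "\<pi> permutes {..<n}" "i < n"
  shows "order_stat k (\<lambda>j. f (\<pi> j)) ({..<n} - {i}) = order_stat k f ({..<n} - {\<pi> i})"
proof -
  have "\<pi> ` ({..<n} - {i}) = {..<n} - {\<pi> i}"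
    using assms permutes_inj[OF assms(1)] by (simp add: image_set_diff permutes_image)
  then show ?thesis
    using order_stat_reindex[of \<pi> "{..<n} - {i}" k f] permutes_inj[OF assms(1)] by (simp add: inj_on_def inj_def)
qed

text \<open>Each \<open>\<Phi> i\<close> reads both samples through the index type
  \<open>nat + nat\<close>. Permuting the X-indices preserves the joint law and carries
  \<open>\<Phi> i\<close> to \<open>\<Phi> (\<pi> i)\<close>, so all second moments reduce to those
  of the query points 0 and 1.\<close>

lemma (in prob_space) exchangeable_average:
  fixes \<Phi> :: "nat \<Rightarrow> (nat + nat \<Rightarrow> 'b) \<Rightarrow> real"
  assumes indep: "indep_vars (\<lambda>_. N) (case_sum X Y) UNIV"
    and law: "\<And>i. distr M N (X i) = distr M N (X 0)"
    and n: "2 \<le> n" and meas: "\<And>i. i < n \<Longrightarrow> \<Phi> i \<in> borel_measurable (PiM UNIV (\<lambda>_. N))"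
    and equivariant: "\<And>\<pi> i w. \<pi> permutes {..<n} \<Longrightarrow> i < n \<Longrightarrow> \<Phi> i (\<lambda>c. w (map_sum \<pi> id c)) = \<Phi> (\<pi> i) w"
  defines "G \<equiv> \<lambda>i \<omega>. \<Phi> i (\<lambda>c. case_sum X Y c \<omega>)"
  assumes int: "integrable M (\<lambda>\<omega>. (G 0 \<omega>)\<^sup>2)"
  defines "S \<equiv> \<lambda>\<omega>. (1 / real n * (\<Sum>i<n. G i \<omega>))\<^sup>2"
  shows "integrable M S" "(\<integral>\<omega>. S \<omega> \<partial>M) \<le> (\<integral>\<omega>. (G 0 \<omega>)\<^sup>2 \<partial>M)"
    "(\<integral>\<omega>. S \<omega> \<partial>M) \<le> (\<integral>\<omega>. (G 0 \<omega>)\<^sup>2 \<partial>M) / real n + \<bar>\<integral>\<omega>. G 0 \<omega> * G 1 \<omega> \<partial>M\<bar>"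
    and "\<And>i. i < n \<Longrightarrow> random_variable borel (G i)"
proof -
  let ?V = "case_sum X Y"
  have rvV: "\<And>i. random_variable N (?V i)"
    using indep by (auto simp: indep_vars_def2)
  have Vmeas: "(\<lambda>\<omega> i. ?V i \<omega>) \<in> measurable M (PiM UNIV (\<lambda>_. N))"
    using rvV measurable_space[OF rvV] by (intro measurable_PiM_single') (auto simp: space_PiM PiE_iff)
  show rv: "random_variable borel (G i)" if "i < n" for i
    unfolding G_def by (rule measurable_compose[OF Vmeas meas[OF that]])
  have n01: "0 < n" "1 < n"
    using n by auto
  {
    fix \<pi> assume \<pi>: "\<pi> permutes {..<n}"
    let ?\<sigma> = "map_sum \<pi> (id :: nat \<Rightarrow> nat)"
    have inj: "inj ?\<sigma>"
      using permutes_inj[OF \<pi>] by (auto intro!: sum.inj_map)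
    have law\<sigma>: "distr M N (?V (?\<sigma> c)) = distr M N (?V c)" for c
    proof (cases c)
      case (Inl a)
      then show ?thesis
        using law[of a] law[of "\<pi> a"] by simp
    qed simp
    have eq: "\<Phi> i (\<lambda>c. ?V (?\<sigma> c) \<omega>) = G (\<pi> i) \<omega>" if "i < n" for i \<omega>
      using equivariant[OF \<pi> that, of "\<lambda>c. ?V c \<omega>"] by (simp add: G_def)
    have "(\<lambda>w. (\<Phi> 0 w)\<^sup>2) \<in> borel_measurable (PiM UNIV (\<lambda>_. N))" "(\<lambda>w. \<Phi> 0 w * \<Phi> 1 w) \<in> borel_measurable (PiM UNIV (\<lambda>_. N))"
      using meas n01 by simp_all
    note L = indep_vars_reindex_law[OF indep inj law\<sigma> this(1)] indep_vars_reindex_law(1)[OF indep inj law\<sigma> this(2)]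
    have "(\<integral>\<omega>. (G (\<pi> 0) \<omega>)\<^sup>2 \<partial>M) = (\<integral>\<omega>. (G 0 \<omega>)\<^sup>2 \<partial>M)"
      "integrable M (\<lambda>\<omega>. (G (\<pi> 0) \<omega>)\<^sup>2)"
      "(\<integral>\<omega>. G (\<pi> 0) \<omega> * G (\<pi> 1) \<omega> \<partial>M) = (\<integral>\<omega>. G 0 \<omega> * G 1 \<omega> \<partial>M)"
      using L int unfolding eq[OF n01(1)] eq[OF n01(2)] by (simp_all add: G_def)
  } note perm = this
  have sq: "(\<integral>\<omega>. (G i \<omega>)\<^sup>2 \<partial>M) = (\<integral>\<omega>. (G 0 \<omega>)\<^sup>2 \<partial>M)" "integrable M (\<lambda>\<omega>. (G i \<omega>)\<^sup>2)" if i: "i < n" for i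
  proof -
    obtain j where "j < n" "i \<noteq> j"
      using n by (metis n01 zero_neq_one)
    then obtain \<pi> where "\<pi> permutes {..<n}" "\<pi> 0 = i"
      using permutation_two_points[OF n i] by metis
    then show "(\<integral>\<omega>. (G i \<omega>)\<^sup>2 \<partial>M) = (\<integral>\<omega>. (G 0 \<omega>)\<^sup>2 \<partial>M)" "integrable M (\<lambda>\<omega>. (G i \<omega>)\<^sup>2)"
      using perm by blast+
  qed
  have prod: "(\<integral>\<omega>. G i \<omega> * G j \<omega> \<partial>M) = (\<integral>\<omega>. G 0 \<omega> * G 1 \<omega> \<partial>M)" if "i < n" "j < n" "i \<noteq> j" for i j
    using permutation_two_points[OF n that] perm(3) by metis
  show "integrable M S" "(\<integral>\<omega>. S \<omega> \<partial>M) \<le> (\<integral>\<omega>. (G 0 \<omega>)\<^sup>2 \<partial>M)"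
    "(\<integral>\<omega>. S \<omega> \<partial>M) \<le> (\<integral>\<omega>. (G 0 \<omega>)\<^sup>2 \<partial>M) / real n + \<bar>\<integral>\<omega>. G 0 \<omega> * G 1 \<omega> \<partial>M\<bar>"
    unfolding S_def by (rule average_square_le[OF n rv sq(2,1) prod]; assumption)+
qed

section \<open>Two independent samples\<close>

text \<open>Increasing enumeration of the naturals other than \<open>i\<close>: the sample without
  its \<open>i\<close>-th point, renumbered from 0, fits the locale
  \<open>nn_sample\<close>.\<close>

definition skip :: "nat \<Rightarrow> nat \<Rightarrow> nat" where
  "skip i j = (if j < i then j else Suc j)"

lemma skip_neq: "skip i j \<noteq> i" "i \<noteq> skip i j"
  by (auto simp: skip_def)

lemma inj_skip: "inj (skip i)"
  by (auto simp: skip_def inj_def split: if_splits)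

lemma image_skip:
  assumes "i < n"
  shows "skip i ` {..<n - 1} = {..<n} - {i}"
proof (intro equalityI subsetI)
  fix j assume "j \<in> {..<n} - {i}"
  then have "j = skip i (if j < i then j else j - 1)" "(if j < i then j else j - 1) \<in> {..<n - 1}"
    using assms by (auto simp: skip_def)
  then show "j \<in> skip i ` {..<n - 1}"
    by blast
qed (use assms in \<open>auto simp: skip_def split: if_splits\<close>)

locale two_samples = prob_space M + p: tame_density p Cp + q: tame_density q Cq
  for M :: "'a measure" and p q :: "'b::euclidean_space \<Rightarrow> real" and Cp Cq +
  fixes X Y :: "nat \<Rightarrow> 'a \<Rightarrow> 'b"
  assumes indep: "indep_vars (\<lambda>_. borel) (case_sum X Y) UNIV"
    and law_X: "\<And>i. distr M borel (X i) = p.Q"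
    and law_Y: "\<And>j. distr M borel (Y j) = q.Q"
begin

lemma X_measurable[measurable]: "random_variable borel (X i)"
  and Y_measurable[measurable]: "random_variable borel (Y j)"
  using indep by (auto simp: indep_vars_def2 split: sum.split)
    (metis sum.case UNIV_I)+

text \<open>The index 1 of a family is the second query point, which is not used for these two families.\<close>

definition index_X :: "nat \<Rightarrow> nat \<Rightarrow> nat + nat" where
  "index_X i j = (if j = 0 then Inl i else if j = 1 then Inr 0 else Inl (skip i (j - 2)))"

definition index_Y :: "nat \<Rightarrow> nat \<Rightarrow> nat + nat" where
  "index_Y i j = (if j = 0 then Inl i else if j = 1 then Inl (Suc i) else Inr (j - 2))"

lemma nn_sample_X: "nn_sample M p Cp (\<lambda>j. case_sum X Y (index_X i j))"
proof (intro nn_sample.intro nn_sample_axioms.intro)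
  have "inj (index_X i)"
  proof (rule injI)
    fix a b assume "index_X i a = index_X i b"
    then show "a = b"
      using inj_eq[OF inj_skip[of i]] by (auto simp: index_X_def skip_neq split: if_split_asm)
  qed
  then show "indep_vars (\<lambda>_. borel) (\<lambda>j. case_sum X Y (index_X i j)) UNIV"
    by (rule indep_vars_reindex[OF indep])
qed (auto simp: index_X_def law_X prob_space_axioms p.tame_density_axioms)

lemma nn_sample_Y: "nn_sample M q Cq (\<lambda>j. case_sum X Y (index_Y i j))"
proof (intro nn_sample.intro nn_sample_axioms.intro)
  have "inj (index_Y i)"
    by (rule injI) (auto simp: index_Y_def split: if_splits)
  then show "indep_vars (\<lambda>_. borel) (\<lambda>j. case_sum X Y (index_Y i j)) UNIV"
    by (rule indep_vars_reindex[OF indep])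
qed (auto simp: index_Y_def law_Y prob_space_axioms q.tame_density_axioms)

text \<open>Here \<open>X 0\<close> and \<open>X 1\<close> are the query points and the sample
  starts at \<open>X 2\<close>: the situation of the cross moment once both query points are removed
  from the candidates.\<close>

lemma nn_sample_X_only: "nn_sample M p Cp X"
proof (intro nn_sample.intro nn_sample_axioms.intro)
  show "indep_vars (\<lambda>_. borel) X UNIV"
    using indep_vars_reindex[OF indep, of Inl] by simp
qed (auto simp: law_X prob_space_axioms p.tame_density_axioms)

definition rank_Y :: "nat \<Rightarrow> nat \<Rightarrow> nat \<Rightarrow> 'a \<Rightarrow> real" where
  "rank_Y l m i \<omega> = order_stat l (\<lambda>j. q.score (X i \<omega>) (Y j \<omega>)) {..<m}"

definition rank_X :: "nat \<Rightarrow> nat \<Rightarrow> nat \<Rightarrow> 'a \<Rightarrow> real" where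
  "rank_X k n i \<omega> = order_stat k (\<lambda>j. p.score (X i \<omega>) (X j \<omega>)) ({..<n} - {i})"

definition dist_Y :: "nat \<Rightarrow> nat \<Rightarrow> nat \<Rightarrow> 'a \<Rightarrow> real" where
  "dist_Y l m i \<omega> = order_stat l (\<lambda>j. dist (X i \<omega>) (Y j \<omega>)) {..<m}"

definition dist_X :: "nat \<Rightarrow> nat \<Rightarrow> nat \<Rightarrow> 'a \<Rightarrow> real" where
  "dist_X k n i \<omega> = order_stat k (\<lambda>j. dist (X i \<omega>) (X j \<omega>)) ({..<n} - {i})"

lemma order_stat_skip:
  "i < n \<Longrightarrow> order_stat k f ({..<n} - {i}) = order_stat k (\<lambda>j. f (skip i j)) {..<n - 1}"
  using order_stat_reindex[OF inj_on_subset[OF inj_skip[of i] subset_UNIV], of k f "{..<n - 1}"]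
  by (simp only: image_skip)

lemma uniform_rank_Y: "1 \<le> l \<Longrightarrow> l \<le> m \<Longrightarrow> uniform_order_stat l m (rank_Y l m i)"
  using nn_sample.uniform_order_stat_score[OF nn_sample_Y[of i], of l m 0]
  unfolding rank_Y_def[abs_def] by (simp add: index_Y_def)

lemma uniform_rank_X: "1 \<le> k \<Longrightarrow> k \<le> n - 1 \<Longrightarrow> i < n \<Longrightarrow> uniform_order_stat k (n - 1) (rank_X k n i)"
  using nn_sample.uniform_order_stat_score[OF nn_sample_X[of i], of k "n - 1" 0]
  unfolding rank_X_def[abs_def] by (simp add: index_X_def order_stat_skip)

lemma dist_Y_pos: "1 \<le> l \<Longrightarrow> l \<le> m \<Longrightarrow> AE \<omega> in M. 0 < dist_Y l m i \<omega>"
  using nn_sample.AE_nn_dist_pos[OF nn_sample_Y[of i], of l m] by (simp add: index_Y_def dist_Y_def)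

lemma dist_X_pos: "1 \<le> k \<Longrightarrow> k \<le> n - 1 \<Longrightarrow> i < n \<Longrightarrow> AE \<omega> in M. 0 < dist_X k n i \<omega>"
  using nn_sample.AE_nn_dist_pos[OF nn_sample_X[of i], of k "n - 1"]
  by (simp add: index_X_def dist_X_def order_stat_skip)

lemma ball_prob_dist_Y: "1 \<le> l \<Longrightarrow> l \<le> m \<Longrightarrow> q.ball_prob (X i \<omega>) (dist_Y l m i \<omega>) = rank_Y l m i \<omega>"
  using nn_sample.ball_prob_nn_dist[OF nn_sample_Y[of i], of l m \<omega>]
  by (simp add: index_Y_def dist_Y_def rank_Y_def)

lemma ball_prob_dist_X:
  "1 \<le> k \<Longrightarrow> k \<le> n - 1 \<Longrightarrow> i < n \<Longrightarrow> p.ball_prob (X i \<omega>) (dist_X k n i \<omega>) = rank_X k n i \<omega>"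
  using nn_sample.ball_prob_nn_dist[OF nn_sample_X[of i], of k "n - 1" \<omega>]
  by (simp add: index_X_def dist_X_def rank_X_def order_stat_skip)

lemma X_moment: "integrable M (\<lambda>\<omega>. norm (X i \<omega>) ^ 4)"
proof -
  have "integrable (distr M borel (X i)) (\<lambda>x. norm x ^ 4)"
    unfolding law_X p.Q_def by (rule p.moment4)
  then show ?thesis
    by (subst (asm) integrable_distr_eq) auto
qed

text \<open>With two points and k = 1 the rank of one point is the score of the other, so its law is
  that of one uniform variable.\<close>

lemma prob_score_X:
  assumes u: "0 \<le> u" "u \<le> 1"
  shows "prob {\<omega>\<in>space M. p.score (X 0 \<omega>) (X 1 \<omega>) \<le> u} = u" "prob {\<omega>\<in>space M. p.score (X 1 \<omega>) (X 0 \<omega>) \<le> u} = u"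
proof -
  have le: "prob {\<omega>\<in>space M. rank_X 1 2 i \<omega> \<le> u} = u" if "i < 2" for i
  proof -
    have U: "uniform_order_stat 1 1 (rank_X 1 2 i)"
      using uniform_rank_X[of 1 2 i] that by simp
    then have [measurable]: "random_variable borel (rank_X 1 2 i)"
      unfolding uniform_order_stat_def by blast
    have "{\<omega>\<in>space M. u < rank_X 1 2 i \<omega>} \<in> events"
      by measurable
    moreover have "{\<omega>\<in>space M. rank_X 1 2 i \<omega> \<le> u} = space M - {\<omega>\<in>space M. u < rank_X 1 2 i \<omega>}"
      by auto
    ultimately have "prob {\<omega>\<in>space M. rank_X 1 2 i \<omega> \<le> u} = 1 - prob {\<omega>\<in>space M. u < rank_X 1 2 i \<omega>}"
      by (simp only: prob_compl)
    then show ?thesis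
      using U u by (simp add: uniform_order_stat_def multinomial_cdf_0)
  qed
  have single: "order_stat 1 f {j} = f j" for f :: "nat \<Rightarrow> real" and j
    using order_stat_in_image[of "{j}" 1 f] by simp
  have "{..<2} - {0} = {1::nat}" "{..<2} - {1} = {0::nat}"
    by auto
  then have "rank_X 1 2 0 \<omega> = p.score (X 0 \<omega>) (X 1 \<omega>)" "rank_X 1 2 1 \<omega> = p.score (X 1 \<omega>) (X 0 \<omega>)" for \<omega>
    unfolding rank_X_def by (simp_all only: single)
  then show "prob {\<omega>\<in>space M. p.score (X 0 \<omega>) (X 1 \<omega>) \<le> u} = u" "prob {\<omega>\<in>space M. p.score (X 1 \<omega>) (X 0 \<omega>) \<le> u} = u"
    using le[of 0] le[of 1] by simp_all
qed

text \<open>Coinciding points have score 0, an event of probability 0.\<close>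

lemma AE_X_neq: "AE \<omega> in M. X 0 \<omega> \<noteq> X 1 \<omega>"
proof -
  have "prob {\<omega>\<in>space M. p.score (X 0 \<omega>) (X 1 \<omega>) \<le> 0} = 0"
    by (rule prob_score_X) auto
  then have "AE \<omega> in M. \<not> p.score (X 0 \<omega>) (X 1 \<omega>) \<le> 0"
    by (subst AE_iff_measurable[OF _ refl]) (auto simp: emeasure_eq_measure)
  then show ?thesis
    by eventually_elim (auto simp: p.score_self)
qed

lemma tendsto_exp_div: "(\<lambda>m. exp s / real m) \<longlonglongrightarrow> 0" "(\<lambda>m. real m * (exp s / real m)) \<longlonglongrightarrow> exp s"
  by real_asymp+

lemma joint_rank_Y:
  assumes l: "1 \<le> l"
  shows "(\<lambda>m. prob {\<omega>\<in>space M. exp s / real m < rank_Y l m 0 \<omega> \<and> exp t / real m < rank_Y l m 1 \<omega>})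
      \<longlonglongrightarrow> poisson_cdf l (exp s) * poisson_cdf l (exp t)"
proof -
  \<comment> \<open>With \<open>index_Y 0\<close> the query points are \<open>X 0\<close> and
    \<open>X 1\<close>, and the sample consists of the Y's.\<close>
  interpret Y: nn_sample M q Cq "\<lambda>j. case_sum X Y (index_Y 0 j)"
    by (rule nn_sample_Y)
  have "(\<lambda>m. prob {\<omega>\<in>space M. card {j\<in>{..<m}. q.score (X 0 \<omega>) (Y j \<omega>) \<le> exp s / real m} < l \<and>
      card {j\<in>{..<m}. q.score (X 1 \<omega>) (Y j \<omega>) \<le> exp t / real m} < l}) \<longlonglongrightarrow> poisson_cdf l (exp s) * poisson_cdf l (exp t)"
    using Y.joint_count_tendsto[of "\<lambda>m. m" "\<lambda>m. exp s / real m" "exp s" "\<lambda>m. exp t / real m" "exp t" l]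
      AE_X_neq tendsto_exp_div by (simp add: index_Y_def filterlim_ident)
  moreover have "\<forall>\<^sub>F m in sequentially. l \<le> m"
    by (rule eventually_ge_at_top)
  then have "\<forall>\<^sub>F m in sequentially.
      prob {\<omega>\<in>space M. card {j\<in>{..<m}. q.score (X 0 \<omega>) (Y j \<omega>) \<le> exp s / real m} < l \<and>
        card {j\<in>{..<m}. q.score (X 1 \<omega>) (Y j \<omega>) \<le> exp t / real m} < l} =
      prob {\<omega>\<in>space M. exp s / real m < rank_Y l m 0 \<omega> \<and> exp t / real m < rank_Y l m 1 \<omega>}"
  proof eventually_elim
    case (elim m)
    then have "u < rank_Y l m i \<omega> \<longleftrightarrow> card {j\<in>{..<m}. q.score (X i \<omega>) (Y j \<omega>) \<le> u} < l" for u i \<omega>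
      unfolding rank_Y_def using l by (intro order_stat_gt_iff) auto
    then show ?case
      by (simp only:)
  qed
  ultimately show ?thesis
    by (rule Lim_transform_eventually)
qed

lemma abs_prob_diff_le:
  assumes "A \<in> events" "B \<in> events" "C \<in> events" "D \<in> events"
    and "A \<subseteq> B \<union> (C \<union> D)" "B \<subseteq> A \<union> (C \<union> D)"
  shows "\<bar>prob A - prob B\<bar> \<le> prob C + prob D"
proof -
  have "prob A \<le> prob B + (prob C + prob D)" "prob B \<le> prob A + (prob C + prob D)"
    using assms finite_measure_mono[of A "B \<union> (C \<union> D)"] finite_measure_mono[of B "A \<union> (C \<union> D)"]
      measure_Un_le[of B M "C \<union> D"] measure_Un_le[of A M "C \<union> D"] measure_Un_le[of C M D]
    by simp_all
  then show ?thesis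
    by simp
qed

text \<open>Dropping each of the two query points from the neighbours of the other one changes the
  event only if one of them is among the nearest neighbours of the other.\<close>

lemma joint_rank_X:
  assumes k: "1 \<le> k"
  shows "(\<lambda>m. prob {\<omega>\<in>space M. exp s / real m < rank_X k (Suc m) 0 \<omega> \<and> exp t / real m < rank_X k (Suc m) 1 \<omega>})
      \<longlonglongrightarrow> poisson_cdf k (exp s) * poisson_cdf k (exp t)"
proof -
  interpret X: nn_sample M p Cp X
    by (rule nn_sample_X_only)
  define A where "A m = {\<omega>\<in>space M. exp s / real m < rank_X k (Suc m) 0 \<omega> \<and> exp t / real m < rank_X k (Suc m) 1 \<omega>}" for m
  \<comment> \<open>Both query points are left out: of the \<open>m\<close> candidates of each query
    point, \<open>m - 1\<close> remain.\<close>
  define B where "B m = {\<omega>\<in>space M. X.count (X 0 \<omega>) (m - 1) (exp s / real m) \<omega> < k \<and> X.count (X 1 \<omega>) (m - 1) (exp t / real m) \<omega> < k}" for m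
  have lim: "(\<lambda>m. prob (B m)) \<longlonglongrightarrow> poisson_cdf k (exp s) * poisson_cdf k (exp t)"
    unfolding B_def
    by (rule X.joint_count_tendsto[OF AE_X_neq filterlim_minus_const_nat_at_top
          _ tendsto_exp_div(1) tendsto_of_nat_diff_mult[OF tendsto_exp_div(1) filterlim_ident tendsto_exp_div(2)]
          _ tendsto_exp_div(1) tendsto_of_nat_diff_mult[OF tendsto_exp_div(1) filterlim_ident tendsto_exp_div(2)]]) auto
  have close: "\<forall>\<^sub>F m in sequentially. \<bar>prob (A m) - prob (B m)\<bar> \<le> exp s / real m + exp t / real m"
  proof -
    have "\<forall>\<^sub>F m in sequentially. exp s / real m < 1 \<and> exp t / real m < 1 \<and> max k 2 \<le> m"
      by (intro eventually_conj order_tendstoD(2)[OF tendsto_exp_div(1)] eventually_ge_at_top) auto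
    then show ?thesis
    proof eventually_elim
      case (elim m)
      let ?u = "exp s / real m" and ?v = "exp t / real m"
      have m: "0 < real m" "1 \<le> m" "k \<le> m" "2 \<le> m"
        using elim by auto
      \<comment> \<open>For i < 2, \<open>1 - i\<close> is the other query point. If it is not
        counted, all counted indices are at least 2.\<close>
      have decomp: "{j\<in>{..<Suc m} - {i}. P j} = (\<lambda>j. j + 2) ` {j\<in>{..<m - 1}. P (j + 2)}"
        if "i < 2" "\<not> P (1 - i)" for P :: "nat \<Rightarrow> bool" and i
      proof (intro equalityI subsetI)
        fix j assume j: "j \<in> {j\<in>{..<Suc m} - {i}. P j}"
        then have "2 \<le> j"
          using that by (cases "j = 0"; cases "j = 1") (auto simp: less_2_cases_iff)
        then obtain d where "j = d + 2"
          by (metis add.commute le_Suc_ex)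
        then show "j \<in> (\<lambda>j. j + 2) ` {j\<in>{..<m - 1}. P (j + 2)}"
          using j by auto
      qed (use that in auto)
      have cards: "card {j\<in>{..<Suc m} - {i}. P j} = card {j\<in>{..<m - 1}. P (j + 2)}"
        if "i < 2" "\<not> P (1 - i)" for P :: "nat \<Rightarrow> bool" and i
        unfolding decomp[of i P, OF that] by (rule card_image) (simp add: inj_on_def)
      have gt: "u < rank_X k (Suc m) i \<omega> \<longleftrightarrow> card {j\<in>{..<Suc m} - {i}. p.score (X i \<omega>) (X j \<omega>) \<le> u} < k"
        if "i < 2" for u i \<omega>
        unfolding rank_X_def using k m that by (intro order_stat_gt_iff) auto
      have same: "\<omega> \<in> A m \<longleftrightarrow> \<omega> \<in> B m"
        if "\<omega> \<in> space M" "\<not> p.score (X 0 \<omega>) (X 1 \<omega>) \<le> ?u" "\<not> p.score (X 1 \<omega>) (X 0 \<omega>) \<le> ?v" for \<omega>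
        using that cards[of 0 "\<lambda>j. p.score (X 0 \<omega>) (X j \<omega>) \<le> ?u"] cards[of 1 "\<lambda>j. p.score (X 1 \<omega>) (X j \<omega>) \<le> ?v"]
        unfolding A_def B_def by (simp add: gt)
      have [measurable]: "random_variable borel (rank_X k (Suc m) i)" if "i < 2" for i
        using uniform_rank_X[of k "Suc m" i] k m that by (simp add: uniform_order_stat_def)
      have "\<bar>prob (A m) - prob (B m)\<bar> \<le> prob {\<omega>\<in>space M. p.score (X 0 \<omega>) (X 1 \<omega>) \<le> ?u} + prob {\<omega>\<in>space M. p.score (X 1 \<omega>) (X 0 \<omega>) \<le> ?v}"
      proof (rule abs_prob_diff_le)
        have r: "random_variable borel (rank_X k (Suc m) 0)" "random_variable borel (rank_X k (Suc m) 1)"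
          by (auto intro!: \<open>\<And>i. i < 2 \<Longrightarrow> random_variable borel (rank_X k (Suc m) i)\<close>)
        show "A m \<in> events"
          unfolding A_def using r by measurable
        have "{\<omega>\<in>space M. X.count (X i \<omega>) (m - 1) u \<omega> < k} \<in> events" for i u
          by (rule sets_Collect_card_less) measurable
        from sets.Int[OF this[of 0 ?u] this[of 1 ?v]] show "B m \<in> events"
          unfolding B_def by (simp add: Collect_conj_eq[symmetric] conj_ac cong: conj_cong)
        show "A m \<subseteq> B m \<union> ({\<omega>\<in>space M. p.score (X 0 \<omega>) (X 1 \<omega>) \<le> ?u} \<union> {\<omega>\<in>space M. p.score (X 1 \<omega>) (X 0 \<omega>) \<le> ?v})"
          "B m \<subseteq> A m \<union> ({\<omega>\<in>space M. p.score (X 0 \<omega>) (X 1 \<omega>) \<le> ?u} \<union> {\<omega>\<in>space M. p.score (X 1 \<omega>) (X 0 \<omega>) \<le> ?v})"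
          using same by (auto simp: A_def B_def)
      qed measurable
      also have "\<dots> = ?u + ?v"
        using prob_score_X[of ?u] prob_score_X[of ?v] elim by simp
      finally show ?case .
    qed
  qed
  have "(\<lambda>m. exp s / real m + exp t / real m) \<longlonglongrightarrow> 0"
    using tendsto_add[OF tendsto_exp_div(1)[of s] tendsto_exp_div(1)[of t]] by simp
  then have "(\<lambda>m. prob (A m) - prob (B m)) \<longlonglongrightarrow> 0"
    by (rule Lim_null_comparison[rotated]) (use close in simp)
  from tendsto_add[OF this lim] show ?thesis
    by (simp add: A_def)
qed

section \<open>The error terms and their averages\<close>

definition divergence :: real where
  "divergence = (\<integral>x. ln (p x) - ln (q x) \<partial>p.Q)"

definition log_rank_Y :: "nat \<Rightarrow> nat \<Rightarrow> nat \<Rightarrow> 'a \<Rightarrow> real" where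
  "log_rank_Y l m i \<omega> = ln (real m * rank_Y l m i \<omega>) - Digamma (real l)"

definition log_rank_X :: "nat \<Rightarrow> nat \<Rightarrow> nat \<Rightarrow> 'a \<Rightarrow> real" where
  "log_rank_X k n i \<omega> = ln (real (n - 1) * rank_X k n i \<omega>) - Digamma (real k)"

text \<open>The plus sign is due to \<open>log_ratio\<close> tending to minus the log
  density.\<close>

definition err_Y :: "nat \<Rightarrow> nat \<Rightarrow> nat \<Rightarrow> 'a \<Rightarrow> real" where
  "err_Y l m i \<omega> = q.log_ratio (X i \<omega>) (dist_Y l m i \<omega>) + ln (q (X i \<omega>))"

definition err_X :: "nat \<Rightarrow> nat \<Rightarrow> nat \<Rightarrow> 'a \<Rightarrow> real" where
  "err_X k n i \<omega> = p.log_ratio (X i \<omega>) (dist_X k n i \<omega>) + ln (p (X i \<omega>))"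

definition log_dev :: "nat \<Rightarrow> 'a \<Rightarrow> real" where
  "log_dev i \<omega> = ln (p (X i \<omega>)) - ln (q (X i \<omega>)) - divergence"

abbreviation mean :: "nat \<Rightarrow> (nat \<Rightarrow> 'a \<Rightarrow> real) \<Rightarrow> 'a \<Rightarrow> real" where
  "mean n G \<omega> \<equiv> 1 / real n * (\<Sum>i<n. G i \<omega>)"

text \<open>Interface to \<open>exchangeable_average\<close>: \<open>\<Phi>\<close> displays
  \<open>G\<close> as a function of all sample points, so that equivariance can be checked term by
  term.\<close>

lemma mean_square:
  fixes \<Phi> :: "nat \<Rightarrow> (nat + nat \<Rightarrow> 'b) \<Rightarrow> real"
  assumes n: "2 \<le> n" and meas: "\<And>i. i < n \<Longrightarrow> \<Phi> i \<in> borel_measurable (PiM UNIV (\<lambda>_. borel))"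
    and equivariant: "\<And>\<pi> i w. \<pi> permutes {..<n} \<Longrightarrow> i < n \<Longrightarrow> \<Phi> i (\<lambda>c. w (map_sum \<pi> id c)) = \<Phi> (\<pi> i) w"
    and eq: "\<And>i \<omega>. \<Phi> i (\<lambda>c. case_sum X Y c \<omega>) = G i \<omega>"
    and int: "integrable M (\<lambda>\<omega>. (G 0 \<omega>)\<^sup>2)"
  shows "integrable M (\<lambda>\<omega>. (mean n G \<omega>)\<^sup>2)" "(\<integral>\<omega>. (mean n G \<omega>)\<^sup>2 \<partial>M) \<le> (\<integral>\<omega>. (G 0 \<omega>)\<^sup>2 \<partial>M)"
    "(\<integral>\<omega>. (mean n G \<omega>)\<^sup>2 \<partial>M) \<le> (\<integral>\<omega>. (G 0 \<omega>)\<^sup>2 \<partial>M) / real n + \<bar>\<integral>\<omega>. G 0 \<omega> * G 1 \<omega> \<partial>M\<bar>"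
proof -
  have law: "distr M borel (X i) = distr M borel (X 0)" for i
    by (simp add: law_X)
  have "integrable M (\<lambda>\<omega>. (\<Phi> 0 (\<lambda>c. case_sum X Y c \<omega>))\<^sup>2)"
    unfolding eq by (rule int)
  from exchangeable_average[OF indep law n meas equivariant this, unfolded eq]
  show "integrable M (\<lambda>\<omega>. (mean n G \<omega>)\<^sup>2)" "(\<integral>\<omega>. (mean n G \<omega>)\<^sup>2 \<partial>M) \<le> (\<integral>\<omega>. (G 0 \<omega>)\<^sup>2 \<partial>M)"
    "(\<integral>\<omega>. (mean n G \<omega>)\<^sup>2 \<partial>M) \<le> (\<integral>\<omega>. (G 0 \<omega>)\<^sup>2 \<partial>M) / real n + \<bar>\<integral>\<omega>. G 0 \<omega> * G 1 \<omega> \<partial>M\<bar>"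
    by blast+
qed

lemma component_measurable[measurable]: "(\<lambda>w. w c) \<in> borel_measurable (PiM UNIV (\<lambda>_. borel))"
  by (rule measurable_component_singleton) simp

lemma log_rank_Y_limits:
  assumes l: "1 \<le> l"
  shows "(\<lambda>m. \<integral>\<omega>. log_rank_Y l m 0 \<omega> * log_rank_Y l m 1 \<omega> \<partial>M) \<longlonglongrightarrow> 0"
    and "\<exists>B. \<forall>m\<ge>2 * l. (\<integral>\<omega>. (log_rank_Y l m 0 \<omega>)\<^sup>2 \<partial>M) \<le> B"
    and "\<And>m. 2 * l \<le> m \<Longrightarrow> integrable M (\<lambda>\<omega>. (log_rank_Y l m 0 \<omega>)\<^sup>2)"
  unfolding log_rank_Y_def
  by (rule uniform_order_stat_log_moments[of l "\<lambda>m. rank_Y l m 0" "\<lambda>m. rank_Y l m 1", OF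
      uniform_rank_Y[OF l] uniform_rank_Y[OF l] l joint_rank_Y[OF l]]; assumption)+

lemma log_rank_X_limits:
  assumes k: "1 \<le> k"
  shows "(\<lambda>n. \<integral>\<omega>. log_rank_X k n 0 \<omega> * log_rank_X k n 1 \<omega> \<partial>M) \<longlonglongrightarrow> 0"
    and "\<exists>B. \<forall>n\<ge>Suc (2 * k). (\<integral>\<omega>. (log_rank_X k n 0 \<omega>)\<^sup>2 \<partial>M) \<le> B"
    and "\<And>n. Suc (2 * k) \<le> n \<Longrightarrow> integrable M (\<lambda>\<omega>. (log_rank_X k n 0 \<omega>)\<^sup>2)"
proof -
  have U: "uniform_order_stat k m (rank_X k (Suc m) 0)" "uniform_order_stat k m (rank_X k (Suc m) 1)" if "k \<le> m" for m
    using uniform_rank_X[of k "Suc m" 0] uniform_rank_X[of k "Suc m" 1] k that by auto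
  have eq: "log_rank_X k (Suc m) i \<omega> = ln (real m * rank_X k (Suc m) i \<omega>) - Digamma (real k)" for m i \<omega>
    by (simp add: log_rank_X_def)
  note L = uniform_order_stat_log_moments[of k "\<lambda>m. rank_X k (Suc m) 0" "\<lambda>m. rank_X k (Suc m) 1",
      OF U k joint_rank_X[OF k], folded eq]
  show "(\<lambda>n. \<integral>\<omega>. log_rank_X k n 0 \<omega> * log_rank_X k n 1 \<omega> \<partial>M) \<longlonglongrightarrow> 0"
    by (rule LIMSEQ_imp_Suc) (rule L(1))
  obtain B where B: "\<And>m. 2 * k \<le> m \<Longrightarrow> (\<integral>\<omega>. (log_rank_X k (Suc m) 0 \<omega>)\<^sup>2 \<partial>M) \<le> B"
    using L(2) by blast
  show "\<exists>B. \<forall>n\<ge>Suc (2 * k). (\<integral>\<omega>. (log_rank_X k n 0 \<omega>)\<^sup>2 \<partial>M) \<le> B"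
  proof (intro exI allI impI)
    fix n assume "Suc (2 * k) \<le> n"
    then show "(\<integral>\<omega>. (log_rank_X k n 0 \<omega>)\<^sup>2 \<partial>M) \<le> B"
      using B[of "n - 1"] by (cases n) auto
  qed
  show "integrable M (\<lambda>\<omega>. (log_rank_X k n 0 \<omega>)\<^sup>2)" if "Suc (2 * k) \<le> n" for n
    using L(3)[of "n - 1"] that by (cases n) auto
qed

lemma err_Y_limits:
  assumes l: "1 \<le> l"
  shows "(\<lambda>m. \<integral>\<omega>. (err_Y l m 0 \<omega>)\<^sup>2 \<partial>M) \<longlonglongrightarrow> 0"
    and "\<And>m. l \<le> m \<Longrightarrow> integrable M (\<lambda>\<omega>. (err_Y l m 0 \<omega>)\<^sup>2)"
  using nn_sample.log_ratio_error[OF nn_sample_Y[of 0] l] X_moment[of 0]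
  by (simp_all add: err_Y_def dist_Y_def index_Y_def)

lemma err_X_limits:
  assumes k: "1 \<le> k"
  shows "(\<lambda>n. \<integral>\<omega>. (err_X k n 0 \<omega>)\<^sup>2 \<partial>M) \<longlonglongrightarrow> 0"
    and "\<And>n. Suc k \<le> n \<Longrightarrow> integrable M (\<lambda>\<omega>. (err_X k n 0 \<omega>)\<^sup>2)"
proof -
  have d: "dist_X k (Suc m) 0 \<omega> = order_stat k (\<lambda>j. dist (X 0 \<omega>) (X (skip 0 j) \<omega>)) {..<m}" for m \<omega>
    unfolding dist_X_def by (subst order_stat_skip) simp_all
  have L: "(\<lambda>m. \<integral>\<omega>. (err_X k (Suc m) 0 \<omega>)\<^sup>2 \<partial>M) \<longlonglongrightarrow> 0"
    "\<And>m. k \<le> m \<Longrightarrow> integrable M (\<lambda>\<omega>. (err_X k (Suc m) 0 \<omega>)\<^sup>2)"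
    using nn_sample.log_ratio_error[OF nn_sample_X[of 0] k] X_moment[of 0]
    by (simp_all add: err_X_def d index_X_def)
  show "(\<lambda>n. \<integral>\<omega>. (err_X k n 0 \<omega>)\<^sup>2 \<partial>M) \<longlonglongrightarrow> 0"
    by (rule LIMSEQ_imp_Suc) (rule L(1))
  show "integrable M (\<lambda>\<omega>. (err_X k n 0 \<omega>)\<^sup>2)" if "Suc k \<le> n" for n
    using L(2)[of "n - 1"] that by (cases n) auto
qed

text \<open>The log densities grow at most quadratically, so the fourth moment gives square
  integrability. The cross moment is a product of two zero means by independence of
  \<open>X 0\<close> and \<open>X 1\<close>.\<close>

lemma log_dev_moments:
  shows "integrable M (\<lambda>\<omega>. (log_dev i \<omega>)\<^sup>2)" and "(\<integral>\<omega>. log_dev 0 \<omega> * log_dev 1 \<omega> \<partial>M) = 0"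
proof -
  define h where "h x = ln (p x) - ln (q x) - divergence" for x
  have [measurable]: "h \<in> borel_measurable borel"
    unfolding h_def by measurable
  have dev: "log_dev i = (\<lambda>\<omega>. h (X i \<omega>))" for i
    by (simp add: log_dev_def h_def fun_eq_iff)
  define K where "K = Cp + Cq + \<bar>divergence\<bar>"
  have K: "0 \<le> K"
    unfolding K_def using p.C_nonneg q.C_nonneg by simp
  have h_le: "(h x)\<^sup>2 \<le> 2 * K\<^sup>2 * (1 + norm x ^ 4)" for x
  proof -
    have "\<bar>divergence\<bar> * 1 \<le> \<bar>divergence\<bar> * (1 + (norm x)\<^sup>2)"
      by (intro mult_left_mono) auto
    then have "\<bar>h x\<bar> \<le> K * (1 + (norm x)\<^sup>2)"
      unfolding h_def K_def using p.ln_q_bounds[of x] q.ln_q_bounds[of x] by (simp add: distrib_right)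
    then have "\<bar>h x\<bar>\<^sup>2 \<le> (K * (1 + (norm x)\<^sup>2))\<^sup>2"
      by (intro power_mono) auto
    also have "\<dots> = K\<^sup>2 * (1 + (norm x)\<^sup>2)\<^sup>2"
      by (rule power_mult_distrib)
    also have "\<dots> \<le> K\<^sup>2 * (2 * (1 + norm x ^ 4))"
    proof (intro mult_left_mono)
      have "0 \<le> (1 - (norm x)\<^sup>2)\<^sup>2"
        by simp
      then show "(1 + (norm x)\<^sup>2)\<^sup>2 \<le> 2 * (1 + norm x ^ 4)"
        by (simp add: power2_eq_square power4_eq_xxxx algebra_simps)
    qed simp
    finally show ?thesis
      by (simp only: mult_ac power2_abs)
  qed
  show sq: "integrable M (\<lambda>\<omega>. (log_dev i \<omega>)\<^sup>2)" for i
    unfolding dev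
  proof (rule Bochner_Integration.integrable_bound)
    show "integrable M (\<lambda>\<omega>. 2 * K\<^sup>2 * (1 + norm (X i \<omega>) ^ 4))"
      using X_moment[of i] by simp
    show "AE \<omega> in M. norm ((h (X i \<omega>))\<^sup>2) \<le> norm (2 * K\<^sup>2 * (1 + norm (X i \<omega>) ^ 4))"
      using h_le K by (intro AE_I2) (simp add: abs_of_nonneg)
  qed measurable
  have int: "integrable M (log_dev i)" for i
  proof (rule square_integrable_imp_integrable)
    show "log_dev i \<in> borel_measurable M"
      unfolding dev by measurable
  qed (rule sq)
  have mean0: "(\<integral>\<omega>. log_dev i \<omega> \<partial>M) = 0" for i
  proof -
    have "integrable M (\<lambda>\<omega>. ln (p (X i \<omega>)) - ln (q (X i \<omega>)))"
      using Bochner_Integration.integrable_add[OF int[of i] integrable_const[of divergence]] by (simp add: log_dev_def)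
    moreover have "(\<integral>\<omega>. ln (p (X i \<omega>)) - ln (q (X i \<omega>)) \<partial>M) = divergence"
    proof -
      have "(\<integral>\<omega>. ln (p (X i \<omega>)) - ln (q (X i \<omega>)) \<partial>M) = (\<integral>x. ln (p x) - ln (q x) \<partial>distr M borel (X i))"
        by (rule integral_distr[symmetric]) measurable
      then show ?thesis
        by (simp add: law_X divergence_def)
    qed
    ultimately show ?thesis
      by (simp add: log_dev_def prob_space)
  qed
  have "indep_var borel (X 0) borel (X 1)"
  proof -
    have "inj (case_bool (Inl 0) (Inl 1) :: bool \<Rightarrow> nat + nat)"
      by (auto simp: inj_def split: bool.splits)
    from indep_vars_reindex[OF indep this]
    have "indep_vars (\<lambda>_. borel) (\<lambda>b. case_sum X Y (case_bool (Inl 0) (Inl 1) b)) UNIV" .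
    moreover have "(\<lambda>b. case_sum X Y (case_bool (Inl 0) (Inl 1) b)) = case_bool (X 0) (X 1)"
      "(\<lambda>_. borel :: 'b measure) = case_bool borel borel"
      by (auto simp: fun_eq_iff split: bool.splits)
    ultimately show ?thesis
      unfolding indep_var_def by simp
  qed
  then have "indep_var borel (h \<circ> X 0) borel (h \<circ> X 1)"
    by (rule indep_var_compose) measurable
  then have "indep_var borel (log_dev 0) borel (log_dev 1)"
    by (simp add: dev comp_def)
  from indep_var_lebesgue_integral[OF this int int] show "(\<integral>\<omega>. log_dev 0 \<omega> * log_dev 1 \<omega> \<partial>M) = 0"
    by (simp add: mean0)
qed

lemma mean_log_rank_Y:
  assumes "1 \<le> l" "2 * l \<le> m" "2 \<le> n"
  shows "integrable M (\<lambda>\<omega>. (mean n (log_rank_Y l m) \<omega>)\<^sup>2)"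
    "(\<integral>\<omega>. (mean n (log_rank_Y l m) \<omega>)\<^sup>2 \<partial>M) \<le> (\<integral>\<omega>. (log_rank_Y l m 0 \<omega>)\<^sup>2 \<partial>M) / real n
      + \<bar>\<integral>\<omega>. log_rank_Y l m 0 \<omega> * log_rank_Y l m 1 \<omega> \<partial>M\<bar>"
proof -
  let ?\<Phi> = "\<lambda>i (w :: nat + nat \<Rightarrow> 'b). ln (real m * order_stat l (\<lambda>j. q.score (w (Inl i)) (w (Inr j))) {..<m}) - Digamma (real l)"
  have [measurable]: "(\<lambda>w. order_stat l (\<lambda>j. q.score (w (Inl i)) (w (Inr j))) {..<m}) \<in> borel_measurable (PiM UNIV (\<lambda>_. borel))" for i
    by (rule order_stat_measurable) (use assms in \<open>simp_all\<close>)
  have 1: "?\<Phi> i \<in> borel_measurable (PiM UNIV (\<lambda>_. borel))" for i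
    by measurable
  have 2: "?\<Phi> i (\<lambda>c. w (map_sum \<pi> id c)) = ?\<Phi> (\<pi> i) w" for i \<pi> and w :: "nat + nat \<Rightarrow> 'b"
    by simp
  have 3: "?\<Phi> i (\<lambda>c. case_sum X Y c \<omega>) = log_rank_Y l m i \<omega>" for i \<omega>
    by (simp add: log_rank_Y_def rank_Y_def)
  show "integrable M (\<lambda>\<omega>. (mean n (log_rank_Y l m) \<omega>)\<^sup>2)"
    "(\<integral>\<omega>. (mean n (log_rank_Y l m) \<omega>)\<^sup>2 \<partial>M) \<le> (\<integral>\<omega>. (log_rank_Y l m 0 \<omega>)\<^sup>2 \<partial>M) / real n
      + \<bar>\<integral>\<omega>. log_rank_Y l m 0 \<omega> * log_rank_Y l m 1 \<omega> \<partial>M\<bar>"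
    by (rule mean_square[where \<Phi>="?\<Phi>", OF assms(3) 1 2 3 log_rank_Y_limits(3)[OF assms(1,2)]])+
qed

lemma mean_log_rank_X:
  assumes "1 \<le> k" "Suc (2 * k) \<le> n"
  shows "integrable M (\<lambda>\<omega>. (mean n (log_rank_X k n) \<omega>)\<^sup>2)"
    "(\<integral>\<omega>. (mean n (log_rank_X k n) \<omega>)\<^sup>2 \<partial>M) \<le> (\<integral>\<omega>. (log_rank_X k n 0 \<omega>)\<^sup>2 \<partial>M) / real n
      + \<bar>\<integral>\<omega>. log_rank_X k n 0 \<omega> * log_rank_X k n 1 \<omega> \<partial>M\<bar>"
proof -
  let ?\<Phi> = "\<lambda>i (w :: nat + nat \<Rightarrow> 'b). ln (real (n - 1) * order_stat k (\<lambda>j. p.score (w (Inl i)) (w (Inl j))) ({..<n} - {i})) - Digamma (real k)"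
  have n: "2 \<le> n"
    using assms by simp
  have 1: "?\<Phi> i \<in> borel_measurable (PiM UNIV (\<lambda>_. borel))" if "i < n" for i
  proof -
    have [measurable]: "(\<lambda>w. order_stat k (\<lambda>j. p.score (w (Inl i)) (w (Inl j))) ({..<n} - {i})) \<in> borel_measurable (PiM UNIV (\<lambda>_. borel))"
      by (rule order_stat_measurable) (use assms that in \<open>simp_all\<close>)
    show ?thesis
      by measurable
  qed
  have 2: "?\<Phi> i (\<lambda>c. w (map_sum \<pi> id c)) = ?\<Phi> (\<pi> i) w" if "\<pi> permutes {..<n}" "i < n" for i \<pi> and w :: "nat + nat \<Rightarrow> 'b"
    using order_stat_permute_lessThan[OF that, of k "\<lambda>j. p.score (w (Inl (\<pi> i))) (w (Inl j))"] by simp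
  have 3: "?\<Phi> i (\<lambda>c. case_sum X Y c \<omega>) = log_rank_X k n i \<omega>" for i \<omega>
    by (simp add: log_rank_X_def rank_X_def)
  show "integrable M (\<lambda>\<omega>. (mean n (log_rank_X k n) \<omega>)\<^sup>2)"
    "(\<integral>\<omega>. (mean n (log_rank_X k n) \<omega>)\<^sup>2 \<partial>M) \<le> (\<integral>\<omega>. (log_rank_X k n 0 \<omega>)\<^sup>2 \<partial>M) / real n
      + \<bar>\<integral>\<omega>. log_rank_X k n 0 \<omega> * log_rank_X k n 1 \<omega> \<partial>M\<bar>"
    by (rule mean_square[where \<Phi>="?\<Phi>", OF n 1 2 3 log_rank_X_limits(3)[OF assms]]; assumption)+
qed

lemma mean_err_Y:
  assumes "1 \<le> l" "l \<le> m" "2 \<le> n"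
  shows "integrable M (\<lambda>\<omega>. (mean n (err_Y l m) \<omega>)\<^sup>2)"
    "(\<integral>\<omega>. (mean n (err_Y l m) \<omega>)\<^sup>2 \<partial>M) \<le> (\<integral>\<omega>. (err_Y l m 0 \<omega>)\<^sup>2 \<partial>M)"
proof -
  let ?\<Phi> = "\<lambda>i (w :: nat + nat \<Rightarrow> 'b). q.log_ratio (w (Inl i)) (order_stat l (\<lambda>j. dist (w (Inl i)) (w (Inr j))) {..<m}) + ln (q (w (Inl i)))"
  have [measurable]: "(\<lambda>w. order_stat l (\<lambda>j. dist (w (Inl i)) (w (Inr j) :: 'b)) {..<m}) \<in> borel_measurable (PiM UNIV (\<lambda>_. borel))" for i :: nat
    by (rule order_stat_measurable) (use assms in \<open>simp_all\<close>)
  have 1: "?\<Phi> i \<in> borel_measurable (PiM UNIV (\<lambda>_. borel))" for i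
    by measurable
  have 2: "?\<Phi> i (\<lambda>c. w (map_sum \<pi> id c)) = ?\<Phi> (\<pi> i) w" for i \<pi> and w :: "nat + nat \<Rightarrow> 'b"
    by simp
  have 3: "?\<Phi> i (\<lambda>c. case_sum X Y c \<omega>) = err_Y l m i \<omega>" for i \<omega>
    by (simp add: err_Y_def dist_Y_def)
  show "integrable M (\<lambda>\<omega>. (mean n (err_Y l m) \<omega>)\<^sup>2)"
    "(\<integral>\<omega>. (mean n (err_Y l m) \<omega>)\<^sup>2 \<partial>M) \<le> (\<integral>\<omega>. (err_Y l m 0 \<omega>)\<^sup>2 \<partial>M)"
    by (rule mean_square[where \<Phi>="?\<Phi>", OF assms(3) 1 2 3 err_Y_limits(2)[OF assms(1,2)]])+
qed

lemma mean_err_X: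
  assumes "1 \<le> k" "Suc k \<le> n"
  shows "integrable M (\<lambda>\<omega>. (mean n (err_X k n) \<omega>)\<^sup>2)"
    "(\<integral>\<omega>. (mean n (err_X k n) \<omega>)\<^sup>2 \<partial>M) \<le> (\<integral>\<omega>. (err_X k n 0 \<omega>)\<^sup>2 \<partial>M)"
proof -
  let ?\<Phi> = "\<lambda>i (w :: nat + nat \<Rightarrow> 'b). p.log_ratio (w (Inl i)) (order_stat k (\<lambda>j. dist (w (Inl i)) (w (Inl j))) ({..<n} - {i})) + ln (p (w (Inl i)))"
  have n: "2 \<le> n"
    using assms by simp
  have 1: "?\<Phi> i \<in> borel_measurable (PiM UNIV (\<lambda>_. borel))" if "i < n" for i
  proof -
    have [measurable]: "(\<lambda>w. order_stat k (\<lambda>j. dist (w (Inl i)) (w (Inl j) :: 'b)) ({..<n} - {i})) \<in> borel_measurable (PiM UNIV (\<lambda>_. borel))"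
      by (rule order_stat_measurable) (use assms that in \<open>simp_all\<close>)
    show ?thesis
      by measurable
  qed
  have 2: "?\<Phi> i (\<lambda>c. w (map_sum \<pi> id c)) = ?\<Phi> (\<pi> i) w" if "\<pi> permutes {..<n}" "i < n" for i \<pi> and w :: "nat + nat \<Rightarrow> 'b"
    using order_stat_permute_lessThan[OF that, of k "\<lambda>j. dist (w (Inl (\<pi> i))) (w (Inl j))"] by simp
  have 3: "?\<Phi> i (\<lambda>c. case_sum X Y c \<omega>) = err_X k n i \<omega>" for i \<omega>
    by (simp add: err_X_def dist_X_def)
  show "integrable M (\<lambda>\<omega>. (mean n (err_X k n) \<omega>)\<^sup>2)"
    "(\<integral>\<omega>. (mean n (err_X k n) \<omega>)\<^sup>2 \<partial>M) \<le> (\<integral>\<omega>. (err_X k n 0 \<omega>)\<^sup>2 \<partial>M)"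
    by (rule mean_square[where \<Phi>="?\<Phi>", OF n 1 2 3 err_X_limits(2)[OF assms]]; assumption)+
qed

lemma mean_log_dev:
  assumes "2 \<le> n"
  shows "integrable M (\<lambda>\<omega>. (mean n log_dev \<omega>)\<^sup>2)"
    "(\<integral>\<omega>. (mean n log_dev \<omega>)\<^sup>2 \<partial>M) \<le> (\<integral>\<omega>. (log_dev 0 \<omega>)\<^sup>2 \<partial>M) / real n"
proof -
  let ?\<Phi> = "\<lambda>i (w :: nat + nat \<Rightarrow> 'b). ln (p (w (Inl i))) - ln (q (w (Inl i))) - divergence"
  have 1: "?\<Phi> i \<in> borel_measurable (PiM UNIV (\<lambda>_. borel))" for i
    by measurable
  have 2: "?\<Phi> i (\<lambda>c. w (map_sum \<pi> id c)) = ?\<Phi> (\<pi> i) w" for i \<pi> and w :: "nat + nat \<Rightarrow> 'b"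
    by simp
  have 3: "?\<Phi> i (\<lambda>c. case_sum X Y c \<omega>) = log_dev i \<omega>" for i \<omega>
    by (simp add: log_dev_def)
  note L = mean_square[where \<Phi>="?\<Phi>", OF assms 1 2 3 log_dev_moments(1)]
  show "integrable M (\<lambda>\<omega>. (mean n log_dev \<omega>)\<^sup>2)"
    "(\<integral>\<omega>. (mean n log_dev \<omega>)\<^sup>2 \<partial>M) \<le> (\<integral>\<omega>. (log_dev 0 \<omega>)\<^sup>2 \<partial>M) / real n"
    using L(1,3) log_dev_moments(2) by simp_all
qed

text \<open>\<open>D_hat\<close> with neighbour distances replaced by order statistics; by
  \<open>dist_nearest_neighbor\<close> the two agree for n \<ge> k + 1 and m \<ge> l.\<close>

definition estimator :: "nat \<Rightarrow> nat \<Rightarrow> nat \<Rightarrow> nat \<Rightarrow> 'a \<Rightarrow> real" where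
  "estimator k l n m \<omega> = Digamma (real k) - Digamma (real l) +
     mean n (\<lambda>i \<omega>. ln (real m * dist_Y l m i \<omega> ^ DIM('b) / ((real n - 1) * dist_X k n i \<omega> ^ DIM('b)))) \<omega>"

lemma estimator_measurable:
  assumes "1 \<le> k" "1 \<le> l" "l \<le> m" "Suc k \<le> n"
  shows "random_variable borel (estimator k l n m)"
proof -
  have [measurable]: "random_variable borel (dist_Y l m i)" for i
    unfolding dist_Y_def[abs_def] by (rule order_stat_measurable) (use assms in simp_all)
  have [measurable]: "random_variable borel (dist_X k n i)" if "i < n" for i
    unfolding dist_X_def[abs_def] by (rule order_stat_measurable) (use assms that in simp_all)
  have "random_variable borel (\<lambda>\<omega>. \<Sum>i<n. ln (real m * dist_Y l m i \<omega> ^ DIM('b) / ((real n - 1) * dist_X k n i \<omega> ^ DIM('b))))"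
    by (intro borel_measurable_sum) simp
  then show ?thesis
    unfolding estimator_def[abs_def] by simp
qed

text \<open>Each \<open>log_ratio\<close> is the log volume of the unit ball, plus d times the log
  distance, minus the log rank. The volumes cancel between the samples, the ranks against
  \<open>log_rank_Y\<close> and \<open>log_rank_X\<close>, and the log densities against
  \<open>log_dev\<close>.\<close>

lemma estimator_term:
  assumes "1 \<le> k" "1 \<le> l" "l \<le> m" "Suc k \<le> n" "i < n"
    and V: "0 < dist_Y l m i \<omega>" and R: "0 < dist_X k n i \<omega>"
  shows "ln (real m * dist_Y l m i \<omega> ^ DIM('b) / ((real n - 1) * dist_X k n i \<omega> ^ DIM('b)))
    + Digamma (real k) - Digamma (real l) - divergence =
    log_rank_Y l m i \<omega> - log_rank_X k n i \<omega> + err_Y l m i \<omega> - err_X k n i \<omega> + log_dev i \<omega>"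
proof -
  let ?v = "unit_ball_vol (real DIM('b))" and ?d = "DIM('b)"
  have pos: "0 < real m" "0 < real n - 1" "0 < ?v" "real (n - 1) = real n - 1"
    using assms by auto
  have rY: "q.ball_prob (X i \<omega>) (dist_Y l m i \<omega>) = rank_Y l m i \<omega>" "0 < rank_Y l m i \<omega>"
    using ball_prob_dist_Y[of l m i \<omega>] q.ball_prob_pos[OF V, of "X i \<omega>"] assms by auto
  have rX: "p.ball_prob (X i \<omega>) (dist_X k n i \<omega>) = rank_X k n i \<omega>" "0 < rank_X k n i \<omega>"
    using ball_prob_dist_X[of k n i \<omega>] p.ball_prob_pos[OF R, of "X i \<omega>"] assms by auto
  have "q.log_ratio (X i \<omega>) (dist_Y l m i \<omega>) = ln ?v + real ?d * ln (dist_Y l m i \<omega>) - ln (rank_Y l m i \<omega>)"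
    unfolding q.log_ratio_def rY(1) using V pos rY(2) by (simp add: content_cball ln_divide_pos ln_mult_pos ln_realpow)
  moreover have "p.log_ratio (X i \<omega>) (dist_X k n i \<omega>) = ln ?v + real ?d * ln (dist_X k n i \<omega>) - ln (rank_X k n i \<omega>)"
    unfolding p.log_ratio_def rX(1) using R pos rX(2) by (simp add: content_cball ln_divide_pos ln_mult_pos ln_realpow)
  moreover have "ln (real m * rank_Y l m i \<omega>) = ln (real m) + ln (rank_Y l m i \<omega>)"
    using pos rY(2) by (intro ln_mult_pos)
  moreover have "ln ((real n - 1) * rank_X k n i \<omega>) = ln (real n - 1) + ln (rank_X k n i \<omega>)"
    using pos rX(2) by (intro ln_mult_pos)
  moreover have "ln (real m * dist_Y l m i \<omega> ^ ?d / ((real n - 1) * dist_X k n i \<omega> ^ ?d)) =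
      (ln (real m) + real ?d * ln (dist_Y l m i \<omega>)) - (ln (real n - 1) + real ?d * ln (dist_X k n i \<omega>))"
    using V R pos by (simp add: ln_divide_pos ln_mult_pos ln_realpow)
  ultimately show ?thesis
    unfolding log_rank_Y_def log_rank_X_def err_Y_def err_X_def log_dev_def pos(4) by simp
qed

text \<open>Splitting the logarithms requires positive distances, which holds almost surely for all
  query points at once.\<close>

lemma estimator_decomposition:
  assumes "1 \<le> k" "1 \<le> l" "l \<le> m" "Suc k \<le> n"
  shows "AE \<omega> in M. estimator k l n m \<omega> - divergence =
    mean n (log_rank_Y l m) \<omega> - mean n (log_rank_X k n) \<omega> + mean n (err_Y l m) \<omega> - mean n (err_X k n) \<omega> + mean n log_dev \<omega>"
proof -
  have n: "0 < real n"
    using assms by simp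
  have "AE \<omega> in M. \<forall>i. 0 < dist_Y l m i \<omega>"
    unfolding AE_all_countable using dist_Y_pos assms by blast
  moreover have "AE \<omega> in M. \<forall>i\<in>{..<n}. 0 < dist_X k n i \<omega>"
    using assms by (intro AE_finite_allI dist_X_pos) auto
  ultimately show ?thesis
  proof eventually_elim
    case (elim \<omega>)
    let ?g = "\<lambda>i. ln (real m * dist_Y l m i \<omega> ^ DIM('b) / ((real n - 1) * dist_X k n i \<omega> ^ DIM('b)))"
    have "estimator k l n m \<omega> - divergence =
        1 / real n * (\<Sum>i<n. ?g i + Digamma (real k) - Digamma (real l) - divergence)"
    proof -
      have "(\<Sum>i<n. ?g i + Digamma (real k) - Digamma (real l) - divergence) =
          (\<Sum>i<n. ?g i) + real n * (Digamma (real k) - Digamma (real l) - divergence)"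
        by (simp add: sum.distrib sum_subtractf algebra_simps)
      then show ?thesis
        using n by (simp add: estimator_def field_simps)
    qed
    also have "(\<Sum>i<n. ?g i + Digamma (real k) - Digamma (real l) - divergence) =
        (\<Sum>i<n. log_rank_Y l m i \<omega> - log_rank_X k n i \<omega> + err_Y l m i \<omega> - err_X k n i \<omega> + log_dev i \<omega>)"
      using elim assms by (intro sum.cong refl estimator_term) auto
    finally show ?case
      by (simp only: sum.distrib sum_subtractf distrib_left right_diff_distrib)
  qed
qed

text \<open>Grouping as (a - b) + ((c - d) + e), each of at most three nested splittings costs a
  factor 2.\<close>

lemma square_sum5_le:
  "(a - b + c - d + e)\<^sup>2 \<le> 8 * (a\<^sup>2 + b\<^sup>2 + c\<^sup>2 + d\<^sup>2 + e\<^sup>2)" for a b c d e :: real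
proof -
  have add: "(x + y)\<^sup>2 \<le> 2 * x\<^sup>2 + 2 * y\<^sup>2" for x y :: real
    using zero_le_power2[of "x - y"] by (simp add: power2_eq_square algebra_simps)
  have sub: "(x - y)\<^sup>2 \<le> 2 * x\<^sup>2 + 2 * y\<^sup>2" for x y :: real
    using add[of x "- y"] by simp
  have "a - b + c - d + e = (a - b) + ((c - d) + e)"
    by simp
  then have "(a - b + c - d + e)\<^sup>2 \<le> 2 * (a - b)\<^sup>2 + 2 * ((c - d) + e)\<^sup>2"
    using add by metis
  moreover have "0 \<le> a\<^sup>2" "0 \<le> b\<^sup>2" "0 \<le> e\<^sup>2"
    by simp_all
  ultimately show ?thesis
    using sub[of a b] add[of "c - d" e] sub[of c d] by argo
qed

lemma estimator_square:
  assumes "1 \<le> k" "1 \<le> l" "2 * l \<le> m" "Suc (2 * k) \<le> n"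
  shows "integrable M (\<lambda>\<omega>. (estimator k l n m \<omega> - divergence)\<^sup>2)"
    and "(\<integral>\<omega>. (estimator k l n m \<omega> - divergence)\<^sup>2 \<partial>M) \<le> 8 * (
      ((\<integral>\<omega>. (log_rank_Y l m 0 \<omega>)\<^sup>2 \<partial>M) / real n + \<bar>\<integral>\<omega>. log_rank_Y l m 0 \<omega> * log_rank_Y l m 1 \<omega> \<partial>M\<bar>) +
      ((\<integral>\<omega>. (log_rank_X k n 0 \<omega>)\<^sup>2 \<partial>M) / real n + \<bar>\<integral>\<omega>. log_rank_X k n 0 \<omega> * log_rank_X k n 1 \<omega> \<partial>M\<bar>) +
      (\<integral>\<omega>. (err_Y l m 0 \<omega>)\<^sup>2 \<partial>M) + (\<integral>\<omega>. (err_X k n 0 \<omega>)\<^sup>2 \<partial>M) + (\<integral>\<omega>. (log_dev 0 \<omega>)\<^sup>2 \<partial>M) / real n)"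
proof -
  have le: "1 \<le> k" "1 \<le> l" "l \<le> m" "Suc k \<le> n" "2 \<le> n"
    using assms by auto
  note Y = mean_log_rank_Y[OF assms(2,3) le(5)]
  note X = mean_log_rank_X[OF assms(1,4)]
  note eY = mean_err_Y[OF le(2,3,5)]
  note eX = mean_err_X[OF le(1,4)]
  note dev = mean_log_dev[OF le(5)]
  let ?h = "\<lambda>\<omega>. 8 * ((mean n (log_rank_Y l m) \<omega>)\<^sup>2 + (mean n (log_rank_X k n) \<omega>)\<^sup>2 + (mean n (err_Y l m) \<omega>)\<^sup>2
    + (mean n (err_X k n) \<omega>)\<^sup>2 + (mean n log_dev \<omega>)\<^sup>2)"
  have h: "integrable M ?h"
    by (intro integrable_mult_right Bochner_Integration.integrable_add Y(1) X(1) eY(1) eX(1) dev(1))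
  have dom: "AE \<omega> in M. (estimator k l n m \<omega> - divergence)\<^sup>2 \<le> ?h \<omega>"
    using estimator_decomposition[OF le(1-4)] by eventually_elim (simp only: square_sum5_le)
  show int: "integrable M (\<lambda>\<omega>. (estimator k l n m \<omega> - divergence)\<^sup>2)"
  proof (rule Bochner_Integration.integrable_bound[OF h])
    show "(\<lambda>\<omega>. (estimator k l n m \<omega> - divergence)\<^sup>2) \<in> borel_measurable M"
      by (intro borel_measurable_power borel_measurable_diff estimator_measurable[OF le(1-4)]) simp
    show "AE \<omega> in M. norm ((estimator k l n m \<omega> - divergence)\<^sup>2) \<le> norm (?h \<omega>)"
      using dom
    proof eventually_elim
      case (elim \<omega>)
      then show ?case
        unfolding real_norm_def abs_power2 using abs_ge_self by (rule order_trans)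
    qed
  qed
  have "(\<integral>\<omega>. (estimator k l n m \<omega> - divergence)\<^sup>2 \<partial>M) \<le> (\<integral>\<omega>. ?h \<omega> \<partial>M)"
    by (rule integral_mono_AE[OF int h dom])
  also have "\<dots> = 8 * ((\<integral>\<omega>. (mean n (log_rank_Y l m) \<omega>)\<^sup>2 \<partial>M) + (\<integral>\<omega>. (mean n (log_rank_X k n) \<omega>)\<^sup>2 \<partial>M)
      + (\<integral>\<omega>. (mean n (err_Y l m) \<omega>)\<^sup>2 \<partial>M) + (\<integral>\<omega>. (mean n (err_X k n) \<omega>)\<^sup>2 \<partial>M) + (\<integral>\<omega>. (mean n log_dev \<omega>)\<^sup>2 \<partial>M))"
    unfolding integral_mult_right_zero
    by (simp only: Bochner_Integration.integral_add Bochner_Integration.integrable_add Y(1) X(1) eY(1) eX(1) dev(1))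
  also have "\<dots> \<le> 8 * (
      ((\<integral>\<omega>. (log_rank_Y l m 0 \<omega>)\<^sup>2 \<partial>M) / real n + \<bar>\<integral>\<omega>. log_rank_Y l m 0 \<omega> * log_rank_Y l m 1 \<omega> \<partial>M\<bar>) +
      ((\<integral>\<omega>. (log_rank_X k n 0 \<omega>)\<^sup>2 \<partial>M) / real n + \<bar>\<integral>\<omega>. log_rank_X k n 0 \<omega> * log_rank_X k n 1 \<omega> \<partial>M\<bar>) +
      (\<integral>\<omega>. (err_Y l m 0 \<omega>)\<^sup>2 \<partial>M) + (\<integral>\<omega>. (err_X k n 0 \<omega>)\<^sup>2 \<partial>M) + (\<integral>\<omega>. (log_dev 0 \<omega>)\<^sup>2 \<partial>M) / real n)"
    by (intro mult_left_mono add_mono Y(2) X(2) eY(2) eX(2) dev(2)) simp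
  finally show "(\<integral>\<omega>. (estimator k l n m \<omega> - divergence)\<^sup>2 \<partial>M) \<le> 8 * (
      ((\<integral>\<omega>. (log_rank_Y l m 0 \<omega>)\<^sup>2 \<partial>M) / real n + \<bar>\<integral>\<omega>. log_rank_Y l m 0 \<omega> * log_rank_Y l m 1 \<omega> \<partial>M\<bar>) +
      ((\<integral>\<omega>. (log_rank_X k n 0 \<omega>)\<^sup>2 \<partial>M) / real n + \<bar>\<integral>\<omega>. log_rank_X k n 0 \<omega> * log_rank_X k n 1 \<omega> \<partial>M\<bar>) +
      (\<integral>\<omega>. (err_Y l m 0 \<omega>)\<^sup>2 \<partial>M) + (\<integral>\<omega>. (err_X k n 0 \<omega>)\<^sup>2 \<partial>M) + (\<integral>\<omega>. (log_dev 0 \<omega>)\<^sup>2 \<partial>M) / real n)" .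
qed

theorem estimator_consistent:
  assumes k: "1 \<le> k" and l: "1 \<le> l"
  shows "\<forall>\<^sub>F (n, m) in sequentially \<times>\<^sub>F sequentially. random_variable borel (estimator k l n m) \<and>
      integrable M (\<lambda>\<omega>. (estimator k l n m \<omega> - divergence)\<^sup>2)"
    and "((\<lambda>(n, m). \<integral>\<omega>. (estimator k l n m \<omega> - divergence)\<^sup>2 \<partial>M) \<longlongrightarrow> 0) (sequentially \<times>\<^sub>F sequentially)"
proof -
  let ?F = "sequentially \<times>\<^sub>F sequentially :: (nat \<times> nat) filter"
  have ev: "\<forall>\<^sub>F nm in ?F. Suc (2 * k) \<le> fst nm \<and> 2 * l \<le> snd nm"
    using eventually_compose_filterlim[OF eventually_ge_at_top filterlim_fst, of "Suc (2 * k)" sequentially]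
      eventually_compose_filterlim[OF eventually_ge_at_top filterlim_snd, of "2 * l" sequentially]
    by (rule eventually_conj)
  show "\<forall>\<^sub>F (n, m) in ?F. random_variable borel (estimator k l n m) \<and>
      integrable M (\<lambda>\<omega>. (estimator k l n m \<omega> - divergence)\<^sup>2)"
    using ev by eventually_elim (use k l in \<open>auto intro!: estimator_measurable estimator_square(1)\<close>)
  \<comment> \<open>Uniform bounds for the second moments leave a constant over n. Every summand of
    \<open>?b\<close> is then a one-variable sequence composed with a projection, so the joint limit
    in (n, m) reduces to ordinary limits.\<close>
  obtain BY where BY: "\<And>m. 2 * l \<le> m \<Longrightarrow> (\<integral>\<omega>. (log_rank_Y l m 0 \<omega>)\<^sup>2 \<partial>M) \<le> BY"
    using log_rank_Y_limits(2)[OF l] by blast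
  obtain BX where BX: "\<And>n. Suc (2 * k) \<le> n \<Longrightarrow> (\<integral>\<omega>. (log_rank_X k n 0 \<omega>)\<^sup>2 \<partial>M) \<le> BX"
    using log_rank_X_limits(2)[OF k] by blast
  let ?b = "\<lambda>nm. 8 * (
      (BY / real (fst nm) + \<bar>\<integral>\<omega>. log_rank_Y l (snd nm) 0 \<omega> * log_rank_Y l (snd nm) 1 \<omega> \<partial>M\<bar>) +
      (BX / real (fst nm) + \<bar>\<integral>\<omega>. log_rank_X k (fst nm) 0 \<omega> * log_rank_X k (fst nm) 1 \<omega> \<partial>M\<bar>) +
      (\<integral>\<omega>. (err_Y l (snd nm) 0 \<omega>)\<^sup>2 \<partial>M) + (\<integral>\<omega>. (err_X k (fst nm) 0 \<omega>)\<^sup>2 \<partial>M)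
      + (\<integral>\<omega>. (log_dev 0 \<omega>)\<^sup>2 \<partial>M) / real (fst nm))"
  have "(?b \<longlongrightarrow> 8 * ((0 + \<bar>0\<bar>) + (0 + \<bar>0\<bar>) + 0 + 0 + 0)) ?F"
  proof (intro tendsto_mult tendsto_add tendsto_rabs tendsto_const)
    show "((\<lambda>nm. B / real (fst nm)) \<longlongrightarrow> 0) ?F" for B
      by (rule filterlim_compose[OF lim_const_over_n filterlim_fst])
    show "((\<lambda>nm. B / real (fst nm)) \<longlongrightarrow> 0) ?F" for B
      by (rule filterlim_compose[OF lim_const_over_n filterlim_fst])
    show "((\<lambda>nm. B / real (fst nm)) \<longlongrightarrow> 0) ?F" for B
      by (rule filterlim_compose[OF lim_const_over_n filterlim_fst])
    show "((\<lambda>nm. \<integral>\<omega>. log_rank_Y l (snd nm) 0 \<omega> * log_rank_Y l (snd nm) 1 \<omega> \<partial>M) \<longlongrightarrow> 0) ?F"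
      by (rule filterlim_compose[OF log_rank_Y_limits(1)[OF l] filterlim_snd])
    show "((\<lambda>nm. \<integral>\<omega>. log_rank_X k (fst nm) 0 \<omega> * log_rank_X k (fst nm) 1 \<omega> \<partial>M) \<longlongrightarrow> 0) ?F"
      by (rule filterlim_compose[OF log_rank_X_limits(1)[OF k] filterlim_fst])
    show "((\<lambda>nm. \<integral>\<omega>. (err_Y l (snd nm) 0 \<omega>)\<^sup>2 \<partial>M) \<longlongrightarrow> 0) ?F"
      by (rule filterlim_compose[OF err_Y_limits(1)[OF l] filterlim_snd])
    show "((\<lambda>nm. \<integral>\<omega>. (err_X k (fst nm) 0 \<omega>)\<^sup>2 \<partial>M) \<longlongrightarrow> 0) ?F"
      by (rule filterlim_compose[OF err_X_limits(1)[OF k] filterlim_fst])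
  qed
  then have b: "(?b \<longlongrightarrow> 0) ?F"
    by simp
  show "((\<lambda>(n, m). \<integral>\<omega>. (estimator k l n m \<omega> - divergence)\<^sup>2 \<partial>M) \<longlongrightarrow> 0) ?F"
  proof (rule tendsto_sandwich[OF _ _ tendsto_const b])
    show "\<forall>\<^sub>F nm in ?F. 0 \<le> (case nm of (n, m) \<Rightarrow> \<integral>\<omega>. (estimator k l n m \<omega> - divergence)\<^sup>2 \<partial>M)"
      by (intro always_eventually) auto
    show "\<forall>\<^sub>F nm in ?F. (case nm of (n, m) \<Rightarrow> \<integral>\<omega>. (estimator k l n m \<omega> - divergence)\<^sup>2 \<partial>M) \<le> ?b nm"
      using ev
    proof eventually_elim
      case (elim nm)
      obtain n m where nm: "nm = (n, m)"
        by (cases nm)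
      have le: "2 * l \<le> m" "Suc (2 * k) \<le> n"
        using elim nm by auto
      show ?case
        unfolding nm prod.case fst_conv snd_conv
        by (rule order_trans[OF estimator_square(2)[OF k l le]])
          (intro mult_left_mono add_mono divide_right_mono BY BX le order_refl; simp)
    qed
  qed
qed

end

text \<open>Nonnegativity of the variance of T - c bounds |E (T - c)| by the root of E (T -
  c)^2.\<close>

lemma (in prob_space) mean_convergence_of_mean_square:
  fixes T :: "'i \<Rightarrow> 'a \<Rightarrow> real"
  assumes ev: "\<forall>\<^sub>F i in F. random_variable borel (T i) \<and> integrable M (\<lambda>\<omega>. (T i \<omega> - c)\<^sup>2)"
    and lim: "((\<lambda>i. \<integral>\<omega>. (T i \<omega> - c)\<^sup>2 \<partial>M) \<longlongrightarrow> 0) F"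
  shows "\<forall>\<^sub>F i in F. integrable M (T i)" and "((\<lambda>i. \<integral>\<omega>. T i \<omega> \<partial>M) \<longlongrightarrow> c) F"
proof -
  have sq: "integrable M (T i) \<and> \<bar>(\<integral>\<omega>. T i \<omega> \<partial>M) - c\<bar> \<le> sqrt (\<integral>\<omega>. (T i \<omega> - c)\<^sup>2 \<partial>M)"
    if rv: "random_variable borel (T i)" and int: "integrable M (\<lambda>\<omega>. (T i \<omega> - c)\<^sup>2)" for i
  proof -
    let ?Z = "\<lambda>\<omega>. T i \<omega> - c"
    have Z: "integrable M ?Z"
      by (rule square_integrable_imp_integrable) (use rv int in auto)
    then have T: "integrable M (T i)"
      using Bochner_Integration.integrable_add[OF Z integrable_const[of c]] by simp
    have "0 \<le> expectation (\<lambda>\<omega>. (?Z \<omega>)\<^sup>2) - (expectation ?Z)\<^sup>2"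
      using variance_eq[OF Z int] variance_positive[of ?Z] by simp
    then have "\<bar>expectation ?Z\<bar> \<le> sqrt (\<integral>\<omega>. (?Z \<omega>)\<^sup>2 \<partial>M)"
      by (intro real_le_rsqrt) simp
    then show ?thesis
      using T by (simp add: prob_space)
  qed
  show "\<forall>\<^sub>F i in F. integrable M (T i)"
    using ev by eventually_elim (use sq in blast)
  have "((\<lambda>i. sqrt (\<integral>\<omega>. (T i \<omega> - c)\<^sup>2 \<partial>M)) \<longlongrightarrow> 0) F"
    using tendsto_real_sqrt[OF lim] by simp
  then have "((\<lambda>i. (\<integral>\<omega>. T i \<omega> \<partial>M) - c) \<longlongrightarrow> 0) F"
    by (rule Lim_null_comparison[rotated]) (use ev in \<open>eventually_elim, use sq in auto\<close>)
  then show "((\<lambda>i. \<integral>\<omega>. T i \<omega> \<partial>M) \<longlongrightarrow> c) F"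
    by (simp add: LIM_zero_iff)
qed

theorem corollary5:
  fixes M :: "'a measure"
    and X Y :: "'a \<Rightarrow> real ^ 'd"
    and Xs Ys :: "nat \<Rightarrow> 'a \<Rightarrow> real ^ 'd"
    and \<mu>\<^sub>X \<mu>\<^sub>Y :: "real ^ 'd"
    and \<Sigma>\<^sub>X \<Sigma>\<^sub>Y :: "real ^ 'd ^ 'd"
    and k l :: nat
    and D :: real
  defines "D \<equiv> kl_div (distr M borel X) (distr M borel Y)"
  assumes "prob_space M"
    and "gaussian_vector M X" and "gaussian_vector M Y"
    and "(\<integral>\<omega>. X \<omega> \<partial>M) = \<mu>\<^sub>X" and "(\<integral>\<omega>. Y \<omega> \<partial>M) = \<mu>\<^sub>Y"
    and "covariance_matrix M X = \<Sigma>\<^sub>X" and "covariance_matrix M Y = \<Sigma>\<^sub>Y"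
    and "invertible \<Sigma>\<^sub>X" and "invertible \<Sigma>\<^sub>Y"
    and "prob_space.indep_vars M (\<lambda>_. borel) (case_sum Xs Ys) UNIV"
    and "\<And>i. distr M borel (Xs i) = distr M borel X"
    and "\<And>j. distr M borel (Ys j) = distr M borel Y"
    and "k \<ge> 1" and "l \<ge> 1"
  shows
    "(\<forall>\<^sub>F (n, m) in sequentially \<times>\<^sub>F sequentially.
        integrable M (\<lambda>\<omega>. D_hat (\<lambda>i. Xs i \<omega>) (\<lambda>j. Ys j \<omega>) k l n m) \<and>
        integrable M (\<lambda>\<omega>. (D_hat (\<lambda>i. Xs i \<omega>) (\<lambda>j. Ys j \<omega>) k l n m - D)\<^sup>2)) \<and>
     ((\<lambda>(n, m). \<integral>\<omega>. D_hat (\<lambda>i. Xs i \<omega>) (\<lambda>j. Ys j \<omega>) k l n m \<partial>M) \<longlongrightarrow> D)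
        (sequentially \<times>\<^sub>F sequentially) \<and>
     ((\<lambda>(n, m). \<integral>\<omega>. (D_hat (\<lambda>i. Xs i \<omega>) (\<lambda>j. Ys j \<omega>) k l n m - D)\<^sup>2 \<partial>M) \<longlongrightarrow> 0)
        (sequentially \<times>\<^sub>F sequentially) \<and>
     D = 1 / 2 * (trace (matrix_inv \<Sigma>\<^sub>Y ** \<Sigma>\<^sub>X)
                  + (\<mu>\<^sub>Y - \<mu>\<^sub>X) \<bullet> (matrix_inv \<Sigma>\<^sub>Y *v (\<mu>\<^sub>Y - \<mu>\<^sub>X))
                  - real CARD('d) + ln (det \<Sigma>\<^sub>Y / det \<Sigma>\<^sub>X))"
proof -
  obtain A where A: "det A \<noteq> 0" "\<Sigma>\<^sub>X = A ** transpose A" "distr M borel X = distr std_gaussian borel (\<lambda>z. A *v z + \<mu>\<^sub>X)"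
    using gaussian_vector_affine[OF assms(2,3)] assms(5,7,9) by metis
  obtain B where B: "det B \<noteq> 0" "\<Sigma>\<^sub>Y = B ** transpose B" "distr M borel Y = distr std_gaussian borel (\<lambda>z. B *v z + \<mu>\<^sub>Y)"
    using gaussian_vector_affine[OF assms(2,4)] assms(6,8,10) by metis
  let ?p = "gauss_density A \<mu>\<^sub>X" and ?q = "gauss_density B \<mu>\<^sub>Y"
  obtain Cp where Cp: "tame_density ?p Cp"
    using tame_gauss_density[OF A(1)] by blast
  obtain Cq where Cq: "tame_density ?q Cq"
    using tame_gauss_density[OF B(1)] by blast
  have laws: "distr M borel X = density lborel ?p" "distr M borel Y = density lborel ?q"
    using A(3) B(3) distr_std_gaussian[OF A(1)] distr_std_gaussian[OF B(1)] by simp_all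
  interpret S: two_samples M ?p ?q Cp Cq Xs Ys
  proof (intro two_samples.intro two_samples_axioms.intro assms(2) Cp Cq assms(11))
    show "distr M borel (Xs i) = tame_density.Q ?p" for i
      unfolding tame_density.Q_def[OF Cp] assms(12) laws ..
    show "distr M borel (Ys j) = tame_density.Q ?q" for j
      unfolding tame_density.Q_def[OF Cq] assms(13) laws ..
  qed
  have D: "D = S.divergence"
    unfolding D_def laws S.divergence_def S.p.Q_def
    by (rule kl_div_density) (simp_all add: S.p.pos S.q.pos)
  have formula: "D = 1 / 2 * (trace (matrix_inv \<Sigma>\<^sub>Y ** \<Sigma>\<^sub>X)
                  + (\<mu>\<^sub>Y - \<mu>\<^sub>X) \<bullet> (matrix_inv \<Sigma>\<^sub>Y *v (\<mu>\<^sub>Y - \<mu>\<^sub>X))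
                  - real CARD('d) + ln (det \<Sigma>\<^sub>Y / det \<Sigma>\<^sub>X))"
    unfolding D S.divergence_def S.p.Q_def A(2) B(2) by (rule kl_div_gauss[OF A(1) B(1)])
  let ?F = "sequentially \<times>\<^sub>F sequentially :: (nat \<times> nat) filter"
  define T where "T nm \<omega> = D_hat (\<lambda>i. Xs i \<omega>) (\<lambda>j. Ys j \<omega>) k l (fst nm) (snd nm)" for nm \<omega>
  \<comment> \<open>For smaller sizes the list of candidates is too short and \<open>D_hat\<close>
    can be unspecified, so the limits are transferred along an eventual equality.\<close>
  have eq: "D_hat (\<lambda>i. Xs i \<omega>) (\<lambda>j. Ys j \<omega>) k l n m = S.estimator k l n m \<omega>" if "Suc k \<le> n" "l \<le> m" for n m \<omega>
  proof -
    have "V_dist (\<lambda>i. Xs i \<omega>) (\<lambda>j. Ys j \<omega>) m l i = S.dist_Y l m i \<omega>" for i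
      using dist_nearest_neighbor[of "{..<m}" l "Xs i \<omega>" "\<lambda>j. Ys j \<omega>"] that \<open>l \<ge> 1\<close>
      by (simp add: V_dist_def S.dist_Y_def dist_norm)
    moreover have "R_dist (\<lambda>i. Xs i \<omega>) n k i = S.dist_X k n i \<omega>" if "i < n" for i
      using dist_nearest_neighbor[of "{..<n} - {i}" k "Xs i \<omega>" "\<lambda>j. Xs j \<omega>"] that \<open>Suc k \<le> n\<close> \<open>k \<ge> 1\<close>
      by (simp add: R_dist_def S.dist_X_def dist_norm)
    ultimately show ?thesis
      by (simp add: D_hat_def S.estimator_def)
  qed
  have ev: "\<forall>\<^sub>F nm in ?F. Suc k \<le> fst nm \<and> l \<le> snd nm"
    using eventually_compose_filterlim[OF eventually_ge_at_top filterlim_fst, of "Suc k" sequentially]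
      eventually_compose_filterlim[OF eventually_ge_at_top filterlim_snd, of l sequentially]
    by (rule eventually_conj)
  have Teq: "\<forall>\<^sub>F nm in ?F. T nm = S.estimator k l (fst nm) (snd nm)"
    using ev by eventually_elim (simp add: T_def eq fun_eq_iff)
  note C = S.estimator_consistent[OF \<open>k \<ge> 1\<close> \<open>l \<ge> 1\<close>, folded D, unfolded case_prod_beta]
  have T1: "\<forall>\<^sub>F nm in ?F. S.random_variable borel (T nm) \<and> integrable M (\<lambda>\<omega>. (T nm \<omega> - D)\<^sup>2)"
    using Teq C(1) by eventually_elim simp
  have T2: "((\<lambda>nm. \<integral>\<omega>. (T nm \<omega> - D)\<^sup>2 \<partial>M) \<longlongrightarrow> 0) ?F"
    using C(2) by (rule Lim_transform_eventually) (use Teq in \<open>eventually_elim, simp\<close>)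
  note T3 = S.mean_convergence_of_mean_square[OF T1 T2]
  have T4: "\<forall>\<^sub>F nm in ?F. integrable M (T nm) \<and> integrable M (\<lambda>\<omega>. (T nm \<omega> - D)\<^sup>2)"
    using T1 T3(1) by eventually_elim simp
  show ?thesis
    unfolding case_prod_beta
    by (intro conjI formula T4[unfolded T_def[abs_def]] T3(2)[unfolded T_def[abs_def]] T2[unfolded T_def[abs_def]])
qed

end
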